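(* Suppose Assumptions (A3) and (A4) hold. Fix $\gamma_0\in(0,a_0)$ and suppose $\delta\in\big(0,\min\{a(\alpha)^{1/(1+\alpha)},\,a_0-\gamma_0\}\big)$. Let $\vartheta=\frac{1-2\sigma\gamma_0}{e^{-\omega}+2\delta\sigma}$. Then there exist $N_0\in\mathbb{N}$ and $C_1\in(0,\infty)$ such that for all $\varepsilon>0$ and all $n\ge0$, $$P(\mathcal{W}_1(\mu_n^N,\mu_n)>\varepsilon)\le P(\mathcal{W}_1(\mu_0^N,\mu_0)>2\sigma\gamma_0\vartheta^n\varepsilon)+C_1\varepsilon^{-(1+\alpha)}N^{-\frac{\alpha}{d+2}}$$ for all $N>N_0\big(\max\{1,\log^+\varepsilon\}\big)^{\frac{d+2}{d}}$.
   Context: Setting. Fix integers $d,m\ge1$, a real $d\times d$ matrix $A$ with operator norm $\|A\|$, $\delta>0$, a Borel probability measure $\theta$ on $\mathbb{R}^m$, and a measurable $f:\mathbb{R}^d\times\mathcal{P}_1(\mathbb{R}^d)\times\mathbb{R}^m\to\mathbb{R}^d$. $\mathcal{P}_1(\mathbb{R}^d)$: Borel probability measures on $\mathbb{R}^d$ with finite first moment, with the Wasserstein-1 distance $\mathcal{W}_1(\mu,\nu)=\inf E|X-Y|$ over couplings. Particle system: for each $N\ge1$, $\{X_0^{i,N}\}_{i=1}^N$ are exchangeable, each with law $\mu_0\in\mathcal{P}_1(\mathbb{R}^d)$; $\{\epsilon_n^i\}_{i,n\ge1}$ i.i.d. with law $\theta$, independent of the initial conditions; $X_{n+1}^{i,N}=AX_n^{i,N}+\delta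 f(X_n^{i,N},\mu_n^N,\epsilon_{n+1}^i)$, $\mu_n^N=\frac1N\sum_{i=1}^N\delta_{X_n^{i,N}}$. Nonlinear evolution: $\Psi(\mu)$ is the law of $AX+\delta f(X,\mu,\epsilon)$ with $(X,\epsilon)\sim\mu\otimes\theta$, and $\mu_{n+1}=\Psi(\mu_n)$. $D(z):=\sup\frac{|f(x_1,\mu_1,z)-f(x_2,\mu_2,z)|}{|x_1-x_2|+\mathcal{W}_1(\mu_1,\mu_2)}$ (supremum over $(x_1,\mu_1)\neq(x_2,\mu_2)$), $D_1(z):=|f(0,\delta_0,z)|$, $\sigma:=\int D\,d\theta$, $a_0:=\frac{1-e^{-\omega}}{2\sigma}$, $a(\alpha):=\frac{4^{-\alpha}-e^{-(1+\alpha)\omega}}{2\sigma_1(\alpha)}$, $\log^+ x=\max\{\log x,0\}$. (A3): $\|A\|\le e^{-\omega}$ for some $\omega>0$. (A4): for some $\alpha>0$, $\int|x|^{1+\alpha}\mu_0(dx)<\infty$, $\sigma_1(\alpha):=\int D^{1+\alpha}d\theta<\infty$, $\int D_1^{1+\alpha}d\theta<\infty$. *)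

theory Defs
  imports "HOL-Probability.Probability"
begin

definition P1 :: "('a::euclidean_space) measure set" where
  "P1 = {\<mu>. prob_space \<mu> \<and> sets \<mu> = sets borel \<and> (\<integral>\<^sup>+x. ennreal (norm x) \<partial>\<mu>) < \<infinity>}"

definition couplings :: "('a::euclidean_space) measure \<Rightarrow> 'a measure \<Rightarrow> ('a \<times> 'a) measure set" where
  "couplings \<mu> \<nu> = {\<pi>. prob_space \<pi> \<and> sets \<pi> = sets (borel :: ('a \<times> 'a) measure)
      \<and> distr \<pi> borel fst = \<mu> \<and> distr \<pi> borel snd = \<nu>}"

text \<open>W_1(mu,nu) = inf over couplings of E|X-Y| (finite on P_1).\<close>
definition W1 :: "('a::euclidean_space) measure \<Rightarrow> 'a measure \<Rightarrow> real" where
  "W1 \<mu> \<nu> = enn2real (INF \<pi>\<in>couplings \<mu> \<nu>. \<integral>\<^sup>+p. ennreal (dist (fst p) (snd p)) \<partial>\<pi>)"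

definition emp :: "nat \<Rightarrow> (nat \<Rightarrow> 'a::euclidean_space) \<Rightarrow> 'a measure" where
  "emp N x = distr (measure_pmf (pmf_of_set {1..N})) borel x"

definition Dlip :: "('a::euclidean_space \<Rightarrow> 'a measure \<Rightarrow> 'b \<Rightarrow> 'a) \<Rightarrow> 'b \<Rightarrow> ennreal" where
  "Dlip f z = (SUP q \<in> {(x1, \<mu>1, x2, \<mu>2). \<mu>1 \<in> P1 \<and> \<mu>2 \<in> P1 \<and> (x1, \<mu>1) \<noteq> (x2, \<mu>2)}.
      (case q of (x1, \<mu>1, x2, \<mu>2) \<Rightarrow>
        ennreal (norm (f x1 \<mu>1 z - f x2 \<mu>2 z) / (dist x1 x2 + W1 \<mu>1 \<mu>2))))"

definition D1 :: "('a::euclidean_space \<Rightarrow> 'a measure \<Rightarrow> 'b \<Rightarrow> 'a) \<Rightarrow> 'b \<Rightarrow> real" where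
  "D1 f z = norm (f 0 (return borel 0) z)"

definition enn_powr :: "ennreal \<Rightarrow> real \<Rightarrow> ennreal" where
  "enn_powr x p = (if x = \<infinity> then \<infinity> else ennreal (enn2real x powr p))"

definition sigma :: "('a::euclidean_space \<Rightarrow> 'a measure \<Rightarrow> 'b \<Rightarrow> 'a) \<Rightarrow> 'b measure \<Rightarrow> real" where
  "sigma f \<theta> = enn2real (\<integral>\<^sup>+z. Dlip f z \<partial>\<theta>)"

definition sigma1 :: "('a::euclidean_space \<Rightarrow> 'a measure \<Rightarrow> 'b \<Rightarrow> 'a) \<Rightarrow> 'b measure \<Rightarrow> real \<Rightarrow> real" where
  "sigma1 f \<theta> \<alpha> = enn2real (\<integral>\<^sup>+z. enn_powr (Dlip f z) (1 + \<alpha>) \<partial>\<theta>)"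

definition a0 :: "real \<Rightarrow> real \<Rightarrow> real" where
  "a0 \<omega> s = (1 - exp (- \<omega>)) / (2 * s)"

definition a_alpha :: "real \<Rightarrow> real \<Rightarrow> real \<Rightarrow> real" where
  "a_alpha \<omega> s1 \<alpha> = (4 powr (- \<alpha>) - exp (- (1 + \<alpha>) * \<omega>)) / (2 * s1)"

primrec particle ::
  "real^'d^'d \<Rightarrow> real \<Rightarrow> (real^'d \<Rightarrow> (real^'d) measure \<Rightarrow> 'b \<Rightarrow> real^'d)
   \<Rightarrow> (nat \<Rightarrow> nat \<Rightarrow> 'w \<Rightarrow> real^'d) \<Rightarrow> (nat \<Rightarrow> nat \<Rightarrow> 'w \<Rightarrow> 'b)
   \<Rightarrow> nat \<Rightarrow> nat \<Rightarrow> nat \<Rightarrow> 'w \<Rightarrow> real^'d" where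
  "particle A \<delta> f X0 eps N 0 i \<omega> = X0 N i \<omega>"
| "particle A \<delta> f X0 eps N (Suc n) i \<omega> =
     A *v particle A \<delta> f X0 eps N n i \<omega>
     + \<delta> *\<^sub>R f (particle A \<delta> f X0 eps N n i \<omega>)
                (emp N (\<lambda>j. particle A \<delta> f X0 eps N n j \<omega>)) (eps (Suc n) i \<omega>)"

definition emp_particle ::
  "real^'d^'d \<Rightarrow> real \<Rightarrow> (real^'d \<Rightarrow> (real^'d) measure \<Rightarrow> 'b \<Rightarrow> real^'d)
   \<Rightarrow> (nat \<Rightarrow> nat \<Rightarrow> 'w \<Rightarrow> real^'d) \<Rightarrow> (nat \<Rightarrow> nat \<Rightarrow> 'w \<Rightarrow> 'b)
   \<Rightarrow> nat \<Rightarrow> nat \<Rightarrow> 'w \<Rightarrow> (real^'d) measure" where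
  "emp_particle A \<delta> f X0 eps N n \<omega> = emp N (\<lambda>j. particle A \<delta> f X0 eps N n j \<omega>)"

definition Psi ::
  "real^'d^'d \<Rightarrow> real \<Rightarrow> (real^'d \<Rightarrow> (real^'d) measure \<Rightarrow> 'b::euclidean_space \<Rightarrow> real^'d)
   \<Rightarrow> 'b measure \<Rightarrow> (real^'d) measure \<Rightarrow> (real^'d) measure" where
  "Psi A \<delta> f \<theta> \<mu> = distr (\<mu> \<Otimes>\<^sub>M \<theta>) borel (\<lambda>(x, z). A *v x + \<delta> *\<^sub>R f x \<mu> z)"

primrec mu_nl ::
  "real^'d^'d \<Rightarrow> real \<Rightarrow> (real^'d \<Rightarrow> (real^'d) measure \<Rightarrow> 'b::euclidean_space \<Rightarrow> real^'d)
   \<Rightarrow> 'b measure \<Rightarrow> (real^'d) measure \<Rightarrow> nat \<Rightarrow> (real^'d) measure" where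
  "mu_nl A \<delta> f \<theta> \<mu>0 0 = \<mu>0"
| "mu_nl A \<delta> f \<theta> \<mu>0 (Suc n) = Psi A \<delta> f \<theta> (mu_nl A \<delta> f \<theta> \<mu>0 n)"

end

theory Submission
  imports Defs
begin

text \<open>
  Consider one time step of the particle system. Given the present state, the new particles are independent
  and the average of their laws is \<open>\<Psi>\<close> applied to the present empirical measure. Cut the ball of radius
  \<open>R\<close> into about \<open>q\<^sup>d\<close> small cubes, where \<open>q = N\<^bsup>1/(d+2)\<^esup>\<close>: up to the diameter of the cubes
  and the mass transported outside of the ball, the Wasserstein distance between the new empirical measure and
  its conditional mean is at most \<open>R\<close> times the total variation distance on the cubes. Hoeffding's inequality for
  each of the \<open>2\<close> to the power \<open>q\<^sup>d\<close> unions of cubes controls the latter. With \<open>R\<close> of order \<open>q\<epsilon>\<close> the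
  exponent in Hoeffding's inequality also has order \<open>q\<^sup>d\<close> and wins by the choice of the constants, while the mass
  outside of the ball is controlled by Markov's inequality and \<open>(1 + \<alpha>)\<close>-th moments, which are bounded uniformly
  in time and \<open>N\<close>. This yields the rate \<open>q\<^bsup>-\<alpha>\<^esup>\<close>.

  \<open>\<Psi>\<close> contracts the Wasserstein distance by the factor \<open>e\<^bsup>-\<omega>\<^esup> + 2\<delta>\<sigma> < 1\<close>, so a fluctuation that occurs
  \<open>j\<close> steps before the final time may exceed its share of \<open>\<epsilon>\<close> by the \<open>j\<close>-th power of the ratio in the theorem
  (called \<open>\<tau>\<close> below). The union bound over all times is therefore a geometric series.
\<close>

section \<open>Couplings and the Wasserstein distance\<close>

text \<open>The scale q comes from a balance: cubes of side of order \<epsilon> in a ball of radius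
  R of order q \<epsilon> number about q^d, and a deviation of order \<epsilon> / R, that is 1 / q,
  has Hoeffding exponent of order N / q^2, which is q^d for N = q^(d+2). A share of this exponent
  must also produce the factor \<epsilon>^(-(1+\<alpha>)); for large \<epsilon> this asks for q^d
  \<ge> (1+\<alpha>) ln \<epsilon>, whence the logarithm in the lower bound on N. The two conditions
  on \<delta> serve different ends: \<delta> < a0 - \<gamma>0 says that \<tau> > 1, and
  \<delta>^(1+\<alpha>) < a(\<alpha>) says that the recursion for the moments has a factor below 1.
  Measurability is the technical obstacle: \<open>Dlip\<close> is a supremum and \<open>W1\<close>
  an infimum over an uncountable family. The former is used only through increments between two
  fixed arguments, the latter is replaced by events on tails and on masses of finitely many sets.
  The gluing of couplings and the transport between cells use explicit densities with respect to
  product measures, so that checking marginals means integrating out one variable.\<close>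

lemma density_pair_marginals:
  fixes h :: "'a \<times> 'b \<Rightarrow> ennreal"
  assumes M1: "sigma_finite_measure M1" and M2: "sigma_finite_measure M2"
    and h[measurable]: "h \<in> borel_measurable (M1 \<Otimes>\<^sub>M M2)"
    and h1: "AE x in M1. (\<integral>\<^sup>+y. h (x, y) \<partial>M2) = 1"
    and h2: "AE y in M2. (\<integral>\<^sup>+x. h (x, y) \<partial>M1) = 1"
  shows "distr (density (M1 \<Otimes>\<^sub>M M2) h) M1 fst = M1"
    and "distr (density (M1 \<Otimes>\<^sub>M M2) h) M2 snd = M2"
proof -
  interpret M1: sigma_finite_measure M1 by fact
  interpret M2: sigma_finite_measure M2 by fact
  interpret P: pair_sigma_finite M1 M2 ..
  show "distr (density (M1 \<Otimes>\<^sub>M M2) h) M1 fst = M1"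
  proof (rule measure_eqI)
    fix A assume "A \<in> sets (distr (density (M1 \<Otimes>\<^sub>M M2) h) M1 fst)"
    then have A[measurable]: "A \<in> sets M1" by simp
    have "emeasure (distr (density (M1 \<Otimes>\<^sub>M M2) h) M1 fst) A
        = (\<integral>\<^sup>+p. indicator A (fst p) \<partial>density (M1 \<Otimes>\<^sub>M M2) h)"
      by (simp add: nn_integral_distr flip: nn_integral_indicator)
    also have "\<dots> = (\<integral>\<^sup>+p. h p * indicator A (fst p) \<partial>(M1 \<Otimes>\<^sub>M M2))"
      by (subst nn_integral_density) auto
    also have "\<dots> = (\<integral>\<^sup>+x. \<integral>\<^sup>+y. h (x, y) * indicator A x \<partial>M2 \<partial>M1)"
      by (subst M2.nn_integral_fst[symmetric]) auto
    also have "\<dots> = (\<integral>\<^sup>+x. (\<integral>\<^sup>+y. h (x, y) \<partial>M2) * indicator A x \<partial>M1)"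
      by (intro nn_integral_cong nn_integral_multc) measurable
    \<comment> \<open>The sections of \<open>h\<close> have integral 1 only almost everywhere, which
      leaves room for normalising constants that vanish on null sets.\<close>
    also have "\<dots> = (\<integral>\<^sup>+x. indicator A x \<partial>M1)"
      using h1 by (intro nn_integral_cong_AE) auto
    finally show "emeasure (distr (density (M1 \<Otimes>\<^sub>M M2) h) M1 fst) A = emeasure M1 A"
      by simp
  qed simp
  show "distr (density (M1 \<Otimes>\<^sub>M M2) h) M2 snd = M2"
  proof (rule measure_eqI)
    fix A assume "A \<in> sets (distr (density (M1 \<Otimes>\<^sub>M M2) h) M2 snd)"
    then have A[measurable]: "A \<in> sets M2" by simp
    have "emeasure (distr (density (M1 \<Otimes>\<^sub>M M2) h) M2 snd) A
        = (\<integral>\<^sup>+p. indicator A (snd p) \<partial>density (M1 \<Otimes>\<^sub>M M2) h)"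
      by (simp add: nn_integral_distr flip: nn_integral_indicator)
    also have "\<dots> = (\<integral>\<^sup>+p. h p * indicator A (snd p) \<partial>(M1 \<Otimes>\<^sub>M M2))"
      by (subst nn_integral_density) auto
    also have "\<dots> = (\<integral>\<^sup>+y. \<integral>\<^sup>+x. h (x, y) * indicator A y \<partial>M1 \<partial>M2)"
      by (subst P.nn_integral_snd[symmetric]) auto
    also have "\<dots> = (\<integral>\<^sup>+y. (\<integral>\<^sup>+x. h (x, y) \<partial>M1) * indicator A y \<partial>M2)"
      by (intro nn_integral_cong nn_integral_multc) measurable
    also have "\<dots> = (\<integral>\<^sup>+y. indicator A y \<partial>M2)"
      using h2 by (intro nn_integral_cong_AE) auto
    finally show "emeasure (distr (density (M1 \<Otimes>\<^sub>M M2) h) M2 snd) A = emeasure M2 A"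
      by simp
  qed simp
qed

abbreviation cost :: "('a::euclidean_space \<times> 'a) measure \<Rightarrow> ennreal" where
  "cost \<pi> \<equiv> (\<integral>\<^sup>+p. ennreal (dist (fst p) (snd p)) \<partial>\<pi>)"

lemma P1_D:
  assumes "\<mu> \<in> P1"
  shows "prob_space \<mu>" "sets \<mu> = sets borel" "(\<integral>\<^sup>+x. ennreal (norm x) \<partial>\<mu>) < \<infinity>"
  using assms by (auto simp: P1_def)

lemma couplings_D:
  assumes "\<pi> \<in> couplings \<mu> \<nu>"
  shows "prob_space \<pi>" "sets \<pi> = sets borel" "distr \<pi> borel fst = \<mu>" "distr \<pi> borel snd = \<nu>"
  using assms by (auto simp: couplings_def)

lemma measurable_fst_borel: "(fst :: 'a::euclidean_space \<times> 'b::euclidean_space \<Rightarrow> 'a) \<in> borel \<rightarrow>\<^sub>M borel"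
  and measurable_snd_borel: "(snd :: 'a::euclidean_space \<times> 'b::euclidean_space \<Rightarrow> 'b) \<in> borel \<rightarrow>\<^sub>M borel"
  by (simp_all add: borel_prod[symmetric])

lemma distr_pair_coupling:
  assumes P: "prob_space P" and X[measurable]: "X \<in> P \<rightarrow>\<^sub>M borel" and Y[measurable]: "Y \<in> P \<rightarrow>\<^sub>M borel"
  shows "distr P borel (\<lambda>s. (X s, Y s)) \<in> couplings (distr P borel X) (distr P borel Y)"
proof -
  have [measurable]: "(\<lambda>s. (X s, Y s)) \<in> P \<rightarrow>\<^sub>M borel"
    by (simp add: borel_prod[symmetric])
  show ?thesis
    by (auto simp: couplings_def distr_distr[OF measurable_fst_borel] distr_distr[OF measurable_snd_borel]
        comp_def intro!: prob_space.prob_space_distr[OF P])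
qed

lemma cost_distr_pair:
  assumes X[measurable]: "X \<in> P \<rightarrow>\<^sub>M borel" and Y[measurable]: "Y \<in> P \<rightarrow>\<^sub>M borel"
  shows "cost (distr P borel (\<lambda>s. (X s, Y s))) = (\<integral>\<^sup>+s. ennreal (dist (X s) (Y s)) \<partial>P)"
proof -
  have [measurable]: "(\<lambda>s. (X s, Y s)) \<in> P \<rightarrow>\<^sub>M borel"
    by (simp add: borel_prod[symmetric])
  have [measurable]: "(\<lambda>p. dist (fst p) (snd p :: 'b)) \<in> borel_measurable borel"
    by (intro borel_measurable_continuous_onI continuous_intros)
  show ?thesis by (subst nn_integral_distr) auto
qed

text \<open>The product measure is a coupling, and its cost is at most the sum of the two first
  moments. Finiteness ensures that \<open>enn2real\<close> in \<open>W1\<close> returns the infimum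
  itself and not the default value 0.\<close>

lemma INF_cost_finite:
  assumes mu: "\<mu> \<in> P1" and nu: "\<nu> \<in> P1"
  shows "(INF \<pi>\<in>couplings \<mu> \<nu>. cost \<pi>) < \<infinity>"
proof -
  note [measurable_cong] = P1_D(2)[OF mu] P1_D(2)[OF nu]
  interpret mu: prob_space \<mu> using P1_D[OF mu] by simp
  interpret nu: prob_space \<nu> using P1_D[OF nu] by simp
  interpret P: pair_prob_space \<mu> \<nu> ..
  let ?X = "fst :: 'a \<times> 'a \<Rightarrow> 'a" and ?Y = "snd :: 'a \<times> 'a \<Rightarrow> 'a"
  have e: "distr (\<mu> \<Otimes>\<^sub>M \<nu>) borel ?X = \<mu>" "distr (\<mu> \<Otimes>\<^sub>M \<nu>) borel ?Y = \<nu>"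
    using density_pair_marginals[of \<mu> \<nu> "\<lambda>_. 1"] mu.sigma_finite_measure_axioms nu.sigma_finite_measure_axioms
    by (simp_all add: density_1 mu.emeasure_space_1 nu.emeasure_space_1 P1_D(2)[OF mu] P1_D(2)[OF nu] cong: distr_cong)
  have "distr (\<mu> \<Otimes>\<^sub>M \<nu>) borel (\<lambda>s. (?X s, ?Y s)) \<in> couplings \<mu> \<nu>"
    using distr_pair_coupling[of "\<mu> \<Otimes>\<^sub>M \<nu>" ?X ?Y] e P.prob_space_axioms by simp
  then have "(INF \<pi>\<in>couplings \<mu> \<nu>. cost \<pi>) \<le> cost (distr (\<mu> \<Otimes>\<^sub>M \<nu>) borel (\<lambda>s. (?X s, ?Y s)))"
    by (rule INF_lower)
  also have "\<dots> = (\<integral>\<^sup>+s. ennreal (dist (?X s) (?Y s)) \<partial>(\<mu> \<Otimes>\<^sub>M \<nu>))"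
    by (rule cost_distr_pair) auto
  also have "\<dots> \<le> (\<integral>\<^sup>+s. ennreal (norm (?X s)) + ennreal (norm (?Y s)) \<partial>(\<mu> \<Otimes>\<^sub>M \<nu>))"
    by (intro nn_integral_mono)
       (auto simp: dist_norm norm_triangle_ineq4 simp flip: ennreal_plus intro!: ennreal_leI)
  also have "\<dots> = (\<integral>\<^sup>+s. ennreal (norm (?X s)) \<partial>(\<mu> \<Otimes>\<^sub>M \<nu>)) + (\<integral>\<^sup>+s. ennreal (norm (?Y s)) \<partial>(\<mu> \<Otimes>\<^sub>M \<nu>))"
    by (intro nn_integral_add) auto
  also have "(\<integral>\<^sup>+s. ennreal (norm (?X s)) \<partial>(\<mu> \<Otimes>\<^sub>M \<nu>)) = (\<integral>\<^sup>+x. ennreal (norm x) \<partial>\<mu>)"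
    by (subst (2) e(1)[symmetric]) (simp add: nn_integral_distr)
  also have "(\<integral>\<^sup>+s. ennreal (norm (?Y s)) \<partial>(\<mu> \<Otimes>\<^sub>M \<nu>)) = (\<integral>\<^sup>+x. ennreal (norm x) \<partial>\<nu>)"
    by (subst (2) e(2)[symmetric]) (simp add: nn_integral_distr)
  also have "(\<integral>\<^sup>+x. ennreal (norm x) \<partial>\<mu>) + (\<integral>\<^sup>+x. ennreal (norm x) \<partial>\<nu>) < \<infinity>"
    using P1_D(3)[OF mu] P1_D(3)[OF nu] by simp
  finally show ?thesis .
qed

lemma W1_nonneg: "0 \<le> W1 \<mu> \<nu>"
  by (simp add: W1_def)

lemma W1_le_cost:
  assumes "\<pi> \<in> couplings \<mu> \<nu>" "cost \<pi> \<le> ennreal c" "0 \<le> c"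
  shows "W1 \<mu> \<nu> \<le> c"
  unfolding W1_def
  by (rule enn2real_leI) (use assms in \<open>auto intro: INF_lower2\<close>)

lemma exists_coupling:
  assumes "\<mu> \<in> P1" "\<nu> \<in> P1" "0 < e"
  obtains \<pi> where "\<pi> \<in> couplings \<mu> \<nu>" "cost \<pi> \<le> ennreal (W1 \<mu> \<nu> + e)"
proof -
  have fin: "(INF \<pi>\<in>couplings \<mu> \<nu>. cost \<pi>) < \<infinity>" (is "?I < _") using assms by (intro INF_cost_finite)
  then have "?I = ennreal (W1 \<mu> \<nu>)"
    by (simp add: W1_def)
  also have "\<dots> < ennreal (W1 \<mu> \<nu> + e)"
    using assms by (simp add: W1_nonneg ennreal_lessI)
  finally have "?I < ennreal (W1 \<mu> \<nu> + e)" .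
  then show ?thesis using that by (auto simp: INF_less_iff intro: less_imp_le)
qed

lemma W1_distr_le:
  assumes P: "prob_space P" and X[measurable]: "X \<in> P \<rightarrow>\<^sub>M borel" and Y[measurable]: "Y \<in> P \<rightarrow>\<^sub>M borel"
    and le: "(\<integral>\<^sup>+s. ennreal (dist (X s) (Y s)) \<partial>P) \<le> ennreal c" "0 \<le> c"
  shows "W1 (distr P borel X) (distr P borel Y) \<le> c"
  using le by (intro W1_le_cost[OF distr_pair_coupling[OF P X Y]]) (auto simp: cost_distr_pair)

section \<open>The triangle inequality by gluing couplings\<close>

text \<open>Each point is sent to the index of the first element of a countable dense sequence at
  distance less than \<open>r / 2\<close>; taking the least index makes the label unique and
  measurable.\<close>

lemma ex_countable_cells:
  assumes "0 < r"
  shows "\<exists>c :: 'a::euclidean_space \<Rightarrow> nat. c \<in> borel \<rightarrow>\<^sub>M count_space UNIV \<and> (\<forall>x y. c x = c y \<longrightarrow> dist x y \<le> r)"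
proof -
  obtain D :: "'a set" where D: "countable D" "\<And>X. open X \<Longrightarrow> X \<noteq> {} \<Longrightarrow> \<exists>d\<in>D. d \<in> X"
    using countable_dense_setE by blast
  have ne: "D \<noteq> {}" using D(2)[of UNIV] by auto
  define q where "q = from_nat_into D"
  have q: "\<exists>n. dist x (q n) < r / 2" for x
  proof -
    obtain d where "d \<in> D" "d \<in> ball x (r/2)"
      using D(2)[of "ball x (r/2)"] assms by auto
    then show ?thesis using D(1) from_nat_into_surj[of D d] unfolding q_def by (metis mem_ball)
  qed
  define c where "c x = (LEAST n. dist x (q n) < r / 2)" for x
  have "c \<in> borel \<rightarrow>\<^sub>M count_space UNIV"
    unfolding c_def by measurable
  moreover have "dist x y \<le> r" if "c x = c y" for x y
    using LeastI_ex[OF q[of x]] LeastI_ex[OF q[of y]] that dist_triangle2[of x y "q (c x)"]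
    unfolding c_def by auto
  ultimately show ?thesis by blast
qed

text \<open>Instead of disintegrating over the common marginal, the two couplings are glued along the
  cells of a countable partition into sets of diameter at most \<open>r\<close>.\<close>

lemma approximate_gluing:
  fixes \<mu> \<nu> \<rho> :: "'a::euclidean_space measure"
  assumes p1: "\<pi>1 \<in> couplings \<mu> \<nu>" and p2: "\<pi>2 \<in> couplings \<nu> \<rho>" and r: "0 < r"
  shows "\<exists>\<pi>\<in>couplings \<mu> \<rho>. cost \<pi> \<le> cost \<pi>1 + ennreal r + cost \<pi>2"
proof -
  obtain c :: "'a \<Rightarrow> nat" where c[measurable]: "c \<in> borel \<rightarrow>\<^sub>M count_space UNIV"
    and cr: "\<And>x y. c x = c y \<Longrightarrow> dist x y \<le> r"
    using ex_countable_cells[OF r] by blast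
  interpret p1: prob_space \<pi>1 using couplings_D[OF p1] by simp
  interpret p2: prob_space \<pi>2 using couplings_D[OF p2] by simp
  have s1[measurable_cong]: "sets \<pi>1 = sets (borel \<Otimes>\<^sub>M borel)"
    and s2[measurable_cong]: "sets \<pi>2 = sets (borel \<Otimes>\<^sub>M borel)"
    unfolding borel_prod using couplings_D[OF p1] couplings_D[OF p2] by simp_all
  have nu1: "\<nu> = distr \<pi>1 borel snd" and nu2: "\<nu> = distr \<pi>2 borel fst"
    and mu: "\<mu> = distr \<pi>1 borel fst" and rho: "\<rho> = distr \<pi>2 borel snd"
    using couplings_D[OF p1] couplings_D[OF p2] by auto
  have snu[measurable_cong]: "sets \<nu> = sets borel" by (simp add: nu1)
  interpret nu: prob_space \<nu> unfolding nu1 by (rule p1.prob_space_distr) measurable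
  define v where "v n = emeasure \<nu> {u. c u = n}" for n
  have [measurable]: "{u. c u = n} \<in> sets borel" for n by measurable
  have vfin: "v n \<noteq> \<infinity>" for n by (simp add: v_def)
  have vinv: "inverse (v n) * v n = 1" if "v n \<noteq> 0" for n
    using that vfin[of n] by (simp add: mult.commute[of "inverse _"] less_top flip: divide_ennreal_def)
  \<comment> \<open>There are countably many cells, so those of mass 0 can be discarded together; on
    the others division by the mass is legitimate.\<close>
  have "AE y in \<nu>. \<forall>n. v n = 0 \<longrightarrow> c y \<noteq> n"
  proof (subst AE_all_countable, intro allI)
    fix n show "AE y in \<nu>. v n = 0 \<longrightarrow> c y \<noteq> n"
    proof (cases "v n = 0")
      case True
      then have "{u. c u = n} \<in> null_sets \<nu>" by (simp add: v_def null_sets_def snu)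
      from AE_not_in[OF this] show ?thesis by simp
    qed simp
  qed
  then have nz: "AE y in \<nu>. v (c y) \<noteq> 0" by auto
  have nz1: "AE p in \<pi>1. v (c (snd p)) \<noteq> 0"
    using nz unfolding nu1 by (subst (asm) AE_distr_iff) auto
  have nz2: "AE p in \<pi>2. v (c (fst p)) \<noteq> 0"
    using nz unfolding nu2 by (subst (asm) AE_distr_iff) auto
  have v1: "v n = emeasure \<pi>1 {p. c (snd p) = n}" for n
    unfolding v_def nu1 by (subst emeasure_distr) (auto simp: sets_eq_imp_space_eq[OF s1] space_pair_measure vimage_def)
  have v2: "v n = emeasure \<pi>2 {p. c (fst p) = n}" for n
    unfolding v_def nu2 by (subst emeasure_distr) (auto simp: sets_eq_imp_space_eq[OF s2] space_pair_measure vimage_def)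
  \<comment> \<open>Given the cell of the middle point, the two couplings are made independent: the
    pair of pairs is conditioned on both middle points having the same label. Their laws agree, so
    one normalisation \<open>v\<close> serves both marginals.\<close>
  define h :: "('a \<times> 'a) \<times> 'a \<times> 'a \<Rightarrow> ennreal" where
    "h w = (if c (snd (fst w)) = c (fst (snd w)) then inverse (v (c (snd (fst w)))) else 0)" for w
  have cells: "(\<lambda>w. c (snd (fst w))) \<in> \<pi>1 \<Otimes>\<^sub>M \<pi>2 \<rightarrow>\<^sub>M count_space UNIV"
    "(\<lambda>w. c (fst (snd w))) \<in> \<pi>1 \<Otimes>\<^sub>M \<pi>2 \<rightarrow>\<^sub>M count_space UNIV"
    by (auto intro!: measurable_compose[OF _ c])
  have "(\<lambda>w. inverse (v (c (snd (fst w))))) \<in> borel_measurable (\<pi>1 \<Otimes>\<^sub>M \<pi>2)"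
    by (rule measurable_compose[OF cells(1), of "\<lambda>n. inverse (v n)"]) simp
  moreover have "{w \<in> space (\<pi>1 \<Otimes>\<^sub>M \<pi>2). real (c (snd (fst w))) = real (c (fst (snd w)))} \<in> sets (\<pi>1 \<Otimes>\<^sub>M \<pi>2)"
    by (intro borel_measurable_eq measurable_compose[OF cells(1)] measurable_compose[OF cells(2)]) simp_all
  ultimately have [measurable]: "h \<in> borel_measurable (\<pi>1 \<Otimes>\<^sub>M \<pi>2)"
    unfolding h_def by (intro measurable_If) simp_all
  have [measurable]: "{q. c (snd q) = n} \<in> sets \<pi>1" "{q. c (fst q) = n} \<in> sets \<pi>2" for n
  proof -
    have "{q \<in> space \<pi>1. c (snd q) = n} \<in> sets \<pi>1" "{q \<in> space \<pi>2. c (fst q) = n} \<in> sets \<pi>2"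
      by measurable
    then show "{q. c (snd q) = n} \<in> sets \<pi>1" "{q. c (fst q) = n} \<in> sets \<pi>2"
      by (simp_all add: sets_eq_imp_space_eq[OF s1] sets_eq_imp_space_eq[OF s2] space_pair_measure)
  qed
  have h1: "AE p in \<pi>1. (\<integral>\<^sup>+q. h (p, q) \<partial>\<pi>2) = 1"
    using nz1
  proof eventually_elim
    fix p :: "'a \<times> 'a" assume nz: "v (c (snd p)) \<noteq> 0"
    have "(\<integral>\<^sup>+q. h (p, q) \<partial>\<pi>2) = (\<integral>\<^sup>+q. inverse (v (c (snd p))) * indicator {q. c (fst q) = c (snd p)} q \<partial>\<pi>2)"
      by (intro nn_integral_cong) (auto simp: h_def indicator_def)
    also have "\<dots> = inverse (v (c (snd p))) * v (c (snd p))"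
      by (subst nn_integral_cmult) (auto simp: v2)
    finally show "(\<integral>\<^sup>+q. h (p, q) \<partial>\<pi>2) = 1" using vinv[OF nz] by simp
  qed
  have h2: "AE q in \<pi>2. (\<integral>\<^sup>+p. h (p, q) \<partial>\<pi>1) = 1"
    using nz2
  proof eventually_elim
    fix q :: "'a \<times> 'a" assume nz: "v (c (fst q)) \<noteq> 0"
    have "(\<integral>\<^sup>+p. h (p, q) \<partial>\<pi>1) = (\<integral>\<^sup>+p. inverse (v (c (fst q))) * indicator {p. c (snd p) = c (fst q)} p \<partial>\<pi>1)"
      by (intro nn_integral_cong) (auto simp: h_def indicator_def)
    also have "\<dots> = inverse (v (c (fst q))) * v (c (fst q))"
      by (subst nn_integral_cmult) (auto simp: v1)
    finally show "(\<integral>\<^sup>+p. h (p, q) \<partial>\<pi>1) = 1" using vinv[OF nz] by simp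
  qed
  define G where "G = density (\<pi>1 \<Otimes>\<^sub>M \<pi>2) h"
  have G1: "distr G \<pi>1 fst = \<pi>1" and G2: "distr G \<pi>2 snd = \<pi>2"
    unfolding G_def using h1 h2
    by (auto intro!: density_pair_marginals p1.sigma_finite_measure_axioms p2.sigma_finite_measure_axioms)
  have sG[measurable_cong]: "sets G = sets (\<pi>1 \<Otimes>\<^sub>M \<pi>2)" by (simp add: G_def)
  have "prob_space (distr G \<pi>1 fst)" unfolding G1 by (fact p1.prob_space_axioms)
  then interpret G: prob_space G by (rule prob_space_distrD[rotated]) measurable
  define X where "X w = fst (fst w)" for w :: "('a \<times> 'a) \<times> 'a \<times> 'a"
  define Y where "Y w = snd (snd w)" for w :: "('a \<times> 'a) \<times> 'a \<times> 'a"
  have X[measurable]: "X \<in> G \<rightarrow>\<^sub>M borel" and Y[measurable]: "Y \<in> G \<rightarrow>\<^sub>M borel"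
    unfolding X_def Y_def by measurable
  have "distr G borel X = distr (distr G \<pi>1 fst) borel fst"
    by (subst distr_distr) (auto simp: X_def[abs_def] comp_def)
  then have dX: "distr G borel X = \<mu>" by (simp add: G1 mu)
  have "distr G borel Y = distr (distr G \<pi>2 snd) borel snd"
    by (subst distr_distr) (auto simp: Y_def[abs_def] comp_def)
  then have dY: "distr G borel Y = \<rho>" by (simp add: G2 rho)
  \<comment> \<open>The density vanishes unless the two middle points share a cell; this is the only
    place where the glued path jumps.\<close>
  have ae: "AE w in G. dist (snd (fst w)) (fst (snd w)) \<le> r"
    unfolding G_def by (subst AE_density) (auto simp: h_def indicator_def cr)
  have "(\<integral>\<^sup>+w. ennreal (dist (X w) (Y w)) \<partial>G)
     \<le> (\<integral>\<^sup>+w. ennreal (dist (fst (fst w)) (snd (fst w))) + ennreal r + ennreal (dist (fst (snd w)) (snd (snd w))) \<partial>G)"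
    using ae
  proof (intro nn_integral_mono_AE, eventually_elim)
    fix w :: "('a \<times> 'a) \<times> 'a \<times> 'a" assume "dist (snd (fst w)) (fst (snd w)) \<le> r"
    then have "dist (X w) (Y w) \<le> dist (fst (fst w)) (snd (fst w)) + r + dist (fst (snd w)) (snd (snd w))"
      unfolding X_def Y_def by metric
    then show "ennreal (dist (X w) (Y w)) \<le> ennreal (dist (fst (fst w)) (snd (fst w))) + ennreal r + ennreal (dist (fst (snd w)) (snd (snd w)))"
      using r by (simp flip: ennreal_plus add: ennreal_leI)
  qed
  also have "\<dots> = (\<integral>\<^sup>+w. ennreal (dist (fst (fst w)) (snd (fst w))) \<partial>G) + ennreal r + (\<integral>\<^sup>+w. ennreal (dist (fst (snd w)) (snd (snd w))) \<partial>G)"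
    by (simp add: nn_integral_add G.emeasure_space_1)
  also have "(\<integral>\<^sup>+w. ennreal (dist (fst (fst w)) (snd (fst w))) \<partial>G) = cost (distr G \<pi>1 fst)"
    by (subst nn_integral_distr) auto
  also have "(\<integral>\<^sup>+w. ennreal (dist (fst (snd w)) (snd (snd w))) \<partial>G) = cost (distr G \<pi>2 snd)"
    by (subst nn_integral_distr) auto
  finally have "cost (distr G borel (\<lambda>w. (X w, Y w))) \<le> cost \<pi>1 + ennreal r + cost \<pi>2"
    by (simp add: cost_distr_pair G1 G2)
  moreover have "distr G borel (\<lambda>w. (X w, Y w)) \<in> couplings \<mu> \<rho>"
    using distr_pair_coupling[OF G.prob_space_axioms X Y] dX dY by simp
  ultimately show ?thesis by blast
qed

lemma W1_triangle:
  assumes mu: "\<mu> \<in> P1" and nu: "\<nu> \<in> P1" and rho: "\<rho> \<in> P1"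
  shows "W1 \<mu> \<rho> \<le> W1 \<mu> \<nu> + W1 \<nu> \<rho>"
proof (rule field_le_epsilon)
  \<comment> \<open>A third of \<open>e\<close> goes to each of the two nearly optimal couplings and
    a third to the width of the gluing cells.\<close>
  fix e :: real assume e: "0 < e"
  obtain \<pi>1 where p1: "\<pi>1 \<in> couplings \<mu> \<nu>" "cost \<pi>1 \<le> ennreal (W1 \<mu> \<nu> + e / 3)"
    using exists_coupling[OF mu nu, of "e/3"] e by auto
  obtain \<pi>2 where p2: "\<pi>2 \<in> couplings \<nu> \<rho>" "cost \<pi>2 \<le> ennreal (W1 \<nu> \<rho> + e / 3)"
    using exists_coupling[OF nu rho, of "e/3"] e by auto
  obtain \<pi> where p: "\<pi> \<in> couplings \<mu> \<rho>" "cost \<pi> \<le> cost \<pi>1 + ennreal (e / 3) + cost \<pi>2"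
    using approximate_gluing[OF p1(1) p2(1), of "e / 3"] e by auto
  note p(2)
  also have "cost \<pi>1 + ennreal (e / 3) + cost \<pi>2
      \<le> ennreal (W1 \<mu> \<nu> + e / 3) + ennreal (e / 3) + ennreal (W1 \<nu> \<rho> + e / 3)"
    using p1 p2 by (intro add_mono) auto
  also have "\<dots> = ennreal (W1 \<mu> \<nu> + W1 \<nu> \<rho> + e)"
    using e by (simp add: W1_nonneg flip: ennreal_plus)
  finally show "W1 \<mu> \<rho> \<le> W1 \<mu> \<nu> + W1 \<nu> \<rho> + e"
    using e by (intro W1_le_cost[OF p(1)]) (auto simp: W1_nonneg)
qed

section \<open>Transport within and between cells\<close>

lemma sum_indicator_disjoint:
  fixes c :: "'i \<Rightarrow> real"
  assumes "finite K" "disjoint_family_on B K" "k \<in> K" "x \<in> B k"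
  shows "(\<Sum>j\<in>K. c j * indicator (B j) x) = c k"
proof -
  have "(\<Sum>j\<in>K. c j * indicator (B j) x) = (\<Sum>j\<in>K. if j = k then c k else 0)"
    using assms by (intro sum.cong) (auto simp: indicator_def disjoint_family_on_def)
  then show ?thesis using assms by simp
qed

text \<open>The part of \<open>\<mu>\<close> that remains when the fraction \<open>c k\<close> of its mass in \<open>B k\<close> is removed.\<close>

lemma residual_mass:
  fixes \<mu> :: "'a::euclidean_space measure" and c :: "'i \<Rightarrow> real"
  assumes mu: "\<mu> \<in> P1" and K: "finite K" and disj: "disjoint_family_on B K"
    and B: "\<And>k. k \<in> K \<Longrightarrow> B k \<in> sets borel"
    and bnd: "\<And>k x. k \<in> K \<Longrightarrow> x \<in> B k \<Longrightarrow> norm x \<le> R"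
    and c: "\<And>k. k \<in> K \<Longrightarrow> 0 \<le> c k" "\<And>k. k \<in> K \<Longrightarrow> c k \<le> 1"
    and off: "(\<integral>\<^sup>+x. ennreal (norm x) * indicator (- (\<Union>k\<in>K. B k)) x \<partial>\<mu>) \<le> ennreal a" "0 \<le> a" and R: "0 \<le> R"
  defines "res \<equiv> \<lambda>x. 1 - (\<Sum>k\<in>K. c k * indicator (B k) x)"
  shows "res \<in> borel_measurable borel"
    and "\<And>x. 0 \<le> res x"
    and "(\<integral>\<^sup>+x. ennreal (res x) \<partial>\<mu>) = ennreal (1 - (\<Sum>k\<in>K. c k * measure \<mu> (B k)))"
    and "0 \<le> 1 - (\<Sum>k\<in>K. c k * measure \<mu> (B k))"
    and "(\<integral>\<^sup>+x. ennreal (norm x * res x) \<partial>\<mu>) \<le> ennreal (a + R * (\<Sum>k\<in>K. measure \<mu> (B k) - c k * measure \<mu> (B k)))"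
proof -
  interpret prob_space \<mu> using P1_D[OF mu] by simp
  have s[measurable_cong]: "sets \<mu> = sets borel" using P1_D[OF mu] by simp
  have sp: "space \<mu> = UNIV" using sets_eq_imp_space_eq[OF s] by simp
  note B[measurable]
  show m[measurable]: "res \<in> borel_measurable borel" unfolding res_def by measurable
  have in_B: "res x = 1 - c k" if "k \<in> K" "x \<in> B k" for k x
    using sum_indicator_disjoint[OF K disj that, of c] by (simp add: res_def)
  have off_B: "res x = 1" if "\<And>k. k \<in> K \<Longrightarrow> x \<notin> B k" for x
    using that by (simp add: res_def)
  show nonneg: "0 \<le> res x" for x
    using in_B[of _ x] off_B[of x] c by (cases "\<exists>k\<in>K. x \<in> B k") auto
  have int: "integrable \<mu> (\<lambda>x. \<Sum>k\<in>K. c k * indicator (B k) x)"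
    by (intro Bochner_Integration.integrable_sum integrable_mult_right integrable_real_indicator)
       (auto simp: s B less_top[symmetric])
  have "(LINT x|\<mu>. res x) = 1 - (\<Sum>k\<in>K. c k * measure \<mu> (B k))"
    unfolding res_def using int prob_space s B
    by (subst Bochner_Integration.integral_diff)
       (simp_all add: Bochner_Integration.integral_sum sp less_top[symmetric])
  moreover have "integrable \<mu> res" unfolding res_def using int by auto
  ultimately show "(\<integral>\<^sup>+x. ennreal (res x) \<partial>\<mu>) = ennreal (1 - (\<Sum>k\<in>K. c k * measure \<mu> (B k)))"
    and "0 \<le> 1 - (\<Sum>k\<in>K. c k * measure \<mu> (B k))"
    using nonneg Bochner_Integration.integral_nonneg[of \<mu> res] by (simp_all add: nn_integral_eq_integral)
  \<comment> \<open>Outside the cells nothing has been removed and the integral is controlled by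
    \<open>a\<close>; inside a cell the norm is at most \<open>R\<close>, so only the remaining mass
    counts.\<close>
  have "(\<integral>\<^sup>+x. ennreal (norm x * res x) \<partial>\<mu>)
     \<le> (\<integral>\<^sup>+x. ennreal (norm x) * indicator (- (\<Union>k\<in>K. B k)) x + (\<Sum>k\<in>K. ennreal (R * (1 - c k)) * indicator (B k) x) \<partial>\<mu>)"
  proof (rule nn_integral_mono)
    fix x
    show "ennreal (norm x * res x) \<le> ennreal (norm x) * indicator (- (\<Union>k\<in>K. B k)) x + (\<Sum>k\<in>K. ennreal (R * (1 - c k)) * indicator (B k) x)"
    proof (cases "\<exists>k\<in>K. x \<in> B k")
      case True
      then obtain k where k: "k \<in> K" "x \<in> B k" by blast
      have "ennreal (norm x * res x) \<le> ennreal (R * (1 - c k)) * indicator (B k) x"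
        using k c bnd[OF k] in_B[OF k] by (auto intro!: ennreal_leI mult_right_mono)
      also have "\<dots> \<le> (\<Sum>k\<in>K. ennreal (R * (1 - c k)) * indicator (B k) x)"
        using k K by (intro member_le_sum) auto
      finally show ?thesis by (simp add: add_increasing)
    qed (simp add: off_B)
  qed
  also have "\<dots> = (\<integral>\<^sup>+x. ennreal (norm x) * indicator (- (\<Union>k\<in>K. B k)) x \<partial>\<mu>) + (\<Sum>k\<in>K. ennreal (R * (1 - c k)) * emeasure \<mu> (B k))"
  proof -
    have "(\<integral>\<^sup>+x. (\<Sum>k\<in>K. ennreal (R * (1 - c k)) * indicator (B k) x) \<partial>\<mu>) = (\<Sum>k\<in>K. ennreal (R * (1 - c k)) * emeasure \<mu> (B k))"
      by (subst nn_integral_sum) (simp_all add: nn_integral_cmult_indicator s B)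
    moreover have "(\<lambda>x. \<Sum>k\<in>K. ennreal (R * (1 - c k)) * indicator (B k) x) \<in> borel_measurable \<mu>"
      by measurable
    moreover have "- (\<Union>k\<in>K. B k) \<in> sets borel" by (intro borel_comp sets.finite_UN K B)
    then have "(\<lambda>x. ennreal (norm x) * indicator (- (\<Union>k\<in>K. B k)) x) \<in> borel_measurable \<mu>"
      by measurable
    ultimately show ?thesis by (simp add: nn_integral_add del: Compl_UN)
  qed
  also have "\<dots> \<le> ennreal a + (\<Sum>k\<in>K. ennreal (R * (1 - c k)) * emeasure \<mu> (B k))"
    using off by (intro add_mono) auto
  also have "(\<Sum>k\<in>K. ennreal (R * (1 - c k)) * emeasure \<mu> (B k)) = (\<Sum>k\<in>K. ennreal (R * (measure \<mu> (B k) - c k * measure \<mu> (B k))))"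
  proof (intro sum.cong refl)
    fix k assume "k \<in> K"
    then have "ennreal (R * (1 - c k)) * emeasure \<mu> (B k) = ennreal (R * (1 - c k) * measure \<mu> (B k))"
      using c R by (simp add: emeasure_eq_measure ennreal_mult)
    then show "ennreal (R * (1 - c k)) * emeasure \<mu> (B k) = ennreal (R * (measure \<mu> (B k) - c k * measure \<mu> (B k)))"
      by (simp add: algebra_simps)
  qed
  also have "\<dots> = ennreal (R * (\<Sum>k\<in>K. measure \<mu> (B k) - c k * measure \<mu> (B k)))"
    using c R by (subst sum_ennreal) (auto simp: sum_distrib_left intro!: mult_nonneg_nonneg mult_left_le_one_le)
  also have "ennreal a + \<dots> = ennreal (a + R * (\<Sum>k\<in>K. measure \<mu> (B k) - c k * measure \<mu> (B k)))"
    using c R off by (subst ennreal_plus) (auto intro!: mult_nonneg_nonneg sum_nonneg mult_left_le_one_le)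
  finally show "(\<integral>\<^sup>+x. ennreal (norm x * res x) \<partial>\<mu>) \<le> ennreal (a + R * (\<Sum>k\<in>K. measure \<mu> (B k) - c k * measure \<mu> (B k)))" .
qed

text \<open>The coupling moves the common mass of each cell inside that cell and the remaining mass
  by an independent coupling, which costs at most \<open>norm x + norm y\<close>.\<close>

lemma W1_le_cells:
  fixes \<mu> \<nu> :: "'a::euclidean_space measure"
  assumes mu: "\<mu> \<in> P1" and nu: "\<nu> \<in> P1" and K: "finite K" and disj: "disjoint_family_on B K"
    and B: "\<And>k. k \<in> K \<Longrightarrow> B k \<in> sets borel"
    and diam: "\<And>k x y. k \<in> K \<Longrightarrow> x \<in> B k \<Longrightarrow> y \<in> B k \<Longrightarrow> dist x y \<le> r"
    and bnd: "\<And>k x. k \<in> K \<Longrightarrow> x \<in> B k \<Longrightarrow> norm x \<le> R"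
    and offmu: "(\<integral>\<^sup>+x. ennreal (norm x) * indicator (- (\<Union>k\<in>K. B k)) x \<partial>\<mu>) \<le> ennreal a" "0 \<le> a"
    and offnu: "(\<integral>\<^sup>+x. ennreal (norm x) * indicator (- (\<Union>k\<in>K. B k)) x \<partial>\<nu>) \<le> ennreal b" "0 \<le> b"
    and r: "0 \<le> r" and R: "0 \<le> R"
  shows "W1 \<mu> \<nu> \<le> r + a + b + R * (\<Sum>k\<in>K. \<bar>measure \<mu> (B k) - measure \<nu> (B k)\<bar>)"
proof -
  note s[measurable_cong] = P1_D(2)[OF mu] P1_D(2)[OF nu]
  note B[measurable]
  interpret mu: prob_space \<mu> using P1_D[OF mu] by simp
  interpret nu: prob_space \<nu> using P1_D[OF nu] by simp
  interpret P: pair_sigma_finite \<mu> \<nu> ..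
  define mk where "mk k = min (measure \<mu> (B k)) (measure \<nu> (B k))" for k
  \<comment> \<open>Spreads the common mass \<open>mk k\<close> over \<open>B k \<times> B k\<close>
    in proportion to the product measure. If one of the two masses is 0, then \<open>mk k\<close> is
    0 and the quotient is 0 too, so the identities \<open>wm\<close> hold without exception.\<close>
  define w where "w k = mk k / (measure \<mu> (B k) * measure \<nu> (B k))" for k
  have mk0: "0 \<le> mk k" for k by (simp add: mk_def)
  have w0: "0 \<le> w k" for k by (simp add: w_def mk0)
  have wm: "w k * measure \<nu> (B k) * measure \<mu> (B k) = mk k" "w k * measure \<mu> (B k) * measure \<nu> (B k) = mk k" for k
    using mk0[of k] by (auto simp: w_def mk_def)
  have w1: "w k * measure \<nu> (B k) \<le> 1" "w k * measure \<mu> (B k) \<le> 1" for k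
    using measure_nonneg[of \<mu> "B k"] measure_nonneg[of \<nu> "B k"]
    by (auto simp: w_def mk_def divide_le_eq)
  define u where "u x y = (\<Sum>k\<in>K. w k * indicator (B k) x * indicator (B k) y :: real)" for x y
  define f where "f x = 1 - (\<Sum>k\<in>K. w k * measure \<nu> (B k) * indicator (B k) x :: real)" for x
  define g where "g y = 1 - (\<Sum>k\<in>K. w k * measure \<mu> (B k) * indicator (B k) y :: real)" for y
  \<comment> \<open>Both measures keep the same residual mass \<open>\<rho>\<close>, because the
    same amount \<open>mk k\<close> is removed from each in every cell; this is what permits
    coupling the residuals.\<close>
  define \<rho> where "\<rho> = 1 - (\<Sum>k\<in>K. mk k)"
  note F = residual_mass[OF mu K disj B bnd, where c="\<lambda>k. w k * measure \<nu> (B k)" and a=a, folded f_def, unfolded wm, folded \<rho>_def]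
  note G = residual_mass[OF nu K disj B bnd, where c="\<lambda>k. w k * measure \<mu> (B k)" and a=b, folded g_def, unfolded wm, folded \<rho>_def]
  have f: "f \<in> borel_measurable borel" "\<And>x. 0 \<le> f x" "(\<integral>\<^sup>+x. ennreal (f x) \<partial>\<mu>) = ennreal \<rho>"
    "(\<integral>\<^sup>+x. ennreal (norm x * f x) \<partial>\<mu>) \<le> ennreal (a + R * (\<Sum>k\<in>K. measure \<mu> (B k) - mk k))" and rho: "0 \<le> \<rho>"
    using F w0 w1 offmu R by auto
  have g: "g \<in> borel_measurable borel" "\<And>x. 0 \<le> g x" "(\<integral>\<^sup>+x. ennreal (g x) \<partial>\<nu>) = ennreal \<rho>"
    "(\<integral>\<^sup>+x. ennreal (norm x * g x) \<partial>\<nu>) \<le> ennreal (b + R * (\<Sum>k\<in>K. measure \<nu> (B k) - mk k))"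
    using G w0 w1 offnu R by auto
  note f(1)[measurable] g(1)[measurable]
  have u0: "0 \<le> u x y" for x y unfolding u_def using w0 by (intro sum_nonneg) auto
  have u_sum: "ennreal (u x y) = (\<Sum>k\<in>K. ennreal (w k) * indicator (B k) x * indicator (B k) y)" for x y
  proof -
    have "(\<Sum>k\<in>K. ennreal (w k) * indicator (B k) x * indicator (B k) y)
        = (\<Sum>k\<in>K. ennreal (w k * indicator (B k) x * indicator (B k) y))"
      by (intro sum.cong) (auto simp: indicator_def)
    also have "\<dots> = ennreal (u x y)"
      unfolding u_def using w0 by (subst sum_ennreal) auto
    finally show ?thesis by (rule sym)
  qed
  have u1: "(\<integral>\<^sup>+y. ennreal (u x y) \<partial>\<nu>) = ennreal (1 - f x)" for x
  proof -
    have "(\<integral>\<^sup>+y. ennreal (u x y) \<partial>\<nu>) = (\<Sum>k\<in>K. ennreal (w k) * indicator (B k) x * emeasure \<nu> (B k))"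
      unfolding u_sum by (subst nn_integral_sum) (auto simp: nn_integral_cmult_indicator s B intro!: sum.cong)
    also have "\<dots> = (\<Sum>k\<in>K. ennreal (w k * measure \<nu> (B k) * indicator (B k) x))"
      using w0 by (intro sum.cong) (auto simp: nu.emeasure_eq_measure ennreal_mult indicator_def)
    also have "\<dots> = ennreal (1 - f x)"
      unfolding f_def using w0 by (subst sum_ennreal) auto
    finally show ?thesis .
  qed
  have u2: "(\<integral>\<^sup>+x. ennreal (u x y) \<partial>\<mu>) = ennreal (1 - g y)" for y
  proof -
    have "(\<integral>\<^sup>+x. ennreal (u x y) \<partial>\<mu>) = (\<integral>\<^sup>+x. (\<Sum>k\<in>K. ennreal (w k) * indicator (B k) y * indicator (B k) x) \<partial>\<mu>)"
      unfolding u_sum by (auto simp: mult_ac)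
    also have "\<dots> = (\<Sum>k\<in>K. ennreal (w k) * indicator (B k) y * emeasure \<mu> (B k))"
      by (subst nn_integral_sum) (auto simp: nn_integral_cmult_indicator s B intro!: sum.cong)
    also have "\<dots> = (\<Sum>k\<in>K. ennreal (w k * measure \<mu> (B k) * indicator (B k) y))"
      using w0 by (intro sum.cong) (auto simp: mu.emeasure_eq_measure ennreal_mult indicator_def)
    also have "\<dots> = ennreal (1 - g y)"
      unfolding g_def using w0 by (subst sum_ennreal) auto
    finally show ?thesis .
  qed
  have f1: "f x \<le> 1" for x unfolding f_def using w0 by (auto intro!: sum_nonneg)
  have g1: "g x \<le> 1" for x unfolding g_def using w0 by (auto intro!: sum_nonneg)
  have u_meas[measurable]: "(\<lambda>p. u (fst p) (snd p)) \<in> borel_measurable (\<mu> \<Otimes>\<^sub>M \<nu>)"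
    unfolding u_def by measurable
  \<comment> \<open>The common part \<open>u\<close> plus the normalised product of the residual
    densities. For \<open>\<rho> = 0\<close> the quotient is 0, which is correct because
    \<open>f\<close> and \<open>g\<close> then vanish almost everywhere.\<close>
  define h where "h p = ennreal (u (fst p) (snd p)) + ennreal (f (fst p)) * ennreal (g (snd p) / \<rho>)" for p
  have [measurable]: "h \<in> borel_measurable (\<mu> \<Otimes>\<^sub>M \<nu>)" unfolding h_def by measurable
  have u_meas1[measurable]: "u x \<in> borel_measurable borel" "(\<lambda>x. u x y) \<in> borel_measurable borel" for x y
    unfolding u_def by measurable
  have gr: "(\<integral>\<^sup>+y. ennreal (g y / \<rho>) \<partial>\<nu>) = ennreal (\<rho> / \<rho>)"
  proof -
    have "(\<integral>\<^sup>+y. ennreal (g y / \<rho>) \<partial>\<nu>) = ennreal \<rho> * ennreal (inverse \<rho>)"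
      using rho g(2,3) by (simp add: divide_inverse ennreal_mult nn_integral_multc)
    then show ?thesis using rho by (simp add: divide_inverse flip: ennreal_mult)
  qed
  have fr: "(\<integral>\<^sup>+x. ennreal (f x / \<rho>) \<partial>\<mu>) = ennreal (\<rho> / \<rho>)"
  proof -
    have "(\<integral>\<^sup>+x. ennreal (f x / \<rho>) \<partial>\<mu>) = ennreal \<rho> * ennreal (inverse \<rho>)"
      using rho f(2,3) by (simp add: divide_inverse ennreal_mult nn_integral_multc)
    then show ?thesis using rho by (simp add: divide_inverse flip: ennreal_mult)
  qed
  have "AE x in \<mu>. \<rho> = 0 \<longrightarrow> f x = 0"
    using f(2,3) rho by (cases "\<rho> = 0") (auto simp: nn_integral_0_iff_AE dest!: antisym[OF _ f(2)])
  then have h1: "AE x in \<mu>. (\<integral>\<^sup>+y. h (x, y) \<partial>\<nu>) = 1"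
  proof eventually_elim
    case (elim x)
    have "(\<integral>\<^sup>+y. h (x, y) \<partial>\<nu>) = ennreal (1 - f x) + ennreal (f x) * ennreal (\<rho> / \<rho>)"
      unfolding h_def by (simp add: nn_integral_add nn_integral_cmult u1 gr)
    also have "\<dots> = 1"
      using elim f(2)[of x] f1[of x] by (cases "\<rho> = 0") (simp_all flip: ennreal_plus)
    finally show ?case .
  qed
  have "AE y in \<nu>. \<rho> = 0 \<longrightarrow> g y = 0"
    using g(2,3) rho by (cases "\<rho> = 0") (auto simp: nn_integral_0_iff_AE dest!: antisym[OF _ g(2)])
  then have h2: "AE y in \<nu>. (\<integral>\<^sup>+x. h (x, y) \<partial>\<mu>) = 1"
  proof eventually_elim
    case (elim y)
    have "(\<integral>\<^sup>+x. h (x, y) \<partial>\<mu>) = ennreal (1 - g y) + ennreal \<rho> * ennreal (g y / \<rho>)"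
      unfolding h_def by (simp add: nn_integral_add nn_integral_multc u2 f(3))
    also have "\<dots> = 1"
      using elim g(2)[of y] g1[of y] rho by (cases "\<rho> = 0") (simp_all flip: ennreal_plus ennreal_mult)
    finally show ?case .
  qed
  define D where "D = density (\<mu> \<Otimes>\<^sub>M \<nu>) h"
  have D1: "distr D \<mu> fst = \<mu>" and D2: "distr D \<nu> snd = \<nu>"
    unfolding D_def using h1 h2
    by (auto intro!: density_pair_marginals mu.sigma_finite_measure_axioms nu.sigma_finite_measure_axioms)
  have sD[measurable_cong]: "sets D = sets (\<mu> \<Otimes>\<^sub>M \<nu>)" by (simp add: D_def)
  have "prob_space (distr D \<mu> fst)" unfolding D1 by (fact mu.prob_space_axioms)
  then interpret D: prob_space D by (rule prob_space_distrD[rotated]) measurable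
  have e: "distr D borel fst = \<mu>" "distr D borel snd = \<nu>"
    using D1 D2 s by (simp_all cong: distr_cong)
  \<comment> \<open>Where \<open>u\<close> is positive, both points lie in one cell; on the residual
    part the distance is bounded by the sum of the norms, which separates the variables.\<close>
  have split: "ennreal (dist x y) * h (x, y) \<le> ennreal r * ennreal (u x y)
      + ennreal (norm x * f x) * ennreal (g y / \<rho>) + ennreal (f x / \<rho>) * ennreal (norm y * g y)" for x y
  proof -
    have "dist x y * u x y \<le> r * u x y"
      unfolding u_def sum_distrib_left
      using diam w0 by (intro sum_mono) (auto simp: indicator_def intro: mult_right_mono)
    moreover have "dist x y * (f x * (g y / \<rho>)) \<le> (norm x + norm y) * (f x * (g y / \<rho>))"
      using f(2) g(2) rho by (intro mult_right_mono) (auto simp: dist_norm norm_triangle_ineq4)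
    ultimately have "dist x y * (u x y + f x * (g y / \<rho>)) \<le> r * u x y + (norm x * f x) * (g y / \<rho>) + (f x / \<rho>) * (norm y * g y)"
      by (simp add: algebra_simps add_divide_distrib)
    moreover have "ennreal (dist x y) * h (x, y) = ennreal (dist x y * (u x y + f x * (g y / \<rho>)))"
      using f(2)[of x] g(2)[of y] rho u0[of x y] by (simp add: h_def flip: ennreal_mult ennreal_plus)
    moreover have "ennreal r * ennreal (u x y)
      + ennreal (norm x * f x) * ennreal (g y / \<rho>) + ennreal (f x / \<rho>) * ennreal (norm y * g y) = 
      ennreal (r * u x y + (norm x * f x) * (g y / \<rho>) + (f x / \<rho>) * (norm y * g y))"
      using f(2)[of x] g(2)[of y] rho u0[of x y] r by (simp flip: ennreal_mult ennreal_plus)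
    ultimately show ?thesis by (simp add: ennreal_leI)
  qed
  let ?A = "a + R * (\<Sum>k\<in>K. measure \<mu> (B k) - mk k)"
  let ?B = "b + R * (\<Sum>k\<in>K. measure \<nu> (B k) - mk k)"
  have A0: "0 \<le> ?A" "0 \<le> ?B"
    using R offmu offnu by (auto intro!: add_nonneg_nonneg mult_nonneg_nonneg sum_nonneg simp: mk_def)
  have "cost (distr D borel (\<lambda>s. (fst s, snd s))) = (\<integral>\<^sup>+s. ennreal (dist (fst s) (snd s)) \<partial>D)"
    by (rule cost_distr_pair) auto
  also have "\<dots> = (\<integral>\<^sup>+p. h p * ennreal (dist (fst p) (snd p)) \<partial>(\<mu> \<Otimes>\<^sub>M \<nu>))"
    unfolding D_def by (subst nn_integral_density) auto
  also have "\<dots> = (\<integral>\<^sup>+x. \<integral>\<^sup>+y. h (x, y) * ennreal (dist x y) \<partial>\<nu> \<partial>\<mu>)"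
    by (subst nu.nn_integral_fst[symmetric]) auto
  also have "\<dots> \<le> (\<integral>\<^sup>+x. \<integral>\<^sup>+y. ennreal r * ennreal (u x y)
      + ennreal (norm x * f x) * ennreal (g y / \<rho>) + ennreal (f x / \<rho>) * ennreal (norm y * g y) \<partial>\<nu> \<partial>\<mu>)"
    using split by (intro nn_integral_mono) (auto simp: mult.commute)
  also have "\<dots> = (\<integral>\<^sup>+x. ennreal r * ennreal (1 - f x) + ennreal (norm x * f x) * ennreal (\<rho> / \<rho>)
      + ennreal (f x / \<rho>) * (\<integral>\<^sup>+y. ennreal (norm y * g y) \<partial>\<nu>) \<partial>\<mu>)"
    by (simp add: nn_integral_add nn_integral_cmult u1 gr)
  also have "\<dots> = ennreal r * (\<integral>\<^sup>+x. ennreal (1 - f x) \<partial>\<mu>) + (\<integral>\<^sup>+x. ennreal (norm x * f x) \<partial>\<mu>) * ennreal (\<rho> / \<rho>)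
      + ennreal (\<rho> / \<rho>) * (\<integral>\<^sup>+y. ennreal (norm y * g y) \<partial>\<nu>)"
    by (simp add: nn_integral_add nn_integral_cmult nn_integral_multc fr)
  also have "\<dots> \<le> ennreal r * 1 + ennreal ?A * 1 + 1 * ennreal ?B"
  proof (intro add_mono mult_mono f(4) g(4))
    have "(\<integral>\<^sup>+x. ennreal (1 - f x) \<partial>\<mu>) \<le> (\<integral>\<^sup>+x. 1 \<partial>\<mu>)"
      using f(2) by (intro nn_integral_mono) (auto simp flip: ennreal_1 intro!: ennreal_leI simp del: ennreal_1)
    then show "(\<integral>\<^sup>+x. ennreal (1 - f x) \<partial>\<mu>) \<le> 1" by (simp add: mu.emeasure_space_1)
  qed auto
  also have "\<dots> = ennreal (r + ?A + ?B)"
    using r A0 by simp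
  finally have c: "cost (distr D borel (\<lambda>s. (fst s, snd s))) \<le> ennreal (r + ?A + ?B)" .
  have "distr D borel (\<lambda>s. (fst s, snd s)) \<in> couplings \<mu> \<nu>"
    using distr_pair_coupling[OF D.prob_space_axioms, of fst snd] e by simp
  from W1_le_cost[OF this c] r A0 have "W1 \<mu> \<nu> \<le> r + ?A + ?B" by simp
  also have "\<dots> = r + a + b + R * ((\<Sum>k\<in>K. measure \<mu> (B k) - mk k) + (\<Sum>k\<in>K. measure \<nu> (B k) - mk k))"
    by (simp add: algebra_simps)
  \<comment> \<open>In each cell the two excesses over the minimum add up to the absolute
    difference.\<close>
  also have "(\<Sum>k\<in>K. measure \<mu> (B k) - mk k) + (\<Sum>k\<in>K. measure \<nu> (B k) - mk k)
     = (\<Sum>k\<in>K. \<bar>measure \<mu> (B k) - measure \<nu> (B k)\<bar>)"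
    unfolding sum.distrib[symmetric] by (intro sum.cong) (auto simp: mk_def)
  finally show ?thesis .
qed

section \<open>Empirical measures\<close>

lemma W1_self: "\<mu> \<in> P1 \<Longrightarrow> W1 \<mu> \<mu> = 0"
  using W1_distr_le[of \<mu> "\<lambda>x. x" "\<lambda>x. x" 0] P1_D[of \<mu>] W1_nonneg[of \<mu> \<mu>]
  by (simp add: measurable_ident_sets distr_id2)

lemma return_in_P1: "return borel (x::'a::euclidean_space) \<in> P1"
  by (simp add: P1_def prob_space_return nn_integral_return)

lemma W1_return_0:
  fixes \<mu> :: "'a::euclidean_space measure"
  assumes "\<mu> \<in> P1" "(\<integral>\<^sup>+x. ennreal (norm x) \<partial>\<mu>) \<le> ennreal c" "0 \<le> c"
  shows "W1 \<mu> (return borel 0) \<le> c"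
proof -
  have s: "sets \<mu> = sets borel" using P1_D[OF assms(1)] by simp
  note [measurable_cong] = s
  have "distr \<mu> borel (\<lambda>x. x) = \<mu>" by (simp add: s distr_id2)
  moreover have "distr \<mu> borel (\<lambda>x. 0::'a) = return borel 0"
    using prob_space.distr_const[OF P1_D(1)[OF assms(1)], of "0::'a" borel] by simp
  ultimately show ?thesis
    using W1_distr_le[of \<mu> "\<lambda>x. x" "\<lambda>x. 0" c] P1_D(1)[OF assms(1)] assms(2,3) by simp
qed

lemma nn_integral_emp:
  assumes N: "1 \<le> N" and [measurable]: "g \<in> borel_measurable borel"
  shows "(\<integral>\<^sup>+x. g x \<partial>emp N X) = (\<Sum>i\<in>{1..N}. g (X i)) / of_nat N"
  unfolding emp_def using N
  by (subst nn_integral_distr) (auto simp: nn_integral_pmf_of_set)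

lemma prob_space_emp: "prob_space (emp N X)"
  unfolding emp_def by (rule measure_pmf.prob_space_distr) simp

lemma sets_emp [simp, measurable_cong]: "sets (emp N X) = sets borel"
  by (simp add: emp_def)

lemma ennreal_sum_average:
  assumes "\<And>i. i \<in> {1..N} \<Longrightarrow> 0 \<le> g i" "1 \<le> N"
  shows "(\<Sum>i\<in>{1..N::nat}. ennreal (g i)) / of_nat N = ennreal ((\<Sum>i\<in>{1..N}. g i) / real N)"
proof -
  have "(\<Sum>i\<in>{1..N}. ennreal (g i)) = ennreal (\<Sum>i\<in>{1..N}. g i)"
    using assms by (intro sum_ennreal) auto
  moreover have "0 \<le> (\<Sum>i\<in>{1..N}. g i)" "0 < real N" using assms by (auto intro: sum_nonneg)
  ultimately show ?thesis
    by (simp only: divide_ennreal ennreal_of_nat_eq_real_of_nat)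
qed

lemma emp_in_P1:
  assumes "1 \<le> N" shows "emp N X \<in> P1"
  using assms ennreal_sum_average[of N "\<lambda>i. norm (X i)"]
  by (simp add: P1_def prob_space_emp nn_integral_emp del: sum_ennreal)

lemma emp_cong:
  assumes "1 \<le> N" "\<And>i. i \<in> {1..N} \<Longrightarrow> X i = Y i"
  shows "emp N X = emp N Y"
  unfolding emp_def using assms by (intro distr_cong_AE) (auto simp: AE_measure_pmf_iff)

text \<open>Couples the atoms that carry the same index.\<close>

lemma W1_emp_le:
  assumes N: "1 \<le> N"
  shows "W1 (emp N X) (emp N Y) \<le> (\<Sum>i\<in>{1..N}. dist (X i) (Y i)) / real N"
  unfolding emp_def
proof (rule W1_distr_le)
  have "(\<integral>\<^sup>+s. ennreal (dist (X s) (Y s)) \<partial>measure_pmf (pmf_of_set {1..N})) = (\<Sum>i\<in>{1..N}. ennreal (dist (X i) (Y i))) / of_nat N"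
    using N by (simp add: nn_integral_pmf_of_set)
  also have "\<dots> = ennreal ((\<Sum>i\<in>{1..N}. dist (X i) (Y i)) / real N)"
    using N by (intro ennreal_sum_average) auto
  finally show "(\<integral>\<^sup>+s. ennreal (dist (X s) (Y s)) \<partial>measure_pmf (pmf_of_set {1..N})) \<le> ennreal ((\<Sum>i\<in>{1..N}. dist (X i) (Y i)) / real N)"
    by simp
qed (auto intro!: measure_pmf.prob_space_axioms sum_nonneg divide_nonneg_nonneg)

lemma W1_emp_return_0:
  assumes N: "1 \<le> N"
  shows "W1 (emp N X) (return borel 0) \<le> (\<Sum>i\<in>{1..N}. norm (X i)) / real N"
  using N ennreal_sum_average[of N "\<lambda>i. norm (X i)"]
  by (intro W1_return_0) (auto simp: emp_in_P1 nn_integral_emp sum_nonneg simp del: sum_ennreal)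

lemma emeasure_emp:
  assumes N: "1 \<le> N" and A: "A \<in> sets borel"
  shows "emeasure (emp N X) A = (\<Sum>i\<in>{1..N}. indicator A (X i)) / of_nat N"
  using nn_integral_emp[OF N, of "indicator A" X] A by simp

text \<open>The target is the \<sigma>-algebra in which \<open>f\<close> is assumed measurable in
  its measure argument; it is generated by evaluations at Borel sets, which for empirical measures
  are finite averages of indicators.\<close>

lemma measurable_emp [measurable]:
  assumes N: "1 \<le> N" and X: "\<And>i. i \<in> {1..N} \<Longrightarrow> X i \<in> M \<rightarrow>\<^sub>M (borel :: 'a::euclidean_space measure)"
  shows "(\<lambda>s. emp N (\<lambda>i. X i s)) \<in> M \<rightarrow>\<^sub>M restrict_space (subprob_algebra borel) P1"
proof (rule measurable_restrict_space2)
  show "(\<lambda>s. emp N (\<lambda>i. X i s)) \<in> M \<rightarrow>\<^sub>M subprob_algebra borel"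
  proof (rule measurable_subprob_algebra)
    fix A :: "'a set" assume A: "A \<in> sets borel"
    have [measurable]: "(\<lambda>s. \<Sum>i\<in>{1..N}. indicator A (X i s) :: ennreal) \<in> borel_measurable M"
      using X A by (intro borel_measurable_sum measurable_compose[OF X] borel_measurable_indicator) auto
    show "(\<lambda>s. emeasure (emp N (\<lambda>i. X i s)) A) \<in> borel_measurable M"
      unfolding emeasure_emp[OF N A] by measurable
  qed (auto intro: prob_space_imp_subprob_space prob_space_emp)
qed (use N in \<open>auto intro: emp_in_P1\<close>)

text \<open>An infimum over uncountably many couplings gives no measurability by itself. By the
  triangle inequality and \<open>W1_emp_le\<close>, however, the distance is a continuous function
  of the positions.\<close>

lemma W1_emp_measurable:
  fixes X :: "nat \<Rightarrow> 's \<Rightarrow> 'a::euclidean_space"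
  assumes N: "1 \<le> N" and X: "\<And>i. i \<in> {1..N} \<Longrightarrow> X i \<in> M \<rightarrow>\<^sub>M borel" and mu: "\<mu> \<in> P1"
  shows "(\<lambda>s. W1 (emp N (\<lambda>i. X i s)) \<mu>) \<in> borel_measurable M"
proof -
  define W where "W x = W1 (emp N x) \<mu>" for x :: "nat \<Rightarrow> 'a"
  have lip: "\<bar>W y - W x\<bar> \<le> (\<Sum>i\<in>{1..N}. dist (y i) (x i)) / real N" for x y
    using W1_triangle[OF emp_in_P1[OF N, of x] emp_in_P1[OF N, of y] mu]
      W1_triangle[OF emp_in_P1[OF N, of y] emp_in_P1[OF N, of x] mu] W1_emp_le[OF N, of x y] W1_emp_le[OF N, of y x]
    by (auto simp: W_def dist_commute abs_le_iff)
  have "isCont W x" for x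
    unfolding isCont_def
  proof (rule Lim_transform_bound[OF always_eventually, THEN Lim_null[THEN iffD2]])
    show "\<forall>y. norm (W y - W x) \<le> norm ((\<Sum>i\<in>{1..N}. dist (y i) (x i)) / real N)"
      unfolding real_norm_def by (rule allI, rule order_trans[OF lip abs_ge_self])
    have "((\<lambda>y. y i) \<longlongrightarrow> x i) (at x)" for i
      using continuous_on_product_coordinates[of i, where 'b="'a"] unfolding continuous_on_def by auto
    then have "((\<lambda>y. (\<Sum>i\<in>{1..N}. dist (y i) (x i)) / real N) \<longlongrightarrow> (\<Sum>i\<in>{1..N}. dist (x i) (x i)) / real N) (at x)"
      using N by (intro tendsto_intros) auto
    then show "((\<lambda>y. (\<Sum>i\<in>{1..N}. dist (y i) (x i)) / real N) \<longlongrightarrow> 0) (at x)" by simp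
  qed
  then have "W \<in> borel_measurable borel"
    by (intro borel_measurable_continuous_onI continuous_at_imp_continuous_on) auto
  then have W: "W \<in> borel_measurable (PiM UNIV (\<lambda>_. borel))"
    by (simp add: sets_PiM_equal_borel cong: measurable_cong_sets)
  \<comment> \<open>Continuity was shown on the space of all sequences, while \<open>X i\<close> is
    measurable only for indices up to \<open>N\<close>. Padding by 0 leaves the empirical measure
    unchanged.\<close>
  define X' where "X' s = (\<lambda>i. if i \<in> {1..N} then X i s else 0)" for s
  have "(\<lambda>s. W (X' s)) \<in> borel_measurable M"
  proof (rule measurable_compose[OF _ W])
    have "(\<lambda>s. X' s i) \<in> M \<rightarrow>\<^sub>M borel" for i
      by (cases "i \<in> {1..N}") (auto simp: X'_def X)
    then show "X' \<in> M \<rightarrow>\<^sub>M PiM UNIV (\<lambda>_. borel)"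
      by (intro measurable_PiM_single') auto
  qed
  also have "(\<lambda>s. W (X' s)) = (\<lambda>s. W1 (emp N (\<lambda>i. X i s)) \<mu>)"
    unfolding W_def X'_def by (intro ext arg_cong[where f="\<lambda>m. W1 m \<mu>"] emp_cong N) auto
  finally show ?thesis .
qed

section \<open>The one-step map\<close>

text \<open>If one argument is 0, the inequality reduces to \<open>u powr p \<le> u\<close> for 0 <
  u < 1; in the open half-line it is \<open>powr_convex\<close>. The endpoint matters because norms
  of increments can vanish.\<close>

lemma powr_convex_nonneg:
  assumes "1 \<le> p" shows "convex_on {0..} (\<lambda>x::real. x powr p)"
proof (intro convex_onI)
  fix t x y :: real assume t: "0 < t" "t < 1" and xy: "x \<in> {0..}" "y \<in> {0..}"
  have *: "(u * z) powr p \<le> u * z powr p" if "0 < u" "u < 1" "0 \<le> z" for u z :: real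
    using that assms powr_mono'[of 1 p u] by (simp add: powr_mult mult_right_mono)
  consider "x = 0" | "y = 0" | "0 < x" "0 < y" using xy by force
  then show "((1 - t) *\<^sub>R x + t *\<^sub>R y) powr p \<le> (1 - t) * x powr p + t * y powr p"
  proof cases
    case 3 then show ?thesis using convex_onD[OF powr_convex[OF assms], of t x y] t by simp
  qed (use * t xy in auto)
qed simp

lemma average_powr_le:
  assumes "1 \<le> p" "finite I" "I \<noteq> {}" "\<And>i. i \<in> I \<Longrightarrow> 0 \<le> x i"
  shows "((\<Sum>i\<in>I. x i) / real (card I)) powr p \<le> (\<Sum>i\<in>I. x i powr p) / real (card I)"
  using convex_on_sum[OF assms(2,3) powr_convex_nonneg[OF assms(1)], of "\<lambda>_. 1 / real (card I)" x] assms
  by (simp add: card_gt_0_iff sum_divide_distrib)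

text \<open>The origin of 4^(-\<alpha>) in \<open>a_alpha\<close>: one step of a particle is
  estimated by a sum of four terms.\<close>

lemma add4_powr_le:
  assumes "1 \<le> p" "0 \<le> a" "0 \<le> b" "0 \<le> c" "0 \<le> (d::real)"
  shows "(a + b + c + d) powr p \<le> 4 powr (p - 1) * (a powr p + b powr p + c powr p + d powr p)"
proof -
  have nth_nonneg: "0 \<le> [a, b, c, d] ! i" if "i \<in> {..<4}" for i
    using that assms by (auto simp: eval_nat_numeral less_Suc_eq)
  have "((a + b + c + d) / 4) powr p \<le> (a powr p + b powr p + c powr p + d powr p) / 4"
    using average_powr_le[of p "{..<4}" "\<lambda>i. [a, b, c, d] ! i", OF assms(1) _ _ nth_nonneg] by (simp add: eval_nat_numeral lessThan_Suc add_ac)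
  then show ?thesis using assms
    by (simp add: powr_divide powr_diff field_simps)
qed

section \<open>Lipschitz bounds in mean\<close>

lemma Dlip_bound:
  assumes "\<mu>1 \<in> P1" "\<mu>2 \<in> P1" "0 < dist x1 x2 + W1 \<mu>1 \<mu>2"
  shows "ennreal (norm (f x1 \<mu>1 z - f x2 \<mu>2 z) / (dist x1 x2 + W1 \<mu>1 \<mu>2)) \<le> Dlip f z"
proof -
  have "(x1, \<mu>1) \<noteq> (x2, \<mu>2)" using assms W1_self[OF assms(1)] by auto
  then show ?thesis unfolding Dlip_def using assms
    by (intro SUP_upper2[of "(x1, \<mu>1, x2, \<mu>2)"]) auto
qed

text \<open>\<open>Dlip f\<close> need not be measurable, so its integral is only a lower integral. It still
  dominates the increments between any two fixed arguments, because these are measurable.\<close>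

lemma nn_integral_Dlip_bound:
  fixes f :: "'a::euclidean_space \<Rightarrow> 'a measure \<Rightarrow> 'b \<Rightarrow> 'a"
  assumes meas: "\<And>x \<mu>. \<mu> \<in> P1 \<Longrightarrow> f x \<mu> \<in> \<theta> \<rightarrow>\<^sub>M borel"
    and mu: "\<mu>1 \<in> P1" "\<mu>2 \<in> P1" and p: "1 \<le> p"
    and S: "(\<integral>\<^sup>+z. enn_powr (Dlip f z) p \<partial>\<theta>) \<le> ennreal S" "0 \<le> S"
  shows "(\<integral>\<^sup>+z. ennreal (norm (f x1 \<mu>1 z - f x2 \<mu>2 z) powr p) \<partial>\<theta>)
      \<le> ennreal (S * (dist x1 x2 + W1 \<mu>1 \<mu>2) powr p)"
proof -
  have pos: "(\<integral>\<^sup>+z. ennreal (norm (f x1 \<mu>1 z - f x2 \<mu>2 z) powr p) \<partial>\<theta>)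
      \<le> ennreal (S * (dist x1 x2 + W1 \<mu>1 \<mu>2) powr p)"
    if mu: "\<mu>1 \<in> P1" "\<mu>2 \<in> P1" and D: "0 < dist x1 x2 + W1 \<mu>1 \<mu>2" for x1 x2 \<mu>1 \<mu>2
  proof -
    define D where "D = dist x1 x2 + W1 \<mu>1 \<mu>2"
    note [measurable] = meas[OF mu(1), of x1] meas[OF mu(2), of x2]
    have "(\<integral>\<^sup>+z. ennreal (norm (f x1 \<mu>1 z - f x2 \<mu>2 z) powr p) \<partial>\<theta>)
      = (\<integral>\<^sup>+z. ennreal (D powr p) * ennreal ((norm (f x1 \<mu>1 z - f x2 \<mu>2 z) / D) powr p) \<partial>\<theta>)"
      using D by (intro nn_integral_cong) (simp add: powr_divide D_def flip: ennreal_mult)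
    also have "\<dots> = ennreal (D powr p) * (\<integral>\<^sup>+z. ennreal ((norm (f x1 \<mu>1 z - f x2 \<mu>2 z) / D) powr p) \<partial>\<theta>)"
      by (rule nn_integral_cmult) measurable
    also have "(\<integral>\<^sup>+z. ennreal ((norm (f x1 \<mu>1 z - f x2 \<mu>2 z) / D) powr p) \<partial>\<theta>) \<le> (\<integral>\<^sup>+z. enn_powr (Dlip f z) p \<partial>\<theta>)"
    proof (rule nn_integral_mono)
      fix z
      have le: "ennreal (norm (f x1 \<mu>1 z - f x2 \<mu>2 z) / D) \<le> Dlip f z"
        unfolding D_def by (intro Dlip_bound mu that)
      show "ennreal ((norm (f x1 \<mu>1 z - f x2 \<mu>2 z) / D) powr p) \<le> enn_powr (Dlip f z) p"
      proof (cases "Dlip f z = \<infinity>")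
        case False
        then have "norm (f x1 \<mu>1 z - f x2 \<mu>2 z) / D \<le> enn2real (Dlip f z)"
          using enn2real_mono[OF le] D by (simp add: D_def less_top)
        then show ?thesis using False D p
          by (auto simp: enn_powr_def D_def intro!: ennreal_leI powr_mono2)
      qed (simp add: enn_powr_def)
    qed
    also note S(1)
    also have "ennreal (D powr p) * ennreal S = ennreal (S * D powr p)"
      using S by (simp add: mult.commute flip: ennreal_mult)
    finally show ?thesis by (auto simp: D_def mult_left_mono)
  qed
  show ?thesis
  proof (cases "0 < dist x1 x2 + W1 \<mu>1 \<mu>2")
    case True then show ?thesis by (intro pos mu)
  next
    \<comment> \<open>The pairs may still differ here, since \<open>W1 \<mu>1 \<mu>2 = 0\<close> has
      not been shown to force equality of the measures. The quotient in \<open>Dlip\<close> is then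
      a division by 0 and carries no information, so the increment is reached by a limit.\<close>
    case False
    then have x: "x2 = x1" and W: "W1 \<mu>1 \<mu>2 = 0"
    proof -
      have "dist x1 x2 = 0" "W1 \<mu>1 \<mu>2 = 0"
        using False W1_nonneg[of \<mu>1 \<mu>2] zero_le_dist[of x1 x2] by linarith+
      then show "x2 = x1" "W1 \<mu>1 \<mu>2 = 0" by simp_all
    qed
    note m[measurable] = meas[OF mu(1)] meas[OF mu(2)]
    define C where "C = 2 powr (p - 1) * (2 * S)"
    have C: "0 \<le> C" using S by (simp add: C_def)
    obtain b :: 'a where b: "b \<in> Basis" by (meson SOME_Basis)
    let ?I = "\<integral>\<^sup>+z. ennreal (norm (f x1 \<mu>1 z - f x2 \<mu>2 z) powr p) \<partial>\<theta>"
    have le: "?I \<le> ennreal (C * h powr p)" if h: "0 < h" for h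
    proof -
      \<comment> \<open>A detour through \<open>(y, \<mu>1)\<close>: both legs have length exactly
        \<open>h > 0\<close>, so the positive case applies to each, and the total tends to 0 with
        \<open>h\<close>.\<close>
      define y where "y = x1 + h *\<^sub>R b"
      have d: "dist x1 y = h" "dist y x2 = h" using h b by (simp_all add: y_def dist_norm x)
      have "?I \<le> (\<integral>\<^sup>+z. ennreal (2 powr (p - 1)) * (ennreal (norm (f x1 \<mu>1 z - f y \<mu>1 z) powr p)
           + ennreal (norm (f y \<mu>1 z - f x2 \<mu>2 z) powr p)) \<partial>\<theta>)"
      proof (rule nn_integral_mono)
        fix z
        let ?a = "norm (f x1 \<mu>1 z - f y \<mu>1 z)" and ?b = "norm (f y \<mu>1 z - f x2 \<mu>2 z)"
        have "norm (f x1 \<mu>1 z - f x2 \<mu>2 z) powr p \<le> (?a + ?b) powr p"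
          using p norm_triangle_ineq[of "f x1 \<mu>1 z - f y \<mu>1 z" "f y \<mu>1 z - f x2 \<mu>2 z"] by (intro powr_mono2) auto
        also have "\<dots> \<le> 2 powr (p - 1) * (?a powr p + ?b powr p)"
          using average_powr_le[OF p, of UNIV "\<lambda>i. if i then ?a else ?b"]
          by (simp add: UNIV_bool powr_divide powr_diff field_simps)
        finally show "ennreal (norm (f x1 \<mu>1 z - f x2 \<mu>2 z) powr p) \<le> ennreal (2 powr (p - 1)) * (ennreal (?a powr p) + ennreal (?b powr p))"
          by (simp add: ennreal_leI flip: ennreal_mult ennreal_plus)
      qed
      also have "\<dots> = ennreal (2 powr (p - 1)) * ((\<integral>\<^sup>+z. ennreal (norm (f x1 \<mu>1 z - f y \<mu>1 z) powr p) \<partial>\<theta>)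
           + (\<integral>\<^sup>+z. ennreal (norm (f y \<mu>1 z - f x2 \<mu>2 z) powr p) \<partial>\<theta>))"
        by (simp add: nn_integral_cmult nn_integral_add)
      also have "\<dots> \<le> ennreal (2 powr (p - 1)) * (ennreal (S * h powr p) + ennreal (S * h powr p))"
        using pos[OF mu(1) mu(1), of x1 y] pos[OF mu, of y x2] d W h W1_self[OF mu(1)]
        by (intro mult_left_mono add_mono) auto
      also have "\<dots> = ennreal (C * h powr p)"
        using S by (simp add: C_def algebra_simps flip: ennreal_mult ennreal_plus)
      finally show ?thesis .
    qed
    have "((\<lambda>h. C * h powr p) \<longlongrightarrow> C * 0 powr p) (at_right 0)"
      using p by (intro tendsto_intros tendsto_powr') (auto intro!: eventually_at_right_less[THEN eventually_mono])
    then have "((\<lambda>h. ennreal (C * h powr p)) \<longlongrightarrow> ennreal 0) (at_right 0)"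
      using p by (intro tendsto_ennrealI) simp
    moreover have "\<forall>\<^sub>F h in at_right 0. ?I \<le> ennreal (C * h powr p)"
      using eventually_at_right_less[of "0::real"] by eventually_elim (rule le)
    ultimately have "?I \<le> ennreal 0"
      by (rule tendsto_lowerbound) simp
    then show ?thesis by (auto intro: order_trans)
  qed
qed

section \<open>The one-step map as a contraction\<close>

lemma P1_const_measurable:
  assumes "\<mu> \<in> P1" shows "(\<lambda>_. \<mu>) \<in> N \<rightarrow>\<^sub>M restrict_space (subprob_algebra borel) P1"
  using assms P1_D[OF assms]
  by (intro measurable_const) (auto simp: space_restrict_space space_subprob_algebra intro: prob_space_imp_subprob_space)

lemma section_measurable:
  fixes f :: "'a::euclidean_space \<Rightarrow> 'a measure \<Rightarrow> 'b::topological_space \<Rightarrow> 'a"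
  assumes f: "(\<lambda>(x, \<mu>, z). f x \<mu> z) \<in>
      borel \<Otimes>\<^sub>M (restrict_space (subprob_algebra borel) P1 \<Otimes>\<^sub>M borel) \<rightarrow>\<^sub>M borel"
    and \<theta>: "sets \<theta> = sets borel" and \<mu>: "\<mu> \<in> P1"
  shows "f x \<mu> \<in> \<theta> \<rightarrow>\<^sub>M borel"
proof -
  have "(\<lambda>z. (x, \<mu>, z)) \<in> \<theta> \<rightarrow>\<^sub>M borel \<Otimes>\<^sub>M (restrict_space (subprob_algebra borel) P1 \<Otimes>\<^sub>M borel)"
    by (intro measurable_Pair P1_const_measurable measurable_const measurable_ident_sets \<theta> \<mu>) simp
  from measurable_compose[OF this f] show ?thesis by simp
qed

text \<open>Keeps of \<open>Dlip\<close> only its consequences for fixed arguments, with constants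
  \<open>\<sigma>\<close> in mean and \<open>s\<close> in \<open>p\<close>-th mean;
  \<open>\<kappa>\<close> stands for exp(-\<omega>) and \<open>p\<close> for 1 + \<alpha>.\<close>

locale mean_field =
  fixes A :: "real^'d^'d" and \<delta> \<kappa> \<sigma> s p :: real
    and \<theta> :: "'b::euclidean_space measure"
    and f :: "real^'d \<Rightarrow> (real^'d) measure \<Rightarrow> 'b \<Rightarrow> real^'d"
  assumes prob_theta: "prob_space \<theta>" and sets_theta [measurable_cong]: "sets \<theta> = sets borel"
    and f_meas: "(\<lambda>(x, \<mu>, z). f x \<mu> z) \<in>
        borel \<Otimes>\<^sub>M (restrict_space (subprob_algebra borel) P1 \<Otimes>\<^sub>M borel) \<rightarrow>\<^sub>M borel"
    and A_le: "\<And>x. norm (A *v x) \<le> \<kappa> * norm x"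
    and nonneg: "0 \<le> \<kappa>" "0 \<le> \<delta>" "0 \<le> \<sigma>" "0 \<le> s" and p: "1 < p"
    and lip1: "\<And>x1 x2 \<mu>1 \<mu>2. \<mu>1 \<in> P1 \<Longrightarrow> \<mu>2 \<in> P1 \<Longrightarrow>
        (\<integral>\<^sup>+z. ennreal (norm (f x1 \<mu>1 z - f x2 \<mu>2 z)) \<partial>\<theta>) \<le> ennreal (\<sigma> * (dist x1 x2 + W1 \<mu>1 \<mu>2))"
    and lipp: "\<And>x1 x2 \<mu>1 \<mu>2. \<mu>1 \<in> P1 \<Longrightarrow> \<mu>2 \<in> P1 \<Longrightarrow>
        (\<integral>\<^sup>+z. ennreal (norm (f x1 \<mu>1 z - f x2 \<mu>2 z) powr p) \<partial>\<theta>) \<le> ennreal (s * (dist x1 x2 + W1 \<mu>1 \<mu>2) powr p)"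
    and f0: "(\<integral>\<^sup>+z. ennreal (norm (f 0 (return borel 0) z) powr p) \<partial>\<theta>) < \<infinity>"
begin

sublocale theta: prob_space \<theta> by (fact prob_theta)

definition step :: "(real^'d) measure \<Rightarrow> real^'d \<Rightarrow> 'b \<Rightarrow> real^'d" where
  "step \<mu> x z = A *v x + \<delta> *\<^sub>R f x \<mu> z"

lemma f_measurable:
  assumes X: "X \<in> N \<rightarrow>\<^sub>M borel" and m: "m \<in> N \<rightarrow>\<^sub>M restrict_space (subprob_algebra borel) P1"
    and Z: "Z \<in> N \<rightarrow>\<^sub>M borel"
  shows "(\<lambda>w. f (X w) (m w) (Z w)) \<in> N \<rightarrow>\<^sub>M borel"
  using measurable_compose[OF measurable_Pair[OF X measurable_Pair[OF m Z]] f_meas] by simp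

lemma step_measurable:
  assumes X[measurable]: "X \<in> N \<rightarrow>\<^sub>M borel" and m: "m \<in> N \<rightarrow>\<^sub>M restrict_space (subprob_algebra borel) P1"
    and Z: "Z \<in> N \<rightarrow>\<^sub>M borel"
  shows "(\<lambda>w. step (m w) (X w) (Z w)) \<in> N \<rightarrow>\<^sub>M borel"
proof -
  have [measurable]: "(\<lambda>x. A *v x) \<in> borel \<rightarrow>\<^sub>M borel"
    by (intro borel_measurable_continuous_onI linear_continuous_on matrix_vector_mul_bounded_linear)
  note f_measurable[OF assms, measurable]
  show ?thesis unfolding step_def by measurable
qed

lemma f_measurable_const [measurable]: "\<mu> \<in> P1 \<Longrightarrow> f x \<mu> \<in> \<theta> \<rightarrow>\<^sub>M borel"
  by (rule section_measurable[OF f_meas sets_theta])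

lemma step_measurable_pair [measurable]:
  assumes "\<mu> \<in> P1" "X \<in> N \<rightarrow>\<^sub>M borel" "Z \<in> N \<rightarrow>\<^sub>M borel"
  shows "(\<lambda>w. step \<mu> (X w) (Z w)) \<in> N \<rightarrow>\<^sub>M borel"
  by (intro step_measurable assms P1_const_measurable)

lemma Psi_eq: "Psi A \<delta> f \<theta> \<mu> = distr (\<mu> \<Otimes>\<^sub>M \<theta>) borel (\<lambda>w. step \<mu> (fst w) (snd w))"
  by (simp add: Psi_def step_def case_prod_beta')

lemma prob_space_Psi:
  assumes mu: "\<mu> \<in> P1" shows "prob_space (Psi A \<delta> f \<theta> \<mu>)"
proof -
  note P1_D(2)[OF mu, measurable_cong]
  interpret mu: prob_space \<mu> using P1_D[OF mu] by simp
  interpret P: pair_prob_space \<mu> \<theta> ..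
  show ?thesis unfolding Psi_eq using mu by (intro P.prob_space_distr) measurable
qed

lemma sets_Psi [simp, measurable_cong]: "sets (Psi A \<delta> f \<theta> \<mu>) = sets borel"
  by (simp add: Psi_def)

lemma f0_first_moment: "(\<integral>\<^sup>+z. ennreal (norm (f 0 (return borel 0) z)) \<partial>\<theta>) < \<infinity>"
proof -
  note [measurable] = f_measurable_const[OF return_in_P1]
  have le: "t \<le> 1 + t powr p" if "0 \<le> t" for t :: real
  proof (cases "t \<le> 1")
    case False
    then show ?thesis using p powr_mono[of 1 p t] by simp
  qed (simp add: add_increasing2)
  have "(\<integral>\<^sup>+z. ennreal (norm (f 0 (return borel 0) z)) \<partial>\<theta>)
      \<le> (\<integral>\<^sup>+z. 1 + ennreal (norm (f 0 (return borel 0) z) powr p) \<partial>\<theta>)"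
    using le by (intro nn_integral_mono) (simp flip: ennreal_1 ennreal_plus add: ennreal_leI)
  also have "\<dots> = 1 + (\<integral>\<^sup>+z. ennreal (norm (f 0 (return borel 0) z) powr p) \<partial>\<theta>)"
    by (simp add: nn_integral_add theta.emeasure_space_1)
  finally show ?thesis using f0 by (simp add: le_less_trans)
qed

lemma Psi_in_P1:
  assumes mu: "\<mu> \<in> P1" shows "Psi A \<delta> f \<theta> \<mu> \<in> P1"
proof -
  note P1_D(2)[OF mu, measurable_cong]
  note [measurable] = f_measurable_const[OF return_in_P1] f_measurable_const[OF mu]
  interpret mu: prob_space \<mu> using P1_D[OF mu] by simp
  let ?o = "return borel (0 :: real^'d)"
  let ?W = "W1 \<mu> ?o"
  let ?F = "\<integral>\<^sup>+z. ennreal (norm (f 0 ?o z)) \<partial>\<theta>"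
  have inner: "(\<integral>\<^sup>+z. ennreal (norm (step \<mu> x z)) \<partial>\<theta>)
      \<le> ennreal (\<kappa> + \<delta> * \<sigma>) * ennreal (norm x) + (ennreal (\<delta> * \<sigma> * ?W) + ennreal \<delta> * ?F)" for x
  proof -
    have "(\<integral>\<^sup>+z. ennreal (norm (step \<mu> x z)) \<partial>\<theta>)
        \<le> (\<integral>\<^sup>+z. ennreal (\<kappa> * norm x) + (ennreal \<delta> * ennreal (norm (f x \<mu> z - f 0 ?o z)) + ennreal \<delta> * ennreal (norm (f 0 ?o z))) \<partial>\<theta>)"
    proof (rule nn_integral_mono)
      fix z
      have "norm (step \<mu> x z) \<le> norm (A *v x) + \<delta> * norm (f x \<mu> z)"
        unfolding step_def using nonneg by (intro order_trans[OF norm_triangle_ineq]) simp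
      also have "\<dots> \<le> \<kappa> * norm x + \<delta> * (norm (f x \<mu> z - f 0 ?o z) + norm (f 0 ?o z))"
        using A_le nonneg norm_triangle_ineq[of "f x \<mu> z - f 0 ?o z" "f 0 ?o z"]
        by (intro add_mono mult_left_mono) auto
      finally show "ennreal (norm (step \<mu> x z)) \<le> ennreal (\<kappa> * norm x) + (ennreal \<delta> * ennreal (norm (f x \<mu> z - f 0 ?o z)) + ennreal \<delta> * ennreal (norm (f 0 ?o z)))"
        using nonneg by (simp add: algebra_simps ennreal_leI flip: ennreal_mult ennreal_plus)
    qed
    also have "\<dots> = ennreal (\<kappa> * norm x) + (ennreal \<delta> * (\<integral>\<^sup>+z. ennreal (norm (f x \<mu> z - f 0 ?o z)) \<partial>\<theta>) + ennreal \<delta> * ?F)"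
      using mu by (simp add: nn_integral_add nn_integral_cmult theta.emeasure_space_1)
    also have "\<dots> \<le> ennreal (\<kappa> * norm x) + (ennreal \<delta> * ennreal (\<sigma> * (dist x 0 + ?W)) + ennreal \<delta> * ?F)"
      using lip1[OF mu return_in_P1, of x 0 0] by (intro add_mono mult_left_mono) auto
    also have "\<dots> = ennreal (\<kappa> * norm x) + ennreal \<delta> * ennreal (\<sigma> * (dist x 0 + ?W)) + ennreal \<delta> * ?F"
      by (simp add: add.assoc)
    also have "ennreal (\<kappa> * norm x) + ennreal \<delta> * ennreal (\<sigma> * (dist x 0 + ?W)) = ennreal (\<kappa> + \<delta> * \<sigma>) * ennreal (norm x) + ennreal (\<delta> * \<sigma> * ?W)"
      using nonneg W1_nonneg[of \<mu> ?o] by (simp add: algebra_simps flip: ennreal_mult ennreal_plus)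
    finally show ?thesis by (simp add: add.assoc)
  qed
  have "(\<integral>\<^sup>+x. ennreal (norm x) \<partial>Psi A \<delta> f \<theta> \<mu>) = (\<integral>\<^sup>+w. ennreal (norm (step \<mu> (fst w) (snd w))) \<partial>(\<mu> \<Otimes>\<^sub>M \<theta>))"
    unfolding Psi_eq using mu by (subst nn_integral_distr) auto
  also have "\<dots> = (\<integral>\<^sup>+x. \<integral>\<^sup>+z. ennreal (norm (step \<mu> x z)) \<partial>\<theta> \<partial>\<mu>)"
    using mu by (subst theta.nn_integral_fst[symmetric]) auto
  also have "\<dots> \<le> (\<integral>\<^sup>+x. ennreal (\<kappa> + \<delta> * \<sigma>) * ennreal (norm x) + (ennreal (\<delta> * \<sigma> * ?W) + ennreal \<delta> * ?F) \<partial>\<mu>)"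
    by (intro nn_integral_mono inner)
  also have "\<dots> = ennreal (\<kappa> + \<delta> * \<sigma>) * (\<integral>\<^sup>+x. ennreal (norm x) \<partial>\<mu>) + (ennreal (\<delta> * \<sigma> * ?W) + ennreal \<delta> * ?F)"
    by (simp add: nn_integral_add nn_integral_cmult mu.emeasure_space_1)
  also have "\<dots> < \<infinity>"
    using P1_D(3)[OF mu] f0_first_moment by (simp add: ennreal_mult_less_top)
  finally show ?thesis using prob_space_Psi[OF mu] by (simp add: P1_def)
qed

text \<open>Allows both marginals of a coupling to be driven by the same independent noise: each
  component is then still distributed as its own image under \<open>Psi\<close>.\<close>

lemma Psi_coupling:
  assumes mu: "\<mu> \<in> P1" and pi: "prob_space \<pi>" and [measurable]: "X \<in> \<pi> \<rightarrow>\<^sub>M borel" and X: "distr \<pi> borel X = \<mu>"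
  shows "distr (\<pi> \<Otimes>\<^sub>M \<theta>) borel (\<lambda>w. step \<mu> (X (fst w)) (snd w)) = Psi A \<delta> f \<theta> \<mu>"
proof -
  note P1_D(2)[OF mu, measurable_cong]
  interpret pi: prob_space \<pi> by fact
  have "distr \<pi> borel X \<Otimes>\<^sub>M distr \<theta> \<theta> (\<lambda>z. z) = distr (\<pi> \<Otimes>\<^sub>M \<theta>) (borel \<Otimes>\<^sub>M \<theta>) (\<lambda>(x, z). (X x, z))"
    by (rule pair_measure_distr) (auto simp: theta.sigma_finite_measure_axioms)
  then have e: "\<mu> \<Otimes>\<^sub>M \<theta> = distr (\<pi> \<Otimes>\<^sub>M \<theta>) (borel \<Otimes>\<^sub>M \<theta>) (\<lambda>(x, z). (X x, z))"
    by (simp add: X)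
  show ?thesis
    unfolding Psi_eq e using mu by (subst distr_distr) (auto simp: comp_def case_prod_beta')
qed

text \<open>With common noise, the linear part contributes \<open>\<kappa>\<close>, and
  \<open>f\<close> contributes \<open>\<delta> * \<sigma>\<close> twice, once through the position
  and once through its measure argument.\<close>

lemma Psi_contraction:
  assumes mu: "\<mu> \<in> P1" and nu: "\<nu> \<in> P1"
  shows "W1 (Psi A \<delta> f \<theta> \<mu>) (Psi A \<delta> f \<theta> \<nu>) \<le> (\<kappa> + 2 * \<delta> * \<sigma>) * W1 \<mu> \<nu>"
proof (rule field_le_epsilon)
  fix e :: real assume e: "0 < e"
  let ?c = "\<kappa> + \<delta> * \<sigma>" and ?W = "W1 \<mu> \<nu>"
  have c: "0 \<le> ?c" using nonneg by simp
  note P1_D(2)[OF mu, measurable_cong] P1_D(2)[OF nu, measurable_cong]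
  note [measurable] = f_measurable_const[OF mu] f_measurable_const[OF nu]
  \<comment> \<open>Dividing by \<open>?c + 1\<close> keeps the error after multiplication by
    \<open>?c\<close> below \<open>e\<close>, also when \<open>?c\<close> is 0.\<close>
  obtain \<pi> where pi: "\<pi> \<in> couplings \<mu> \<nu>" "cost \<pi> \<le> ennreal (?W + e / (?c + 1))"
    using exists_coupling[OF mu nu, of "e / (?c + 1)"] e c by (auto simp: divide_pos_pos)
  interpret pi: prob_space \<pi> using couplings_D[OF pi(1)] by simp
  have [measurable_cong]: "sets \<pi> = sets (borel \<Otimes>\<^sub>M borel)"
    unfolding borel_prod using couplings_D[OF pi(1)] by simp
  interpret P: pair_prob_space \<pi> \<theta> ..
  let ?X = "\<lambda>w. step \<mu> (fst (fst w)) (snd w)" and ?Y = "\<lambda>w. step \<nu> (snd (fst w)) (snd w)"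
  have [measurable]: "?X \<in> \<pi> \<Otimes>\<^sub>M \<theta> \<rightarrow>\<^sub>M borel" "?Y \<in> \<pi> \<Otimes>\<^sub>M \<theta> \<rightarrow>\<^sub>M borel"
    using mu nu by measurable
  have inner: "(\<integral>\<^sup>+z. ennreal (dist (step \<mu> x z) (step \<nu> y z)) \<partial>\<theta>)
      \<le> ennreal ?c * ennreal (dist x y) + ennreal (\<delta> * \<sigma> * ?W)" for x y
  proof -
    have "(\<integral>\<^sup>+z. ennreal (dist (step \<mu> x z) (step \<nu> y z)) \<partial>\<theta>)
        \<le> (\<integral>\<^sup>+z. ennreal (\<kappa> * dist x y) + ennreal \<delta> * ennreal (norm (f x \<mu> z - f y \<nu> z)) \<partial>\<theta>)"
    proof (rule nn_integral_mono)
      fix z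
      have "step \<mu> x z - step \<nu> y z = A *v (x - y) + \<delta> *\<^sub>R (f x \<mu> z - f y \<nu> z)"
        by (simp add: step_def algebra_simps matrix_vector_mult_diff_distrib)
      then have "dist (step \<mu> x z) (step \<nu> y z) \<le> norm (A *v (x - y)) + \<delta> * norm (f x \<mu> z - f y \<nu> z)"
        unfolding dist_norm using nonneg by (metis norm_triangle_ineq norm_scaleR abs_of_nonneg)
      also have "\<dots> \<le> \<kappa> * dist x y + \<delta> * norm (f x \<mu> z - f y \<nu> z)"
        using A_le[of "x - y"] by (simp add: dist_norm)
      finally show "ennreal (dist (step \<mu> x z) (step \<nu> y z)) \<le> ennreal (\<kappa> * dist x y) + ennreal \<delta> * ennreal (norm (f x \<mu> z - f y \<nu> z))"
        using nonneg by (simp add: ennreal_leI flip: ennreal_mult ennreal_plus)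
    qed
    also have "\<dots> = ennreal (\<kappa> * dist x y) + ennreal \<delta> * (\<integral>\<^sup>+z. ennreal (norm (f x \<mu> z - f y \<nu> z)) \<partial>\<theta>)"
      using mu nu by (simp add: nn_integral_add nn_integral_cmult theta.emeasure_space_1)
    also have "\<dots> \<le> ennreal (\<kappa> * dist x y) + ennreal \<delta> * ennreal (\<sigma> * (dist x y + ?W))"
      using lip1[OF mu nu, of x y] by (intro add_mono mult_left_mono) auto
    also have "\<dots> = ennreal ?c * ennreal (dist x y) + ennreal (\<delta> * \<sigma> * ?W)"
      using nonneg W1_nonneg[of \<mu> \<nu>] by (simp add: algebra_simps flip: ennreal_mult ennreal_plus)
    finally show ?thesis .
  qed
  have "(\<integral>\<^sup>+w. ennreal (dist (?X w) (?Y w)) \<partial>(\<pi> \<Otimes>\<^sub>M \<theta>))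
      = (\<integral>\<^sup>+q. \<integral>\<^sup>+z. ennreal (dist (step \<mu> (fst q) z) (step \<nu> (snd q) z)) \<partial>\<theta> \<partial>\<pi>)"
    by (subst theta.nn_integral_fst[symmetric]) auto
  also have "\<dots> \<le> (\<integral>\<^sup>+q. ennreal ?c * ennreal (dist (fst q) (snd q)) + ennreal (\<delta> * \<sigma> * ?W) \<partial>\<pi>)"
    by (intro nn_integral_mono inner)
  also have "\<dots> = ennreal ?c * cost \<pi> + ennreal (\<delta> * \<sigma> * ?W)"
    by (simp add: nn_integral_add nn_integral_cmult pi.emeasure_space_1)
  also have "\<dots> \<le> ennreal ?c * ennreal (?W + e / (?c + 1)) + ennreal (\<delta> * \<sigma> * ?W)"
    using pi(2) by (intro add_mono mult_left_mono) auto
  also have "\<dots> = ennreal (?c * (?W + e / (?c + 1)) + \<delta> * \<sigma> * ?W)"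
    using nonneg c e W1_nonneg[of \<mu> \<nu>] by (simp flip: ennreal_mult ennreal_plus)
  also have "\<dots> \<le> ennreal ((\<kappa> + 2 * \<delta> * \<sigma>) * ?W + e)"
  proof (rule ennreal_leI)
    have "?c * (e / (?c + 1)) \<le> 1 * e"
      using c e by (simp add: divide_le_eq mult_right_mono)
    then show "?c * (?W + e / (?c + 1)) + \<delta> * \<sigma> * ?W \<le> (\<kappa> + 2 * \<delta> * \<sigma>) * ?W + e"
      by (simp add: algebra_simps)
  qed
  finally have "W1 (distr (\<pi> \<Otimes>\<^sub>M \<theta>) borel ?X) (distr (\<pi> \<Otimes>\<^sub>M \<theta>) borel ?Y) \<le> (\<kappa> + 2 * \<delta> * \<sigma>) * ?W + e"
    using e nonneg W1_nonneg[of \<mu> \<nu>]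
    by (intro W1_distr_le P.prob_space_axioms) auto
  then show "W1 (Psi A \<delta> f \<theta> \<mu>) (Psi A \<delta> f \<theta> \<nu>) \<le> (\<kappa> + 2 * \<delta> * \<sigma>) * ?W + e"
    using Psi_coupling[OF mu pi.prob_space_axioms, of fst] Psi_coupling[OF nu pi.prob_space_axioms, of snd]
      couplings_D[OF pi(1)] by simp
qed

end

section \<open>Fluctuations in one step\<close>

lemma indep_vars_PiM_coordinates:
  assumes "prob_space \<theta>" "I \<noteq> {}"
  shows "prob_space.indep_vars (PiM I (\<lambda>_. \<theta>)) (\<lambda>_. \<theta>) (\<lambda>i z. z i) I"
proof -
  interpret prob_space "PiM I (\<lambda>_. \<theta>)" by (intro prob_space_PiM assms)
  have "distr (PiM I (\<lambda>_. \<theta>)) (PiM I (\<lambda>_. \<theta>)) (\<lambda>z. \<lambda>i\<in>I. z i) = distr (PiM I (\<lambda>_. \<theta>)) (PiM I (\<lambda>_. \<theta>)) (\<lambda>z. z)"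
    by (intro distr_cong) (auto simp: space_PiM)
  also have "\<dots> = PiM I (\<lambda>i. distr (PiM I (\<lambda>_. \<theta>)) \<theta> (\<lambda>z. z i))"
    by (subst distr_id2) (auto simp: id_def intro!: PiM_cong distr_PiM_component[symmetric] assms)
  finally show ?thesis
    using assms by (subst indep_vars_iff_distr_eq_PiM') auto
qed

context mean_field
begin

definition move :: "nat \<Rightarrow> (nat \<Rightarrow> real^'d) \<Rightarrow> (nat \<Rightarrow> 'b) \<Rightarrow> nat \<Rightarrow> real^'d" where
  "move N x z i = step (emp N x) (x i) (z i)"

text \<open>Identifies \<open>Psi\<close> of the present empirical measure as the conditional mean
  of the next one: the average over \<open>i\<close> of the law of the \<open>i\<close>-th particle
  after the step.\<close>

lemma nn_integral_Psi_emp: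
  assumes N: "1 \<le> N" and [measurable]: "g \<in> borel_measurable borel"
  shows "(\<integral>\<^sup>+y. g y \<partial>Psi A \<delta> f \<theta> (emp N x)) = (\<Sum>i\<in>{1..N}. \<integral>\<^sup>+z. g (step (emp N x) (x i) z) \<partial>\<theta>) / of_nat N"
proof -
  note e[measurable] = emp_in_P1[OF N, of x]
  have "(\<integral>\<^sup>+y. g y \<partial>Psi A \<delta> f \<theta> (emp N x)) = (\<integral>\<^sup>+w. g (step (emp N x) (fst w) (snd w)) \<partial>(emp N x \<Otimes>\<^sub>M \<theta>))"
    unfolding Psi_eq by (subst nn_integral_distr) auto
  also have "\<dots> = (\<integral>\<^sup>+x'. \<integral>\<^sup>+z. g (step (emp N x) x' z) \<partial>\<theta> \<partial>emp N x)"
    by (subst theta.nn_integral_fst[symmetric]) auto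
  also have "\<dots> = (\<Sum>i\<in>{1..N}. \<integral>\<^sup>+z. g (step (emp N x) (x i) z) \<partial>\<theta>) / of_nat N"
    by (intro nn_integral_emp N) measurable
  finally show ?thesis .
qed

lemma step_event [measurable]:
  "\<mu> \<in> P1 \<Longrightarrow> S \<in> sets borel \<Longrightarrow> {z. step \<mu> x z \<in> S} \<in> sets \<theta>"
  using measurable_sets[OF step_measurable_pair[of \<mu> "\<lambda>_. x" \<theta> "\<lambda>z. z"], of S] sets_eq_imp_space_eq[OF sets_theta]
  by (simp add: measurable_ident_sets sets_theta vimage_def)

lemma measure_Psi_emp:
  assumes N: "1 \<le> N" and S[measurable]: "S \<in> sets borel"
  shows "measure (Psi A \<delta> f \<theta> (emp N x)) S = (\<Sum>i\<in>{1..N}. measure \<theta> {z. step (emp N x) (x i) z \<in> S}) / real N"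
proof -
  note e[measurable] = emp_in_P1[OF N, of x]
  have "emeasure (Psi A \<delta> f \<theta> (emp N x)) S = (\<Sum>i\<in>{1..N}. \<integral>\<^sup>+z. indicator S (step (emp N x) (x i) z) \<partial>\<theta>) / of_nat N"
    using nn_integral_Psi_emp[OF N, of "indicator S" x] by simp
  also have "(\<Sum>i\<in>{1..N}. \<integral>\<^sup>+z. indicator S (step (emp N x) (x i) z) \<partial>\<theta>) = (\<Sum>i\<in>{1..N}. ennreal (measure \<theta> {z. step (emp N x) (x i) z \<in> S}))"
  proof (intro sum.cong refl)
    fix i
    have "(\<integral>\<^sup>+z. indicator S (step (emp N x) (x i) z) \<partial>\<theta>) = (\<integral>\<^sup>+z. indicator {z. step (emp N x) (x i) z \<in> S} z \<partial>\<theta>)"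
      by (intro nn_integral_cong) (simp add: indicator_def)
    also have "\<dots> = ennreal (measure \<theta> {z. step (emp N x) (x i) z \<in> S})"
      by (simp add: theta.emeasure_eq_measure e step_event)
    finally show "(\<integral>\<^sup>+z. indicator S (step (emp N x) (x i) z) \<partial>\<theta>) = ennreal (measure \<theta> {z. step (emp N x) (x i) z \<in> S})" .
  qed
  also have "\<dots> / of_nat N = ennreal ((\<Sum>i\<in>{1..N}. measure \<theta> {z. step (emp N x) (x i) z \<in> S}) / real N)"
    using N by (intro ennreal_sum_average) auto
  finally show ?thesis
    unfolding measure_def by (simp add: sum_nonneg)
qed

lemma measure_emp:
  assumes N: "1 \<le> N" and S: "S \<in> sets borel"
  shows "measure (emp N x) S = (\<Sum>i\<in>{1..N}. indicator S (x i)) / real N"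
proof -
  have "emeasure (emp N x) S = (\<Sum>i\<in>{1..N}. ennreal (indicator S (x i))) / of_nat N"
    using emeasure_emp[OF N S] by (simp add: ennreal_indicator)
  also have "\<dots> = ennreal ((\<Sum>i\<in>{1..N}. indicator S (x i)) / real N)"
    using N by (intro ennreal_sum_average) auto
  finally show ?thesis unfolding measure_def by (simp add: sum_nonneg)
qed

text \<open>For a frozen state \<open>x\<close> the indicators of the new positions are independent
  with values in [0, 1], though not identically distributed; their mean is the mass that
  \<open>Psi\<close> gives to \<open>S\<close>.\<close>

lemma hoeffding_emp:
  assumes N: "1 \<le> N" and S[measurable]: "S \<in> sets borel" and u: "0 \<le> u"
  defines "\<Theta> \<equiv> PiM {1..N} (\<lambda>_. \<theta>)"
  shows "measure \<Theta> {z \<in> space \<Theta>. u \<le> \<bar>measure (emp N (move N x z)) S - measure (Psi A \<delta> f \<theta> (emp N x)) S\<bar>}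
     \<le> 2 * exp (- 2 * real N * u\<^sup>2)"
proof -
  note e[measurable] = emp_in_P1[OF N, of x]
  have pT: "prob_space \<Theta>" unfolding \<Theta>_def by (intro prob_space_PiM prob_theta)
  interpret T: prob_space \<Theta> by fact
  define X where "X i z = (indicator S (step (emp N x) (x i) (z i)) :: real)" for i and z :: "nat \<Rightarrow> 'b"
  have "T.indep_vars (\<lambda>_. borel) X {1..N}"
    unfolding X_def \<Theta>_def using N
    by (intro prob_space.indep_vars_compose2[OF prob_space_PiM indep_vars_PiM_coordinates] prob_theta) auto
  then interpret H: Hoeffding_ineq \<Theta> "{1..N}" X "\<lambda>_. 0" "\<lambda>_. 1" "\<Sum>i\<in>{1..N}. T.expectation (X i)"
    by unfold_locales (auto simp: X_def indicator_def)
  have E: "T.expectation (X i) = measure \<theta> {z. step (emp N x) (x i) z \<in> S}" if i: "i \<in> {1..N}" for i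
  proof -
    have "T.expectation (X i) = (LINT z|distr \<Theta> \<theta> (\<lambda>z. z i). indicator S (step (emp N x) (x i) z))"
      unfolding X_def using i by (subst integral_distr) (auto simp: \<Theta>_def)
    also have "distr \<Theta> \<theta> (\<lambda>z. z i) = \<theta>"
      unfolding \<Theta>_def using i by (intro distr_PiM_component prob_theta)
    also have "(LINT z|\<theta>. indicator S (step (emp N x) (x i) z)) = (LINT z|\<theta>. indicator {z. step (emp N x) (x i) z \<in> S} z :: real)"
      by (intro Bochner_Integration.integral_cong) (auto simp: indicator_def)
    also have "\<dots> = measure \<theta> {z. step (emp N x) (x i) z \<in> S}"
      by (simp add: sets_eq_imp_space_eq[OF sets_theta])
    finally show ?thesis .
  qed
  have eq: "\<bar>measure (emp N (move N x z)) S - measure (Psi A \<delta> f \<theta> (emp N x)) S\<bar>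
      = \<bar>(\<Sum>i\<in>{1..N}. X i z) - (\<Sum>i\<in>{1..N}. T.expectation (X i))\<bar> / real N" for z
    unfolding measure_emp[OF N S] measure_Psi_emp[OF N S] using N
    by (simp add: E X_def move_def abs_divide flip: diff_divide_distrib)
  have "measure \<Theta> {z \<in> space \<Theta>. u \<le> \<bar>measure (emp N (move N x z)) S - measure (Psi A \<delta> f \<theta> (emp N x)) S\<bar>}
     = measure \<Theta> {z \<in> space \<Theta>. \<bar>(\<Sum>i\<in>{1..N}. X i z) - (\<Sum>i\<in>{1..N}. T.expectation (X i))\<bar> \<ge> real N * u}"
    unfolding eq using N by (simp add: le_divide_eq mult.commute)
  also have "\<dots> \<le> 2 * exp (- 2 * (real N * u)\<^sup>2 / (\<Sum>i\<in>{1..N}. (1 - 0)\<^sup>2))"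
    using N u by (intro H.Hoeffding_ineq_abs_ge) auto
  also have "- 2 * (real N * u)\<^sup>2 / (\<Sum>i\<in>{1..N}. (1 - 0)\<^sup>2) = - 2 * real N * u\<^sup>2"
    using N by (simp add: power2_eq_square field_simps)
  finally show ?thesis .
qed

section \<open>Moments after one step\<close>

definition F0 :: ennreal where
  "F0 = (\<integral>\<^sup>+z. ennreal (norm (f 0 (return borel 0) z) powr p) \<partial>\<theta>)"

text \<open>The four terms are the linear part, the increment of \<open>f\<close> in the position,
  its increment in the measure, and its value at the base point
  \<open>(0, return borel 0)\<close>.\<close>

lemma step_moment:
  assumes mu: "\<mu> \<in> P1"
  shows "(\<integral>\<^sup>+z. ennreal (norm (step \<mu> x z) powr p) \<partial>\<theta>)
    \<le> ennreal (4 powr (p - 1) * ((\<kappa> powr p + \<delta> powr p * s) * norm x powr p + \<delta> powr p * s * W1 \<mu> (return borel 0) powr p))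
      + ennreal (4 powr (p - 1) * \<delta> powr p) * F0"
proof -
  let ?o = "return borel (0 :: real^'d)" and ?c = "4 powr (p - 1) :: real" and ?d = "\<delta> powr p"
  let ?W = "W1 \<mu> ?o"
  note [measurable] = f_measurable_const[OF return_in_P1] f_measurable_const[OF mu]
  have "(\<integral>\<^sup>+z. ennreal (norm (step \<mu> x z) powr p) \<partial>\<theta>)
      \<le> (\<integral>\<^sup>+z. ennreal ?c * (ennreal (\<kappa> powr p * norm x powr p) + (ennreal ?d * ennreal (norm (f x \<mu> z - f 0 \<mu> z) powr p)
         + (ennreal ?d * ennreal (norm (f 0 \<mu> z - f 0 ?o z) powr p) + ennreal ?d * ennreal (norm (f 0 ?o z) powr p)))) \<partial>\<theta>)"
  proof (rule nn_integral_mono)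
    fix z
    let ?a = "norm (f x \<mu> z - f 0 \<mu> z)" and ?b = "norm (f 0 \<mu> z - f 0 ?o z)" and ?e = "norm (f 0 ?o z)"
    have "norm (step \<mu> x z) \<le> norm (A *v x) + \<delta> * norm (f x \<mu> z)"
      unfolding step_def using nonneg by (intro order_trans[OF norm_triangle_ineq]) simp
    also have "\<delta> * norm (f x \<mu> z) \<le> \<delta> * (?a + ?b + ?e)"
      using norm_triangle_sub[of "f x \<mu> z" "f 0 \<mu> z"] norm_triangle_sub[of "f 0 \<mu> z" "f 0 ?o z"] nonneg
      by (intro mult_left_mono) auto
    finally have "norm (step \<mu> x z) \<le> \<kappa> * norm x + \<delta> * ?a + \<delta> * ?b + \<delta> * ?e"
      using A_le[of x] by (simp add: algebra_simps)
    then have "norm (step \<mu> x z) powr p \<le> (\<kappa> * norm x + \<delta> * ?a + \<delta> * ?b + \<delta> * ?e) powr p"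
      using p by (intro powr_mono2) auto
    also have "\<dots> \<le> ?c * ((\<kappa> * norm x) powr p + (\<delta> * ?a) powr p + (\<delta> * ?b) powr p + (\<delta> * ?e) powr p)"
      using p nonneg by (intro add4_powr_le) auto
    also have "\<dots> = ?c * (\<kappa> powr p * norm x powr p + (?d * ?a powr p + (?d * ?b powr p + ?d * ?e powr p)))"
      using nonneg by (simp add: powr_mult)
    finally show "ennreal (norm (step \<mu> x z) powr p) \<le> ennreal ?c * (ennreal (\<kappa> powr p * norm x powr p) + (ennreal ?d * ennreal (?a powr p)
         + (ennreal ?d * ennreal (?b powr p) + ennreal ?d * ennreal (?e powr p))))"
      by (simp add: ennreal_leI flip: ennreal_mult ennreal_plus)
  qed
  also have "\<dots> = ennreal ?c * (ennreal (\<kappa> powr p * norm x powr p) + (ennreal ?d * (\<integral>\<^sup>+z. ennreal (norm (f x \<mu> z - f 0 \<mu> z) powr p) \<partial>\<theta>)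
         + (ennreal ?d * (\<integral>\<^sup>+z. ennreal (norm (f 0 \<mu> z - f 0 ?o z) powr p) \<partial>\<theta>) + ennreal ?d * F0)))"
    by (simp add: nn_integral_add nn_integral_cmult theta.emeasure_space_1 F0_def)
  also have "\<dots> \<le> ennreal ?c * (ennreal (\<kappa> powr p * norm x powr p) + (ennreal ?d * ennreal (s * norm x powr p)
         + (ennreal ?d * ennreal (s * ?W powr p) + ennreal ?d * F0)))"
    using lipp[OF mu mu, of x 0] lipp[OF mu return_in_P1, of 0 0 0] W1_self[OF mu]
    by (intro mult_left_mono add_mono order_refl) auto
  also have "\<dots> = ennreal ?c * (ennreal (\<kappa> powr p * norm x powr p) + ennreal ?d * ennreal (s * norm x powr p)
         + ennreal ?d * ennreal (s * ?W powr p)) + ennreal ?c * ennreal ?d * F0"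
    by (simp add: distrib_left add.assoc mult.assoc)
  also have "ennreal ?c * (ennreal (\<kappa> powr p * norm x powr p) + ennreal ?d * ennreal (s * norm x powr p)
         + ennreal ?d * ennreal (s * ?W powr p)) = ennreal (?c * ((\<kappa> powr p + ?d * s) * norm x powr p + ?d * s * ?W powr p))"
    using nonneg by (simp add: algebra_simps flip: ennreal_mult ennreal_plus)
  finally show ?thesis by (simp add: ennreal_mult)
qed

text \<open>The distance of the empirical measure to the point mass at 0 is at most the mean norm,
  whose \<open>p\<close>-th power is at most the mean \<open>p\<close>-th power. The increment in
  the measure thus costs as much as the one in the position, which explains the factor 2 in front of
  \<open>\<delta> powr p * s\<close>.\<close>

lemma moment_step:
  assumes N: "1 \<le> N"
  shows "(\<Sum>i\<in>{1..N}. \<integral>\<^sup>+z. ennreal (norm (step (emp N x) (x i) z) powr p) \<partial>\<theta>)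
    \<le> ennreal (4 powr (p - 1) * (\<kappa> powr p + 2 * \<delta> powr p * s)) * (\<Sum>i\<in>{1..N}. ennreal (norm (x i) powr p))
      + of_nat N * (ennreal (4 powr (p - 1) * \<delta> powr p) * F0)"
proof -
  let ?c = "4 powr (p - 1) :: real" and ?d = "\<delta> powr p" and ?W = "W1 (emp N x) (return borel 0)"
  let ?S = "\<Sum>i\<in>{1..N}. norm (x i) powr p"
  have "real N * ?W powr p \<le> real N * ((\<Sum>i\<in>{1..N}. norm (x i)) / real N) powr p"
    using W1_emp_return_0[OF N, of x] p W1_nonneg by (intro mult_left_mono powr_mono2) auto
  also have "\<dots> \<le> real N * (?S / real N)"
    using average_powr_le[of p "{1..N}" "\<lambda>i. norm (x i)"] p N by (intro mult_left_mono) auto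
  finally have W: "real N * ?W powr p \<le> ?S" using N by simp
  have "(\<Sum>i\<in>{1..N}. \<integral>\<^sup>+z. ennreal (norm (step (emp N x) (x i) z) powr p) \<partial>\<theta>)
    \<le> (\<Sum>i\<in>{1..N}. ennreal (?c * ((\<kappa> powr p + ?d * s) * norm (x i) powr p + ?d * s * ?W powr p)) + ennreal (?c * ?d) * F0)"
    by (intro sum_mono step_moment emp_in_P1 N)
  also have "\<dots> = ennreal (\<Sum>i\<in>{1..N}. ?c * ((\<kappa> powr p + ?d * s) * norm (x i) powr p + ?d * s * ?W powr p)) + of_nat N * (ennreal (?c * ?d) * F0)"
    using nonneg by (simp add: sum.distrib sum_ennreal)
  also have "(\<Sum>i\<in>{1..N}. ?c * ((\<kappa> powr p + ?d * s) * norm (x i) powr p + ?d * s * ?W powr p))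
     = ?c * ((\<kappa> powr p + ?d * s) * ?S + ?d * s * (real N * ?W powr p))"
    by (simp add: sum.distrib flip: sum_distrib_left)
  also have "\<dots> \<le> ?c * ((\<kappa> powr p + ?d * s) * ?S + ?d * s * ?S)"
    using W nonneg by (intro mult_left_mono add_left_mono) auto
  also have "\<dots> = ?c * (\<kappa> powr p + 2 * ?d * s) * ?S" by (simp add: algebra_simps)
  also have "ennreal (?c * (\<kappa> powr p + 2 * ?d * s) * ?S) = ennreal (?c * (\<kappa> powr p + 2 * ?d * s)) * (\<Sum>i\<in>{1..N}. ennreal (norm (x i) powr p))"
    using nonneg by (subst sum_ennreal) (auto simp: ennreal_mult sum_nonneg)
  finally show ?thesis by (simp add: ennreal_leI)
qed

end

section \<open>Partition of a ball into cubes\<close>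

definition cell :: "real \<Rightarrow> real \<Rightarrow> ('d \<Rightarrow> int) \<Rightarrow> (real^'d) set" where
  "cell h R k = {x. norm x \<le> R \<and> (\<forall>i. \<lfloor>x $ i / h\<rfloor> = k i)}"

definition cells :: "real \<Rightarrow> real \<Rightarrow> ('d::finite \<Rightarrow> int) set" where
  "cells h R = PiE UNIV (\<lambda>_. {\<lfloor>- R / h\<rfloor>..\<lfloor>R / h\<rfloor>})"

lemma finite_cells: "finite (cells h R)"
  unfolding cells_def by (intro finite_PiE) auto

lemma card_cells_le:
  assumes "0 < h" "0 \<le> R"
  shows "real (card (cells h R :: ('d::finite \<Rightarrow> int) set)) \<le> (2 * R / h + 2) ^ CARD('d)"
proof -
  have "real (card (cells h R :: ('d \<Rightarrow> int) set)) = real (card {\<lfloor>- R / h\<rfloor>..\<lfloor>R / h\<rfloor>}) ^ CARD('d)"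
    by (simp add: cells_def card_PiE)
  also have "\<dots> \<le> (2 * R / h + 2) ^ CARD('d)"
  proof (rule power_mono)
    have "real_of_int \<lfloor>R / h\<rfloor> \<le> R / h" "- R / h - 1 < real_of_int \<lfloor>- R / h\<rfloor>" by linarith+
    moreover have "0 \<le> R / h" using assms by simp
    ultimately show "real (card {\<lfloor>- R / h\<rfloor>..\<lfloor>R / h\<rfloor>}) \<le> 2 * R / h + 2" by (simp add: of_nat_nat) linarith
  qed simp
  finally show ?thesis .
qed

lemma cell_borel [measurable]: "cell h R k \<in> sets borel"
proof -
  have "{x :: real^'a. norm x \<le> R \<and> (\<forall>i. \<lfloor>x $ i / h\<rfloor> = k i)} = 
      {x. norm x \<le> R} \<inter> (\<Inter>i. {x. of_int (k i) \<le> x $ i / h \<and> x $ i / h < of_int (k i) + 1})"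
    by (auto simp: floor_eq_iff)
  also have "\<dots> \<in> sets borel" by measurable
  finally show ?thesis by (simp add: cell_def)
qed

lemma disjoint_cells: "disjoint_family_on (cell h R) K"
  by (auto simp: disjoint_family_on_def cell_def)

lemma Union_cells:
  assumes "0 < h"
  shows "(\<Union>k\<in>cells h R. cell h R k) = {x :: real^'d. norm x \<le> R}"
proof -
  have "x \<in> (\<Union>k\<in>cells h R. cell h R k)" if "norm x \<le> R" for x :: "real^'d"
  proof (rule UN_I[of "\<lambda>i. \<lfloor>x $ i / h\<rfloor>"])
    have "- R / h \<le> x $ i / h" "x $ i / h \<le> R / h" for i
      using component_le_norm_cart[of x i] that assms
        divide_right_mono[of "- R" "x $ i" h] divide_right_mono[of "x $ i" R h] by simp_all
    then show "(\<lambda>i. \<lfloor>x $ i / h\<rfloor>) \<in> cells h R"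
      by (auto simp: cells_def intro!: floor_mono)
  qed (simp add: cell_def that)
  then show ?thesis by (auto simp: cell_def)
qed

lemma dist_cell_le:
  fixes x y :: "real^'d"
  assumes h: "0 < h" and "x \<in> cell h R k" "y \<in> cell h R k"
  shows "dist x y \<le> real CARD('d) * h"
proof -
  have "\<bar>x $ i - y $ i\<bar> \<le> h" for i
  proof -
    have "\<lfloor>x $ i / h\<rfloor> = \<lfloor>y $ i / h\<rfloor>" using assms by (simp add: cell_def)
    then have "\<bar>x $ i / h - y $ i / h\<bar> \<le> 1" by linarith
    then have "\<bar>x $ i - y $ i\<bar> / h \<le> 1" using h by (simp add: abs_divide flip: diff_divide_distrib)
    then show ?thesis using h by (simp add: divide_le_eq)
  qed
  then have "(\<Sum>i\<in>UNIV. \<bar>(x - y) $ i\<bar>) \<le> of_nat CARD('d) * h"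
    by (intro sum_bounded_above) auto
  then show ?thesis
    unfolding dist_norm by (rule order_trans[OF norm_le_l1_cart])
qed

definition tail :: "real \<Rightarrow> 'a::real_normed_vector measure \<Rightarrow> ennreal" where
  "tail R \<mu> = (\<integral>\<^sup>+x. ennreal (norm x) * indicator {x. R < norm x} x \<partial>\<mu>)"

text \<open>The cells where \<open>\<mu>\<close> dominates and those where \<open>\<nu>\<close>
  dominates form two unions, each contributing at most \<open>u\<close>. As these unions depend on
  the measures, all subfamilies have to be controlled at once.\<close>

lemma sum_abs_diff_le:
  fixes \<mu> \<nu> :: "'a measure"
  assumes "finite_measure \<mu>" "finite_measure \<nu>" and K: "finite K" "disjoint_family_on B K"
    and B: "\<And>k. k \<in> K \<Longrightarrow> B k \<in> sets \<mu>" "sets \<nu> = sets \<mu>"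
    and le: "\<And>S. S \<subseteq> K \<Longrightarrow> \<bar>measure \<mu> (\<Union>k\<in>S. B k) - measure \<nu> (\<Union>k\<in>S. B k)\<bar> \<le> u"
  shows "(\<Sum>k\<in>K. \<bar>measure \<mu> (B k) - measure \<nu> (B k)\<bar>) \<le> 2 * u"
proof -
  interpret mu: finite_measure \<mu> by fact
  interpret nu: finite_measure \<nu> by fact
  let ?P = "{k\<in>K. measure \<nu> (B k) \<le> measure \<mu> (B k)}" and ?Q = "{k\<in>K. measure \<mu> (B k) < measure \<nu> (B k)}"
  have U: "measure \<mu> (\<Union>k\<in>S. B k) - measure \<nu> (\<Union>k\<in>S. B k) = (\<Sum>k\<in>S. measure \<mu> (B k) - measure \<nu> (B k))" if "S \<subseteq> K" for S
  proof -
    have "finite S" "disjoint_family_on B S" "B ` S \<subseteq> sets \<mu>" "B ` S \<subseteq> sets \<nu>"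
      using that K B finite_subset disjoint_family_on_mono[OF that] by auto
    then show ?thesis by (simp add: mu.finite_measure_finite_Union nu.finite_measure_finite_Union sum_subtractf)
  qed
  have "(\<Sum>k\<in>K. \<bar>measure \<mu> (B k) - measure \<nu> (B k)\<bar>)
      = (\<Sum>k\<in>?P \<union> ?Q. \<bar>measure \<mu> (B k) - measure \<nu> (B k)\<bar>)"
    by (intro sum.cong) auto
  also have "\<dots> = (\<Sum>k\<in>?P. \<bar>measure \<mu> (B k) - measure \<nu> (B k)\<bar>) + (\<Sum>k\<in>?Q. \<bar>measure \<mu> (B k) - measure \<nu> (B k)\<bar>)"
    using K by (intro sum.union_disjoint) auto
  also have "(\<Sum>k\<in>?P. \<bar>measure \<mu> (B k) - measure \<nu> (B k)\<bar>) = (\<Sum>k\<in>?P. measure \<mu> (B k) - measure \<nu> (B k))"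
    by (intro sum.cong) auto
  also have "(\<Sum>k\<in>?Q. \<bar>measure \<mu> (B k) - measure \<nu> (B k)\<bar>) = - (\<Sum>k\<in>?Q. measure \<mu> (B k) - measure \<nu> (B k))"
    unfolding sum_negf[symmetric] by (intro sum.cong) auto
  also have "(\<Sum>k\<in>?P. measure \<mu> (B k) - measure \<nu> (B k)) + - (\<Sum>k\<in>?Q. measure \<mu> (B k) - measure \<nu> (B k)) \<le> u + u"
    using le[of ?P] le[of ?Q] U[of ?P] U[of ?Q] by (intro add_mono) auto
  finally show ?thesis by simp
qed

text \<open>The budget \<open>t\<close> is split into quarters: the cell diameter, the two tails,
  and \<open>R\<close> times the total variation, for which \<open>t / (8 * R)\<close> per union
  gives \<open>2 * t / (8 * R)\<close> in total.\<close>

lemma W1_le_of_cells: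
  fixes \<mu> \<nu> :: "(real^'d) measure"
  assumes mu: "\<mu> \<in> P1" and nu: "\<nu> \<in> P1" and t: "0 < t" and R: "0 < R" and h: "0 < h" "real CARD('d) * h \<le> t / 4"
    and tails: "tail R \<mu> \<le> ennreal (t / 4)" "tail R \<nu> \<le> ennreal (t / 4)"
    and le: "\<And>S. S \<subseteq> cells h R \<Longrightarrow> \<bar>measure \<mu> (\<Union>k\<in>S. cell h R k) - measure \<nu> (\<Union>k\<in>S. cell h R k)\<bar> \<le> t / (8 * R)"
  shows "W1 \<mu> \<nu> \<le> t"
proof -
  have off: "- (\<Union>k\<in>cells h R. cell h R k) = {x :: real^'d. R < norm x}"
    unfolding Union_cells[OF h(1)] by auto
  have norm_cell: "norm x \<le> R" if "x \<in> cell h R k" for x :: "real^'d" and k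
    using that by (simp add: cell_def)
  have "(\<Sum>k\<in>cells h R. \<bar>measure \<mu> (cell h R k) - measure \<nu> (cell h R k)\<bar>) \<le> 2 * (t / (8 * R))"
    using P1_D[OF mu] P1_D[OF nu] le
    by (intro sum_abs_diff_le finite_cells disjoint_cells) (auto simp: prob_space_def)
  then have "R * (\<Sum>k\<in>cells h R. \<bar>measure \<mu> (cell h R k) - measure \<nu> (cell h R k)\<bar>) \<le> R * (2 * (t / (8 * R)))"
    using R by (intro mult_left_mono) auto
  also have "\<dots> = t / 4" using R by simp
  finally have s: "R * (\<Sum>k\<in>cells h R. \<bar>measure \<mu> (cell h R k) - measure \<nu> (cell h R k)\<bar>) \<le> t / 4" .
  have "W1 \<mu> \<nu> \<le> real CARD('d) * h + t / 4 + t / 4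
      + R * (\<Sum>k\<in>cells h R. \<bar>measure \<mu> (cell h R k) - measure \<nu> (cell h R k)\<bar>)"
    by (rule W1_le_cells[OF mu nu finite_cells disjoint_cells])
       (use h t R tails[unfolded tail_def, folded off] dist_cell_le[OF h(1)] norm_cell in \<open>auto simp del: Compl_UN\<close>)
  then show ?thesis using s h by linarith
qed

section \<open>The bad event of one step\<close>

context mean_field
begin

text \<open>A substitute for the event that the fluctuation exceeds \<open>t\<close> in
  \<open>W1\<close>. It is composed of tails and of masses of finitely many Borel sets, so its
  measurability and its probability are accessible.\<close>

definition bad :: "real \<Rightarrow> real \<Rightarrow> real \<Rightarrow> nat \<Rightarrow> (nat \<Rightarrow> real^'d) \<Rightarrow> (nat \<Rightarrow> 'b) \<Rightarrow> bool" where
  "bad t R h N x z \<longleftrightarrow> ennreal (t / 4) < tail R (emp N (move N x z))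
     \<or> ennreal (t / 4) < tail R (Psi A \<delta> f \<theta> (emp N x))
     \<or> (\<exists>S\<in>Pow (cells h R). t / (8 * R) \<le>
          \<bar>measure (emp N (move N x z)) (\<Union>k\<in>S. cell h R k) - measure (Psi A \<delta> f \<theta> (emp N x)) (\<Union>k\<in>S. cell h R k)\<bar>)"

lemma W1_step_le:
  assumes "1 \<le> N" "0 < t" "0 < R" "0 < h" "real CARD('d) * h \<le> t / 4" "\<not> bad t R h N x z"
  shows "W1 (emp N (move N x z)) (Psi A \<delta> f \<theta> (emp N x)) \<le> t"
  using assms
  by (intro W1_le_of_cells[where R=R and h=h] Psi_in_P1 emp_in_P1) (auto simp: bad_def not_less not_le less_imp_le)

abbreviation \<Theta> :: "nat \<Rightarrow> (nat \<Rightarrow> 'b) measure" where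
  "\<Theta> N \<equiv> PiM {1..N} (\<lambda>_. \<theta>)"

abbreviation E :: "nat \<Rightarrow> (nat \<Rightarrow> real^'d) measure" where
  "E N \<equiv> PiM {1..N} (\<lambda>_. borel)"

lemma move_measurable:
  assumes N: "1 \<le> N" and i: "i \<in> {1..N}"
    and X: "\<And>i. i \<in> {1..N} \<Longrightarrow> (\<lambda>w. X w i) \<in> P \<rightarrow>\<^sub>M borel"
    and Z: "\<And>i. i \<in> {1..N} \<Longrightarrow> (\<lambda>w. Z w i) \<in> P \<rightarrow>\<^sub>M borel"
  shows "(\<lambda>w. move N (X w) (Z w) i) \<in> P \<rightarrow>\<^sub>M borel"
  unfolding move_def by (intro step_measurable X Z i measurable_emp N) auto

lemma Psi_emp_measurable:
  assumes N: "1 \<le> N" and g[measurable]: "g \<in> borel_measurable borel"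
    and X: "\<And>i. i \<in> {1..N} \<Longrightarrow> (\<lambda>w. X w i) \<in> P \<rightarrow>\<^sub>M borel"
  shows "(\<lambda>w. \<integral>\<^sup>+y. g y \<partial>Psi A \<delta> f \<theta> (emp N (X w))) \<in> borel_measurable P"
proof -
  have "(\<lambda>w. \<integral>\<^sup>+z. g (step (emp N (X w)) (X w i) z) \<partial>\<theta>) \<in> borel_measurable P" if i: "i \<in> {1..N}" for i
  proof (intro theta.borel_measurable_nn_integral, unfold case_prod_beta')
    have "(\<lambda>v. step (emp N (X (fst v))) (X (fst v) i) (snd v)) \<in> P \<Otimes>\<^sub>M \<theta> \<rightarrow>\<^sub>M borel"
      using i by (intro step_measurable measurable_emp N measurable_compose[OF measurable_fst X]) auto
    then show "(\<lambda>v. g (step (emp N (X (fst v))) (X (fst v) i) (snd v))) \<in> borel_measurable (P \<Otimes>\<^sub>M \<theta>)"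
      by measurable
  qed
  then have [measurable]: "(\<lambda>w. \<Sum>i\<in>{1..N}. \<integral>\<^sup>+z. g (step (emp N (X w)) (X w i) z) \<partial>\<theta>) \<in> borel_measurable P"
    by (intro borel_measurable_sum)
  show ?thesis unfolding nn_integral_Psi_emp[OF N g] by measurable
qed

lemma Psi_measure_measurable:
  assumes N: "1 \<le> N" and S[measurable]: "S \<in> sets borel"
    and X: "\<And>i. i \<in> {1..N} \<Longrightarrow> (\<lambda>w. X w i) \<in> P \<rightarrow>\<^sub>M borel"
  shows "(\<lambda>w. measure (Psi A \<delta> f \<theta> (emp N (X w))) S) \<in> borel_measurable P"
  using Psi_emp_measurable[OF N _ X, where g="indicator S"] by (simp add: measure_def)

lemma emp_integral_measurable:
  assumes N: "1 \<le> N" and g[measurable]: "g \<in> borel_measurable borel"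
    and X: "\<And>i. i \<in> {1..N} \<Longrightarrow> (\<lambda>w. X w i) \<in> P \<rightarrow>\<^sub>M borel"
  shows "(\<lambda>w. \<integral>\<^sup>+y. g y \<partial>emp N (X w)) \<in> borel_measurable P"
proof -
  have [measurable]: "(\<lambda>w. \<Sum>i\<in>{1..N}. g (X w i)) \<in> borel_measurable P"
    by (intro borel_measurable_sum measurable_compose[OF X g])
  show ?thesis unfolding nn_integral_emp[OF N g] by measurable
qed

lemma emp_measure_measurable:
  assumes N: "1 \<le> N" and S[measurable]: "S \<in> sets borel"
    and X: "\<And>i. i \<in> {1..N} \<Longrightarrow> (\<lambda>w. X w i) \<in> P \<rightarrow>\<^sub>M borel"
  shows "(\<lambda>w. measure (emp N (X w)) S) \<in> borel_measurable P"
  using emp_integral_measurable[OF N _ X, where g="indicator S"] by (simp add: measure_def)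

lemma Union_cell_borel: "S \<subseteq> cells h R \<Longrightarrow> (\<Union>k\<in>S. cell h R k) \<in> sets borel"
  using finite_subset[OF _ finite_cells] by (intro sets.finite_UN) auto

lemma bad_events:
  assumes N: "1 \<le> N"
  shows "{w \<in> space (E N \<Otimes>\<^sub>M \<Theta> N). ennreal (t / 4) < tail R (emp N (move N (fst w) (snd w)))} \<in> sets (E N \<Otimes>\<^sub>M \<Theta> N)"
    and "{w \<in> space (E N \<Otimes>\<^sub>M \<Theta> N). ennreal (t / 4) < tail R (Psi A \<delta> f \<theta> (emp N (fst w)))} \<in> sets (E N \<Otimes>\<^sub>M \<Theta> N)"
    and "S \<in> sets borel \<Longrightarrow> {w \<in> space (E N \<Otimes>\<^sub>M \<Theta> N). u \<le>
          \<bar>measure (emp N (move N (fst w) (snd w))) S - measure (Psi A \<delta> f \<theta> (emp N (fst w))) S\<bar>} \<in> sets (E N \<Otimes>\<^sub>M \<Theta> N)"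
proof -
  have X: "(\<lambda>w. fst w i) \<in> E N \<Otimes>\<^sub>M \<Theta> N \<rightarrow>\<^sub>M borel" and Z: "(\<lambda>w. snd w i) \<in> E N \<Otimes>\<^sub>M \<Theta> N \<rightarrow>\<^sub>M borel"
    if "i \<in> {1..N}" for i using that by (measurable; simp add: measurable_ident_sets sets_theta)+
  note mv = move_measurable[OF N _ X Z]
  have g: "(\<lambda>x. ennreal (norm x) * indicator {x. R < norm x} x) \<in> borel_measurable (borel :: (real^'d) measure)"
    by measurable
  note [measurable] = emp_integral_measurable[OF N g mv] Psi_emp_measurable[OF N g X]
  show "{w \<in> space (E N \<Otimes>\<^sub>M \<Theta> N). ennreal (t / 4) < tail R (emp N (move N (fst w) (snd w)))} \<in> sets (E N \<Otimes>\<^sub>M \<Theta> N)"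
    and "{w \<in> space (E N \<Otimes>\<^sub>M \<Theta> N). ennreal (t / 4) < tail R (Psi A \<delta> f \<theta> (emp N (fst w)))} \<in> sets (E N \<Otimes>\<^sub>M \<Theta> N)"
    unfolding tail_def by measurable
  assume S: "S \<in> sets borel"
  note [measurable] = emp_measure_measurable[OF N S mv] Psi_measure_measurable[OF N S X]
  show "{w \<in> space (E N \<Otimes>\<^sub>M \<Theta> N). u \<le>
          \<bar>measure (emp N (move N (fst w) (snd w))) S - measure (Psi A \<delta> f \<theta> (emp N (fst w))) S\<bar>} \<in> sets (E N \<Otimes>\<^sub>M \<Theta> N)"
    by measurable
qed

end

lemma nn_integral_PiM_coordinate:
  assumes "prob_space \<theta>" "i \<in> I" "g \<in> borel_measurable \<theta>"
  shows "(\<integral>\<^sup>+z. g (z i) \<partial>PiM I (\<lambda>_. \<theta>)) = (\<integral>\<^sup>+z. g z \<partial>\<theta>)"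
proof -
  have "(\<integral>\<^sup>+z. g z \<partial>\<theta>) = (\<integral>\<^sup>+z. g z \<partial>distr (PiM I (\<lambda>_. \<theta>)) \<theta> (\<lambda>z. z i))"
    using assms by (subst distr_PiM_component[of I "\<lambda>_. \<theta>" i]) auto
  also have "\<dots> = (\<integral>\<^sup>+z. g (z i) \<partial>PiM I (\<lambda>_. \<theta>))"
    using assms by (subst nn_integral_distr) auto
  finally show ?thesis by simp
qed

lemma tail_le_moment:
  assumes "1 \<le> p" "0 < R" and s[measurable_cong]: "sets \<mu> = sets (borel :: 'a::euclidean_space measure)"
  shows "tail R \<mu> \<le> ennreal (R powr (1 - p)) * (\<integral>\<^sup>+x. ennreal (norm x powr p) \<partial>\<mu>)"
proof -
  have "tail R \<mu> \<le> (\<integral>\<^sup>+x. ennreal (R powr (1 - p)) * ennreal (norm x powr p) \<partial>\<mu>)"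
    unfolding tail_def
  proof (intro nn_integral_mono)
    fix x :: 'a
    show "ennreal (norm x) * indicator {x. R < norm x} x \<le> ennreal (R powr (1 - p)) * ennreal (norm x powr p)"
    proof (cases "R < norm x")
      case True
      then have "norm x = norm x powr (1 - p) * norm x powr p"
        using assms by (simp flip: powr_add)
      also have "\<dots> \<le> R powr (1 - p) * norm x powr p"
        using True assms by (intro mult_right_mono powr_mono2') auto
      finally show ?thesis using True by (simp add: ennreal_leI flip: ennreal_mult)
    qed simp
  qed
  also have "\<dots> = ennreal (R powr (1 - p)) * (\<integral>\<^sup>+x. ennreal (norm x powr p) \<partial>\<mu>)"
    by (rule nn_integral_cmult) measurable
  finally show ?thesis .
qed

lemma of_nat_mult_divide_ennreal:
  "0 < N \<Longrightarrow> 0 \<le> V \<Longrightarrow> of_nat N * ennreal V / of_nat N = ennreal V"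
  by (simp add: ennreal_of_nat_eq_real_of_nat divide_ennreal flip: ennreal_mult)

context mean_field
begin

text \<open>The factor in the recursion for the average \<open>p\<close>-th moment, with
  \<open>c\<^sub>0\<close> as its additive term.\<close>

definition \<rho> :: real where "\<rho> = 4 powr (p - 1) * (\<kappa> powr p + 2 * \<delta> powr p * s)"

definition c\<^sub>0 :: real where "c\<^sub>0 = 4 powr (p - 1) * \<delta> powr p * enn2real F0"

lemma c0: "ennreal (4 powr (p - 1) * \<delta> powr p) * F0 = ennreal c\<^sub>0"
proof -
  have "F0 = ennreal (enn2real F0)" using f0 by (simp add: F0_def less_top)
  then show ?thesis unfolding c\<^sub>0_def by (metis ennreal_mult enn2real_nonneg powr_ge_zero mult_nonneg_nonneg)
qed

lemma rho_nonneg: "0 \<le> \<rho>" "0 \<le> c\<^sub>0"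
  using nonneg by (auto simp: \<rho>_def c\<^sub>0_def)

definition moment :: "nat \<Rightarrow> (nat \<Rightarrow> real^'d) \<Rightarrow> ennreal" where
  "moment N x = (\<Sum>i\<in>{1..N}. ennreal (norm (x i) powr p))"

text \<open>\<open>L\<close> is the law of the particle system at some time, \<open>V\<close> a bound on its \<open>p\<close>-th moment that is
  preserved by the dynamics.\<close>

context
  fixes N :: nat and L :: "(nat \<Rightarrow> real^'d) measure" and V :: real
  assumes N: "1 \<le> N" and pL: "prob_space L" and sL[measurable_cong]: "sets L = sets (E N)"
    and V: "0 \<le> V" "\<rho> * V + c\<^sub>0 \<le> V"
    and mom: "(\<integral>\<^sup>+x. moment N x \<partial>L) \<le> of_nat N * ennreal V"
begin

interpretation L: prob_space L by (fact pL)
interpretation T: prob_space "\<Theta> N" by (intro prob_space_PiM prob_theta)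
interpretation LT: pair_prob_space L "\<Theta> N" ..

lemma coordinate_measurable:
  "i \<in> {1..N} \<Longrightarrow> (\<lambda>w. fst w i) \<in> L \<Otimes>\<^sub>M \<Theta> N \<rightarrow>\<^sub>M borel" "i \<in> {1..N} \<Longrightarrow> (\<lambda>w. snd w i) \<in> L \<Otimes>\<^sub>M \<Theta> N \<rightarrow>\<^sub>M borel"
  by (measurable; simp add: measurable_ident_sets sets_theta)+

lemma moment_step_integral:
  "(\<integral>\<^sup>+x. (\<Sum>i\<in>{1..N}. \<integral>\<^sup>+z. ennreal (norm (step (emp N x) (x i) z) powr p) \<partial>\<theta>) \<partial>L) \<le> of_nat N * ennreal V"
proof -
  have [measurable]: "moment N \<in> borel_measurable L"
    unfolding moment_def by measurable
  have "(\<integral>\<^sup>+x. (\<Sum>i\<in>{1..N}. \<integral>\<^sup>+z. ennreal (norm (step (emp N x) (x i) z) powr p) \<partial>\<theta>) \<partial>L)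
      \<le> (\<integral>\<^sup>+x. ennreal \<rho> * moment N x + of_nat N * ennreal c\<^sub>0 \<partial>L)"
    using moment_step[OF N] unfolding moment_def \<rho>_def c0 by (intro nn_integral_mono) auto
  also have "\<dots> = ennreal \<rho> * (\<integral>\<^sup>+x. moment N x \<partial>L) + of_nat N * ennreal c\<^sub>0"
    by (simp add: nn_integral_add nn_integral_cmult L.emeasure_space_1)
  also have "\<dots> \<le> ennreal \<rho> * (of_nat N * ennreal V) + of_nat N * ennreal c\<^sub>0"
    using mom by (intro add_mono mult_left_mono) auto
  also have "\<dots> = of_nat N * ennreal (\<rho> * V + c\<^sub>0)"
    using rho_nonneg V by (simp add: ennreal_mult distrib_left mult_ac)
  also have "\<dots> \<le> of_nat N * ennreal V"
    using V by (intro mult_left_mono ennreal_leI) auto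
  finally show ?thesis .
qed

lemma moment_move:
  "(\<integral>\<^sup>+w. moment N (move N (fst w) (snd w)) \<partial>(L \<Otimes>\<^sub>M \<Theta> N)) \<le> of_nat N * ennreal V"
proof -
  note [measurable] = move_measurable[OF N _ coordinate_measurable]
  have "(\<integral>\<^sup>+w. moment N (move N (fst w) (snd w)) \<partial>(L \<Otimes>\<^sub>M \<Theta> N))
      = (\<integral>\<^sup>+x. \<integral>\<^sup>+z. moment N (move N x z) \<partial>\<Theta> N \<partial>L)"
  proof (subst T.nn_integral_fst[symmetric])
    show "(\<lambda>w. moment N (move N (fst w) (snd w))) \<in> borel_measurable (L \<Otimes>\<^sub>M \<Theta> N)"
      unfolding moment_def by measurable
  qed simp
  also have "\<dots> = (\<integral>\<^sup>+x. (\<Sum>i\<in>{1..N}. \<integral>\<^sup>+z. ennreal (norm (step (emp N x) (x i) z) powr p) \<partial>\<theta>) \<partial>L)"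
  proof (intro nn_integral_cong)
    fix x
    note [measurable] = emp_in_P1[OF N, of x]
    have "(\<lambda>z. ennreal (norm (move N x z i) powr p)) \<in> borel_measurable (\<Theta> N)" if "i \<in> {1..N}" for i
      using that unfolding move_def by measurable
    then have "(\<integral>\<^sup>+z. moment N (move N x z) \<partial>\<Theta> N) = (\<Sum>i\<in>{1..N}. \<integral>\<^sup>+z. ennreal (norm (move N x z i) powr p) \<partial>\<Theta> N)"
      unfolding moment_def by (rule nn_integral_sum)
    also have "\<dots> = (\<Sum>i\<in>{1..N}. \<integral>\<^sup>+z. ennreal (norm (step (emp N x) (x i) z) powr p) \<partial>\<theta>)"
      unfolding move_def by (intro sum.cong refl nn_integral_PiM_coordinate[of \<theta> _ _ "\<lambda>z. ennreal (norm (step (emp N x) (x _) z) powr p)"] prob_theta) measurable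
    finally show "(\<integral>\<^sup>+z. moment N (move N x z) \<partial>\<Theta> N) = (\<Sum>i\<in>{1..N}. \<integral>\<^sup>+z. ennreal (norm (step (emp N x) (x i) z) powr p) \<partial>\<theta>)" .
  qed
  finally show ?thesis using moment_step_integral by simp
qed

context
  fixes t R h :: real
  assumes t: "0 < t" and R: "0 < R"
begin

text \<open>One argument for both tails: \<open>u\<close> is the tail of the new empirical measure
  or of its conditional mean, and \<open>g / N\<close> is the \<open>p\<close>-th moment of the same
  measure. Both satisfy the same bound on the integral of \<open>g\<close>.\<close>

lemma markov:
  assumes m: "u \<in> borel_measurable (L \<Otimes>\<^sub>M \<Theta> N)"
    and le: "\<And>w. u w \<le> ennreal (R powr (1 - p)) * (g w / of_nat N)"
    and g: "g \<in> borel_measurable (L \<Otimes>\<^sub>M \<Theta> N)" "(\<integral>\<^sup>+w. g w \<partial>(L \<Otimes>\<^sub>M \<Theta> N)) \<le> of_nat N * ennreal V"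
  shows "emeasure (L \<Otimes>\<^sub>M \<Theta> N) {w \<in> space (L \<Otimes>\<^sub>M \<Theta> N). ennreal (t / 4) < u w} \<le> ennreal (4 / t * R powr (1 - p) * V)"
proof -
  note m[measurable] g(1)[measurable]
  have "emeasure (L \<Otimes>\<^sub>M \<Theta> N) {w \<in> space (L \<Otimes>\<^sub>M \<Theta> N). ennreal (t / 4) < u w}
      \<le> emeasure (L \<Otimes>\<^sub>M \<Theta> N) ({w \<in> space (L \<Otimes>\<^sub>M \<Theta> N). 1 \<le> ennreal (4 / t) * u w})"
  proof (intro emeasure_mono subsetI)
    fix w assume "w \<in> {w \<in> space (L \<Otimes>\<^sub>M \<Theta> N). ennreal (t / 4) < u w}"
    moreover from this have "ennreal (4 / t) * ennreal (t / 4) \<le> ennreal (4 / t) * u w"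
      by (intro mult_left_mono) auto
    moreover have "ennreal (4 / t) * ennreal (t / 4) = 1" using t by (simp flip: ennreal_mult)
    ultimately show "w \<in> {w \<in> space (L \<Otimes>\<^sub>M \<Theta> N). 1 \<le> ennreal (4 / t) * u w}" by auto
  qed measurable
  also have "\<dots> \<le> ennreal (4 / t) * (\<integral>\<^sup>+w. u w * indicator (space (L \<Otimes>\<^sub>M \<Theta> N)) w \<partial>(L \<Otimes>\<^sub>M \<Theta> N))"
    by (rule nn_integral_Markov_inequality) measurable
  also have "\<dots> \<le> ennreal (4 / t) * (\<integral>\<^sup>+w. ennreal (R powr (1 - p)) * (g w / of_nat N) \<partial>(L \<Otimes>\<^sub>M \<Theta> N))"
    by (intro mult_left_mono nn_integral_mono) (auto simp: le indicator_def)
  also have "\<dots> = ennreal (4 / t) * (ennreal (R powr (1 - p)) * ((\<integral>\<^sup>+w. g w \<partial>(L \<Otimes>\<^sub>M \<Theta> N)) / of_nat N))"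
    by (subst nn_integral_cmult, measurable, subst nn_integral_divide, measurable)
  also have "\<dots> \<le> ennreal (4 / t) * (ennreal (R powr (1 - p)) * (of_nat N * ennreal V / of_nat N))"
    by (intro mult_left_mono divide_right_mono_ennreal g) auto
  also have "\<dots> = ennreal (4 / t * R powr (1 - p) * V)"
    using N V t by (subst of_nat_mult_divide_ennreal) (simp_all add: mult.assoc flip: ennreal_mult)
  finally show ?thesis .
qed

text \<open>Each of the two tails costs \<open>4 / t * R powr (1 - p) * V\<close>; the remaining
  summand is Hoeffding's bound times the number of unions of cells.\<close>

lemma bad_prob:
  "emeasure (L \<Otimes>\<^sub>M \<Theta> N) {w \<in> space (L \<Otimes>\<^sub>M \<Theta> N). bad t R h N (fst w) (snd w)}
     \<le> ennreal (8 / t * R powr (1 - p) * V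
        + 2 ^ card (cells h R :: ('d \<Rightarrow> int) set) * (2 * exp (- 2 * real N * (t / (8 * R))\<^sup>2)))"
proof -
  let ?P = "L \<Otimes>\<^sub>M \<Theta> N" and ?X = "2 * exp (- 2 * real N * (t / (8 * R))\<^sup>2)"
  note mv = move_measurable[OF N _ coordinate_measurable]
  have sP: "sets ?P = sets (E N \<Otimes>\<^sub>M \<Theta> N)" by (intro sets_pair_measure_cong sL refl)
  have spP: "space (E N \<Otimes>\<^sub>M \<Theta> N) = space ?P" using sets_eq_imp_space_eq[OF sP] by simp
  note ev = bad_events[OF N, folded sP, unfolded spP]
  define B1 where "B1 = {w \<in> space ?P. ennreal (t / 4) < tail R (emp N (move N (fst w) (snd w)))}"
  define B2 where "B2 = {w \<in> space ?P. ennreal (t / 4) < tail R (Psi A \<delta> f \<theta> (emp N (fst w)))}"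
  define B3 where "B3 S = {w \<in> space ?P. t / (8 * R) \<le>
          \<bar>measure (emp N (move N (fst w) (snd w))) (\<Union>k\<in>S. cell h R k) - measure (Psi A \<delta> f \<theta> (emp N (fst w))) (\<Union>k\<in>S. cell h R k)\<bar>}"
    for S :: "('d \<Rightarrow> int) set"
  have B12[measurable]: "B1 \<in> sets ?P" "B2 \<in> sets ?P" unfolding B1_def B2_def by (fact ev)+
  have B3[measurable]: "B3 S \<in> sets ?P" if "S \<in> Pow (cells h R)" for S
    unfolding B3_def using that by (intro ev(3) Union_cell_borel) auto
  have U: "(\<Union>S\<in>Pow (cells h R). B3 S) \<in> sets ?P"
    using finite_cells B3 by (intro sets.finite_UN) auto
  have "{w \<in> space ?P. bad t R h N (fst w) (snd w)} = B1 \<union> B2 \<union> (\<Union>S\<in>Pow (cells h R). B3 S)"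
    by (auto simp: bad_def B1_def B2_def B3_def)
  then have "emeasure ?P {w \<in> space ?P. bad t R h N (fst w) (snd w)} = emeasure ?P (B1 \<union> B2 \<union> (\<Union>S\<in>Pow (cells h R). B3 S))"
    by simp
  also have "\<dots> \<le> emeasure ?P (B1 \<union> B2) + emeasure ?P (\<Union>S\<in>Pow (cells h R). B3 S)"
    using B12 U by (intro emeasure_subadditive) auto
  also have "\<dots> \<le> (emeasure ?P B1 + emeasure ?P B2) + (\<Sum>S\<in>Pow (cells h R). emeasure ?P (B3 S))"
    using B12 B3 finite_cells by (intro add_mono emeasure_subadditive emeasure_subadditive_finite) auto
  also have "\<dots> \<le> (ennreal (4 / t * R powr (1 - p) * V) + ennreal (4 / t * R powr (1 - p) * V))
      + (\<Sum>S\<in>Pow (cells h R :: ('d \<Rightarrow> int) set). ennreal ?X)"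
  proof (intro add_mono sum_mono)
    have g: "(\<lambda>x. ennreal (norm x) * indicator {x. R < norm x} x) \<in> borel_measurable (borel :: (real^'d) measure)"
      "(\<lambda>x. ennreal (norm x powr p)) \<in> borel_measurable (borel :: (real^'d) measure)"
      by measurable
    show "emeasure ?P B1 \<le> ennreal (4 / t * R powr (1 - p) * V)"
      unfolding B1_def
    proof (rule markov[OF _ _ _ moment_move])
      show "(\<lambda>w. tail R (emp N (move N (fst w) (snd w)))) \<in> borel_measurable ?P"
        unfolding tail_def by (rule emp_integral_measurable[OF N g(1) mv])
      show "(\<lambda>w. moment N (move N (fst w) (snd w))) \<in> borel_measurable ?P"
        unfolding moment_def by (intro borel_measurable_sum measurable_compose[OF mv g(2)])
      show "tail R (emp N (move N (fst w) (snd w))) \<le> ennreal (R powr (1 - p)) * (moment N (move N (fst w) (snd w)) / of_nat N)" for w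
        using tail_le_moment[of p R "emp N (move N (fst w) (snd w))"] p R N
        by (simp add: nn_integral_emp moment_def)
    qed
    let ?g = "\<lambda>w. \<Sum>i\<in>{1..N}. \<integral>\<^sup>+z. ennreal (norm (step (emp N (fst w)) (fst w i) z) powr p) \<partial>\<theta>"
    have gm: "(\<lambda>x. (\<Sum>i\<in>{1..N}. \<integral>\<^sup>+z. ennreal (norm (step (emp N x) (x i) z) powr p) \<partial>\<theta>)) \<in> borel_measurable L"
    proof (intro borel_measurable_sum theta.borel_measurable_nn_integral, unfold case_prod_beta')
      fix i assume "i \<in> {1..N}"
      then have "(\<lambda>v. step (emp N (fst v)) (fst v i) (snd v)) \<in> L \<Otimes>\<^sub>M \<theta> \<rightarrow>\<^sub>M borel"
        by (intro step_measurable measurable_emp N) measurable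
      then show "(\<lambda>v. ennreal (norm (step (emp N (fst v)) (fst v i) (snd v)) powr p)) \<in> borel_measurable (L \<Otimes>\<^sub>M \<theta>)"
        by measurable
    qed
    have gm': "?g \<in> borel_measurable ?P"
      by (rule measurable_compose[OF measurable_fst gm])
    have gi: "(\<integral>\<^sup>+w. ?g w \<partial>?P) \<le> of_nat N * ennreal V"
      using moment_step_integral gm' by (subst T.nn_integral_fst[symmetric]) (simp_all add: T.emeasure_space_1 del: One_nat_def)
    show "emeasure ?P B2 \<le> ennreal (4 / t * R powr (1 - p) * V)"
      unfolding B2_def
    proof (rule markov[OF _ _ gm' gi])
      show "(\<lambda>w. tail R (Psi A \<delta> f \<theta> (emp N (fst w)))) \<in> borel_measurable ?P"
        unfolding tail_def by (rule Psi_emp_measurable[OF N g(1) coordinate_measurable(1)])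
      show "tail R (Psi A \<delta> f \<theta> (emp N (fst w))) \<le> ennreal (R powr (1 - p)) * (?g w / of_nat N)" for w
        using tail_le_moment[of p R "Psi A \<delta> f \<theta> (emp N (fst w))"] p R N
        by (simp add: nn_integral_Psi_emp)
    qed
    fix S assume S: "S \<in> Pow (cells h R :: ('d \<Rightarrow> int) set)"
    \<comment> \<open>Hoeffding's inequality holds for every frozen state with the same bound, so it
      is applied in the inner integral and averaged over \<open>L\<close>.\<close>
    have "emeasure ?P (B3 S) = (\<integral>\<^sup>+x. emeasure (\<Theta> N) (Pair x -` B3 S) \<partial>L)"
      by (rule T.emeasure_pair_measure_alt[OF B3[OF S]])
    also have "\<dots> \<le> (\<integral>\<^sup>+x. ennreal ?X \<partial>L)"
    proof (rule nn_integral_mono)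
      fix x assume "x \<in> space L"
      then have "Pair x -` B3 S = {z \<in> space (\<Theta> N). t / (8 * R) \<le>
          \<bar>measure (emp N (move N x z)) (\<Union>k\<in>S. cell h R k) - measure (Psi A \<delta> f \<theta> (emp N x)) (\<Union>k\<in>S. cell h R k)\<bar>}"
        by (auto simp: B3_def space_pair_measure)
      then show "emeasure (\<Theta> N) (Pair x -` B3 S) \<le> ennreal ?X"
        using hoeffding_emp[OF N, of "\<Union>k\<in>S. cell h R k" "t / (8 * R)" x] S t R Union_cell_borel[of S h R]
        by (simp add: T.emeasure_eq_measure ennreal_leI del: One_nat_def)
    qed
    also have "\<dots> = ennreal ?X" by (simp add: L.emeasure_space_1)
    finally show "emeasure ?P (B3 S) \<le> ennreal ?X" .
  qed
  also have "\<dots> = ennreal (8 / t * R powr (1 - p) * V + 2 ^ card (cells h R :: ('d \<Rightarrow> int) set) * ?X)"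
    using t V
    by (simp add: finite_cells card_Pow ennreal_of_nat_eq_real_of_nat flip: ennreal_mult ennreal_plus)
  finally show ?thesis .
qed

end

end

end

section \<open>The particle system\<close>

context prob_space
begin

text \<open>Independence of \<open>X\<close> and \<open>Y\<close>. The library's \<open>indep_var\<close> requires both variables to have the same type.\<close>

definition product_law :: "'b measure \<Rightarrow> ('a \<Rightarrow> 'b) \<Rightarrow> 'c measure \<Rightarrow> ('a \<Rightarrow> 'c) \<Rightarrow> bool" where
  "product_law S X T Y \<longleftrightarrow> X \<in> M \<rightarrow>\<^sub>M S \<and> Y \<in> M \<rightarrow>\<^sub>M T
     \<and> distr M (S \<Otimes>\<^sub>M T) (\<lambda>x. (X x, Y x)) = distr M S X \<Otimes>\<^sub>M distr M T Y"

lemma product_law_indep_set: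
  assumes X: "X \<in> M \<rightarrow>\<^sub>M S" and Y: "Y \<in> M \<rightarrow>\<^sub>M T"
    and ind: "indep_set (sets (vimage_algebra (space M) X S)) (sets (vimage_algebra (space M) Y T))"
  shows "product_law S X T Y"
proof -
  interpret X: prob_space "distr M S X" by (rule prob_space_distr) fact
  interpret Y: prob_space "distr M T Y" by (rule prob_space_distr) fact
  have "distr M S X \<Otimes>\<^sub>M distr M T Y = distr M (S \<Otimes>\<^sub>M T) (\<lambda>x. (X x, Y x))"
  proof (rule pair_measure_eqI)
    fix A B assume "A \<in> sets (distr M S X)" "B \<in> sets (distr M T Y)"
    then have AB: "A \<in> sets S" "B \<in> sets T" by auto
    have "prob ((X -` A \<inter> space M) \<inter> (Y -` B \<inter> space M)) = prob (X -` A \<inter> space M) * prob (Y -` B \<inter> space M)"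
      by (rule indep_setD[OF ind]) (use AB in \<open>auto intro!: in_vimage_algebra\<close>)
    moreover have "(\<lambda>x. (X x, Y x)) -` (A \<times> B) \<inter> space M = (X -` A \<inter> space M) \<inter> (Y -` B \<inter> space M)" by auto
    ultimately show "emeasure (distr M S X) A * emeasure (distr M T Y) B
        = emeasure (distr M (S \<Otimes>\<^sub>M T) (\<lambda>x. (X x, Y x))) (A \<times> B)"
      using AB X Y by (simp add: emeasure_distr emeasure_eq_measure measurable_Pair ennreal_mult)
  qed (auto simp: X.sigma_finite_measure_axioms Y.sigma_finite_measure_axioms intro: sets_pair_measure_cong)
  then show ?thesis using X Y by (simp add: product_law_def)
qed

lemma product_law_compose:
  assumes "product_law S X T Y" and g: "g \<in> S \<rightarrow>\<^sub>M S'" and h: "h \<in> T \<rightarrow>\<^sub>M T'"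
  shows "product_law S' (\<lambda>x. g (X x)) T' (\<lambda>x. h (Y x))"
proof -
  have X: "X \<in> M \<rightarrow>\<^sub>M S" and Y: "Y \<in> M \<rightarrow>\<^sub>M T"
    and e: "distr M (S \<Otimes>\<^sub>M T) (\<lambda>x. (X x, Y x)) = distr M S X \<Otimes>\<^sub>M distr M T Y"
    using assms by (auto simp: product_law_def)
  have gX: "(\<lambda>x. g (X x)) \<in> M \<rightarrow>\<^sub>M S'" and hY: "(\<lambda>x. h (Y x)) \<in> M \<rightarrow>\<^sub>M T'"
    using X Y g h by (auto intro: measurable_compose)
  have dg: "distr M S' (\<lambda>x. g (X x)) = distr (distr M S X) S' g" and dh: "distr M T' (\<lambda>x. h (Y x)) = distr (distr M T Y) T' h"
    using X Y g h by (simp_all add: distr_distr comp_def)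
  interpret Y: prob_space "distr (distr M T Y) T' h"
    unfolding dh[symmetric] by (rule prob_space_distr) fact
  have "distr (distr M S X) S' g \<Otimes>\<^sub>M distr (distr M T Y) T' h
      = distr (distr M S X \<Otimes>\<^sub>M distr M T Y) (S' \<Otimes>\<^sub>M T') (\<lambda>(x, y). (g x, h y))"
    using g h by (intro pair_measure_distr) (auto simp: Y.sigma_finite_measure_axioms)
  also have "\<dots> = distr M (S' \<Otimes>\<^sub>M T') (\<lambda>x. (g (X x), h (Y x)))"
    unfolding e[symmetric] using X Y g h by (subst distr_distr) (auto simp: comp_def)
  finally show ?thesis using gX hY by (simp add: product_law_def dg dh)
qed

text \<open>To be read with the initial positions as \<open>U\<close>, the noise of the past as
  \<open>F\<close> and the noise of the next step as \<open>G\<close>. Fubini's theorem splits off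
  \<open>G\<close> for arbitrary measurable sets of pairs \<open>(U, F)\<close>.\<close>

lemma product_law_assoc:
  assumes U: "product_law S U (T1 \<Otimes>\<^sub>M T2) (\<lambda>x. (F x, G x))" and FG: "product_law T1 F T2 G"
  shows "product_law (S \<Otimes>\<^sub>M T1) (\<lambda>x. (U x, F x)) T2 G"
proof -
  have [measurable]: "random_variable S U" "random_variable T1 F" "random_variable T2 G"
    using U FG by (auto simp: product_law_def)
  let ?U = "distr M S U" and ?F = "distr M T1 F" and ?G = "distr M T2 G"
  interpret U: prob_space ?U by (rule prob_space_distr) measurable
  interpret F: prob_space ?F by (rule prob_space_distr) measurable
  interpret G: prob_space ?G by (rule prob_space_distr) measurable
  interpret UF: pair_prob_space ?U ?F ..
  interpret FG: pair_prob_space ?F ?G ..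
  have eFG: "?F \<Otimes>\<^sub>M ?G = distr M (T1 \<Otimes>\<^sub>M T2) (\<lambda>x. (F x, G x))"
    using FG by (simp add: product_law_def)
  have eUFG: "?U \<Otimes>\<^sub>M (?F \<Otimes>\<^sub>M ?G) = distr M (S \<Otimes>\<^sub>M (T1 \<Otimes>\<^sub>M T2)) (\<lambda>x. (U x, F x, G x))"
    unfolding eFG using U by (simp add: product_law_def)
  have I: "(\<integral>\<^sup>+x. indicator A (U x, F x) * indicator B (G x) \<partial>M) = emeasure (?U \<Otimes>\<^sub>M ?F) A * emeasure ?G B"
    if [measurable]: "A \<in> sets (S \<Otimes>\<^sub>M T1)" "B \<in> sets T2" for A B
  proof -
    have "(\<integral>\<^sup>+x. indicator A (U x, F x) * indicator B (G x) \<partial>M)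
        = (\<integral>\<^sup>+w. indicator A (fst w, fst (snd w)) * indicator B (snd (snd w)) \<partial>distr M (S \<Otimes>\<^sub>M (T1 \<Otimes>\<^sub>M T2)) (\<lambda>x. (U x, F x, G x)))"
      by (subst nn_integral_distr) auto
    also have "\<dots> = (\<integral>\<^sup>+w. indicator A (fst w, fst (snd w)) * indicator B (snd (snd w)) \<partial>(?U \<Otimes>\<^sub>M (?F \<Otimes>\<^sub>M ?G)))"
      by (simp add: eUFG)
    also have "\<dots> = (\<integral>\<^sup>+u. \<integral>\<^sup>+v. indicator A (u, fst v) * indicator B (snd v) \<partial>(?F \<Otimes>\<^sub>M ?G) \<partial>?U)"
      by (subst FG.nn_integral_fst[symmetric]) auto
    also have "\<dots> = (\<integral>\<^sup>+u. \<integral>\<^sup>+a. \<integral>\<^sup>+b. indicator A (u, a) * indicator B b \<partial>?G \<partial>?F \<partial>?U)"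
      by (intro nn_integral_cong, subst G.nn_integral_fst[symmetric]) auto
    also have "\<dots> = (\<integral>\<^sup>+u. (\<integral>\<^sup>+a. indicator A (u, a) \<partial>?F) * emeasure ?G B \<partial>?U)"
      by (intro nn_integral_cong) (simp add: nn_integral_cmult nn_integral_multc)
    also have "\<dots> = (\<integral>\<^sup>+u. \<integral>\<^sup>+a. indicator A (u, a) \<partial>?F \<partial>?U) * emeasure ?G B"
      by (rule nn_integral_multc) measurable
    also have "(\<integral>\<^sup>+u. \<integral>\<^sup>+a. indicator A (u, a) \<partial>?F \<partial>?U) = emeasure (?U \<Otimes>\<^sub>M ?F) A"
      by (subst F.nn_integral_fst) auto
    finally show ?thesis .
  qed
  have "distr M (S \<Otimes>\<^sub>M T1) (\<lambda>x. (U x, F x)) = ?U \<Otimes>\<^sub>M ?F"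
  proof (rule measure_eqI)
    fix A assume "A \<in> sets (distr M (S \<Otimes>\<^sub>M T1) (\<lambda>x. (U x, F x)))"
    then have A[measurable]: "A \<in> sets (S \<Otimes>\<^sub>M T1)" by simp
    have "emeasure (distr M (S \<Otimes>\<^sub>M T1) (\<lambda>x. (U x, F x))) A = (\<integral>\<^sup>+x. indicator A (U x, F x) \<partial>M)"
      by (simp add: nn_integral_distr flip: nn_integral_indicator)
    also have "\<dots> = (\<integral>\<^sup>+x. indicator A (U x, F x) * indicator (space T2) (G x) \<partial>M)"
      using measurable_space[of G M T2] by (intro nn_integral_cong) (auto simp: indicator_def)
    finally show "emeasure (distr M (S \<Otimes>\<^sub>M T1) (\<lambda>x. (U x, F x))) A = emeasure (?U \<Otimes>\<^sub>M ?F) A"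
      using I[OF A sets.top] G.emeasure_space_1 by simp
  qed simp
  moreover have "(?U \<Otimes>\<^sub>M ?F) \<Otimes>\<^sub>M ?G = distr M ((S \<Otimes>\<^sub>M T1) \<Otimes>\<^sub>M T2) (\<lambda>x. ((U x, F x), G x))"
  proof (rule pair_measure_eqI)
    fix A B assume "A \<in> sets (?U \<Otimes>\<^sub>M ?F)" "B \<in> sets ?G"
    then have [measurable]: "A \<in> sets (S \<Otimes>\<^sub>M T1)" "B \<in> sets T2"
      using sets_pair_measure_cong[of ?U S ?F T1] by auto
    have "emeasure (distr M ((S \<Otimes>\<^sub>M T1) \<Otimes>\<^sub>M T2) (\<lambda>x. ((U x, F x), G x))) (A \<times> B)
        = (\<integral>\<^sup>+x. indicator (A \<times> B) ((U x, F x), G x) \<partial>M)"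
      by (simp add: nn_integral_distr flip: nn_integral_indicator)
    also have "\<dots> = (\<integral>\<^sup>+x. indicator A (U x, F x) * indicator B (G x) \<partial>M)"
      by (simp add: indicator_times)
    finally show "emeasure (?U \<Otimes>\<^sub>M ?F) A * emeasure ?G B
        = emeasure (distr M ((S \<Otimes>\<^sub>M T1) \<Otimes>\<^sub>M T2) (\<lambda>x. ((U x, F x), G x))) (A \<times> B)"
      using I by simp
  next
    show "sets ((?U \<Otimes>\<^sub>M ?F) \<Otimes>\<^sub>M ?G) = sets (distr M ((S \<Otimes>\<^sub>M T1) \<Otimes>\<^sub>M T2) (\<lambda>x. ((U x, F x), G x)))"
      by (simp cong: sets_pair_measure_cong)
  qed (fact UF.sigma_finite_measure_axioms G.sigma_finite_measure_axioms)+
  ultimately show ?thesis by (simp add: product_law_def)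
qed

end

context mean_field
begin

text \<open>The dynamics without randomness: a function of the initial positions and an array of
  noise values. It exhibits the state at time \<open>k\<close> as a measurable function of
  independent data.\<close>

primrec traj :: "nat \<Rightarrow> (nat \<Rightarrow> real^'d) \<Rightarrow> (nat \<times> nat \<Rightarrow> 'b) \<Rightarrow> nat \<Rightarrow> nat \<Rightarrow> real^'d" where
  "traj N u e 0 = u"
| "traj N u e (Suc k) = move N (traj N u e k) (\<lambda>i. e (Suc k, i))"

lemma traj_measurable:
  assumes N: "1 \<le> N" and "k \<le> m" "i \<in> {1..N}"
  shows "(\<lambda>w. traj N (fst w) (snd w) k i) \<in> E N \<Otimes>\<^sub>M PiM ({1..m} \<times> {1..N}) (\<lambda>_. borel) \<rightarrow>\<^sub>M borel"
  using assms(2,3)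
proof (induction k arbitrary: i)
  case 0
  then show ?case by simp measurable
next
  case (Suc k)
  show ?case
    unfolding traj.simps
  proof (rule move_measurable[OF N Suc.prems(2)])
    fix j assume j: "j \<in> {1..N}"
    show "(\<lambda>w. traj N (fst w) (snd w) k j) \<in> E N \<Otimes>\<^sub>M PiM ({1..m} \<times> {1..N}) (\<lambda>_. borel) \<rightarrow>\<^sub>M borel"
      using Suc j by simp
    have "(Suc k, j) \<in> {1..m} \<times> {1..N}" using Suc.prems j by auto
    then show "(\<lambda>w. snd w (Suc k, j)) \<in> E N \<Otimes>\<^sub>M PiM ({1..m} \<times> {1..N}) (\<lambda>_. borel) \<rightarrow>\<^sub>M borel"
      by measurable
  qed
qed

end

locale particle_system = mean_field A \<delta> \<kappa> \<sigma> s1 p \<theta> f + prob_space M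
  for A :: "real^'d^'d" and \<delta> \<kappa> \<sigma> s1 p :: real and \<theta> :: "'b::euclidean_space measure"
    and f :: "real^'d \<Rightarrow> (real^'d) measure \<Rightarrow> 'b \<Rightarrow> real^'d" and M :: "'w measure" +
  fixes X0 :: "nat \<Rightarrow> nat \<Rightarrow> 'w \<Rightarrow> real^'d" and eps :: "nat \<Rightarrow> nat \<Rightarrow> 'w \<Rightarrow> 'b" and \<mu>0 :: "(real^'d) measure"
  assumes mu0: "\<mu>0 \<in> P1"
    and X0_rv: "\<And>N i. N \<ge> 1 \<Longrightarrow> i \<in> {1..N} \<Longrightarrow> X0 N i \<in> M \<rightarrow>\<^sub>M borel"
    and X0_law: "\<And>N i. N \<ge> 1 \<Longrightarrow> i \<in> {1..N} \<Longrightarrow> distr M borel (X0 N i) = \<mu>0"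
    and eps_rv: "\<And>n i. n \<ge> 1 \<Longrightarrow> i \<ge> 1 \<Longrightarrow> eps n i \<in> M \<rightarrow>\<^sub>M borel"
    and eps_law: "\<And>n i. n \<ge> 1 \<Longrightarrow> i \<ge> 1 \<Longrightarrow> distr M borel (eps n i) = \<theta>"
    and eps_indep: "indep_vars (\<lambda>_. borel) (\<lambda>(n, i). eps n i) ({1..} \<times> {1..})"
    and indep_init: "\<And>N. N \<ge> 1 \<Longrightarrow> indep_set
        (sets (vimage_algebra (space M) (\<lambda>s. \<lambda>i\<in>{1..N}. X0 N i s) (PiM {1..N} (\<lambda>_. borel))))
        (sets (vimage_algebra (space M) (\<lambda>s. \<lambda>(n, i)\<in>{1..} \<times> {1..}. eps n i s)
            (PiM ({1..} \<times> {1..}) (\<lambda>_. borel))))"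
begin

definition Y :: "nat \<Rightarrow> nat \<Rightarrow> 'w \<Rightarrow> nat \<Rightarrow> real^'d" where
  "Y N k s = (\<lambda>i\<in>{1..N}. particle A \<delta> f X0 eps N k i s)"

definition Z :: "nat \<Rightarrow> nat \<Rightarrow> 'w \<Rightarrow> nat \<Rightarrow> 'b" where
  "Z N k s = (\<lambda>i\<in>{1..N}. eps k i s)"

definition past :: "nat \<Rightarrow> nat \<Rightarrow> 'w \<Rightarrow> nat \<times> nat \<Rightarrow> 'b" where
  "past N k s = (\<lambda>(n, i)\<in>{1..k} \<times> {1..N}. eps n i s)"

lemma emp_Y: "1 \<le> N \<Longrightarrow> emp N (Y N k s) = emp_particle A \<delta> f X0 eps N k s"
  unfolding emp_particle_def by (rule emp_cong) (auto simp: Y_def)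

lemma Y_Suc:
  assumes "1 \<le> N" "i \<in> {1..N}"
  shows "Y N (Suc k) s i = move N (Y N k s) (Z N (Suc k) s) i"
  using assms emp_Y[OF assms(1), of k s]
  by (simp add: Y_def Z_def move_def step_def emp_particle_def)

lemma move_cong:
  assumes "1 \<le> N" "\<And>j. j \<in> {1..N} \<Longrightarrow> x j = x' j" "\<And>j. j \<in> {1..N} \<Longrightarrow> z j = z' j" "i \<in> {1..N}"
  shows "move N x z i = move N x' z' i"
  using emp_cong[OF assms(1), of x x'] assms by (simp add: move_def)

text \<open>The horizon \<open>m\<close> of the noise array stays fixed while \<open>k\<close>
  grows, so that the induction hypothesis concerns the same array.\<close>

lemma Y_traj:
  assumes N: "1 \<le> N" and k: "k \<le> m" and "i \<in> {1..N}"
  shows "traj N (\<lambda>i\<in>{1..N}. X0 N i s) (past N m s) k i = Y N k s i"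
  using k \<open>i \<in> {1..N}\<close>
proof (induction k arbitrary: i)
  case (Suc k)
  have "past N m s (Suc k, j) = Z N (Suc k) s j" if "j \<in> {1..N}" for j
    using that Suc.prems by (simp add: past_def Z_def)
  then have "traj N (\<lambda>i\<in>{1..N}. X0 N i s) (past N m s) (Suc k) i = move N (Y N k s) (Z N (Suc k) s) i"
    unfolding traj.simps using Suc.prems
    by (intro move_cong N Suc.IH) (simp_all del: One_nat_def)
  then show ?case by (simp only: Y_Suc[OF N Suc.prems(2)])
qed (simp add: Y_def)

text \<open>The state at time \<open>k\<close> is a function of the initial positions and the noise
  up to time \<open>k\<close>. Two independence hypotheses are combined: initial positions against
  all noise (\<open>1\<close>), and past noise against the next noise (\<open>2\<close>).\<close>

lemma indep_Y_Z:
  assumes N: "1 \<le> N"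
  shows "product_law (E N) (Y N k) (PiM {1..N} (\<lambda>_. borel)) (Z N (Suc k))"
proof -
  let ?I = "{1..} \<times> {1..} :: (nat \<times> nat) set" and ?J = "{1..k} \<times> {1..N}" and ?K = "{Suc k} \<times> {1..N}"
  let ?U = "\<lambda>s. \<lambda>i\<in>{1..N}. X0 N i s" and ?all = "\<lambda>s. \<lambda>(n, i)\<in>?I. eps n i s"
  let ?B = "\<lambda>I. PiM I (\<lambda>_. borel :: 'b measure)"
  have U: "?U \<in> M \<rightarrow>\<^sub>M E N" by (intro measurable_restrict X0_rv N) auto
  have all: "?all \<in> M \<rightarrow>\<^sub>M ?B ?I" by (intro measurable_restrict) (auto intro: eps_rv)
  have pl: "product_law (E N) ?U (?B ?I) ?all"
    using U all indep_init[OF N] by (intro product_law_indep_set)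
  define g where "g e = (restrict e ?J, \<lambda>i\<in>{1..N}. e (Suc k, i))" for e :: "nat \<times> nat \<Rightarrow> 'b"
  have gm: "g \<in> ?B ?I \<rightarrow>\<^sub>M ?B ?J \<Otimes>\<^sub>M ?B {1..N}"
    unfolding g_def by (intro measurable_Pair measurable_restrict measurable_component_singleton) auto
  have "product_law (E N) ?U (?B ?J \<Otimes>\<^sub>M ?B {1..N}) (\<lambda>s. g (?all s))"
    by (rule product_law_compose[OF pl measurable_ident_sets[OF refl] gm])
  moreover have "g (?all s) = (past N k s, Z N (Suc k) s)" for s
    by (auto simp: g_def past_def Z_def restrict_def fun_eq_iff)
  ultimately have 1: "product_law (E N) ?U (?B ?J \<Otimes>\<^sub>M ?B {1..N}) (\<lambda>s. (past N k s, Z N (Suc k) s))"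
    by simp
  have "indep_var (?B ?J) (\<lambda>s. restrict (\<lambda>j. (\<lambda>(n, i). eps n i) j s) ?J) (?B ?K) (\<lambda>s. restrict (\<lambda>j. (\<lambda>(n, i). eps n i) j s) ?K)"
    by (rule indep_var_restrict[OF eps_indep]) auto
  then have pJK: "product_law (?B ?J) (\<lambda>s. restrict (\<lambda>j. (\<lambda>(n, i). eps n i) j s) ?J) (?B ?K) (\<lambda>s. restrict (\<lambda>j. (\<lambda>(n, i). eps n i) j s) ?K)"
    by (simp add: product_law_def indep_var_distribution_eq)
  have km: "(\<lambda>e. \<lambda>i\<in>{1..N}. e (Suc k, i)) \<in> ?B ?K \<rightarrow>\<^sub>M ?B {1..N}"
    by (intro measurable_restrict measurable_component_singleton) auto
  have "product_law (?B ?J) (\<lambda>s. restrict (\<lambda>j. (\<lambda>(n, i). eps n i) j s) ?J)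
      (?B {1..N}) (\<lambda>s. \<lambda>i\<in>{1..N}. restrict (\<lambda>j. (\<lambda>(n, i). eps n i) j s) ?K (Suc k, i))"
    by (rule product_law_compose[OF pJK measurable_ident_sets[OF refl] km])
  moreover have "restrict (\<lambda>j. (\<lambda>(n, i). eps n i) j s) ?J = past N k s"
    "(\<lambda>i\<in>{1..N}. restrict (\<lambda>j. (\<lambda>(n, i). eps n i) j s) ?K (Suc k, i)) = Z N (Suc k) s" for s
    by (auto simp: past_def Z_def restrict_def fun_eq_iff)
  ultimately have 2: "product_law (?B ?J) (past N k) (?B {1..N}) (Z N (Suc k))"
    by simp
  define h where "h w = (\<lambda>i\<in>{1..N}. traj N (fst w) (snd w) k i)" for w :: "(nat \<Rightarrow> real^'d) \<times> (nat \<times> nat \<Rightarrow> 'b)"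
  have hm: "h \<in> E N \<Otimes>\<^sub>M ?B ?J \<rightarrow>\<^sub>M E N"
    unfolding h_def by (intro measurable_restrict traj_measurable N) auto
  have "product_law (E N) (\<lambda>s. h (?U s, past N k s)) (?B {1..N}) (Z N (Suc k))"
    by (rule product_law_compose[OF product_law_assoc[OF 1 2] hm measurable_ident_sets[OF refl]])
  moreover have "h (?U s, past N k s) = Y N k s" for s
    unfolding h_def using Y_traj[OF N order_refl, of _ s k] by (auto simp: restrict_def fun_eq_iff Y_def)
  ultimately show ?thesis by simp
qed

lemma law_Z:
  assumes N: "1 \<le> N"
  shows "distr M (PiM {1..N} (\<lambda>_. borel)) (Z N (Suc k)) = PiM {1..N} (\<lambda>_. \<theta>)"
proof -
  let ?K = "{Suc k} \<times> {1..N}" and ?e = "\<lambda>j s. (\<lambda>(n, i). eps n i) j s"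
  have K: "(\<lambda>e. \<lambda>i\<in>{1..N}. e (Suc k, i)) \<in> PiM ?K (\<lambda>_. borel) \<rightarrow>\<^sub>M PiM {1..N} (\<lambda>_. borel :: 'b measure)"
    by (intro measurable_restrict measurable_component_singleton) auto
  have e: "(\<lambda>s. \<lambda>j\<in>?K. ?e j s) \<in> M \<rightarrow>\<^sub>M PiM ?K (\<lambda>_. borel)"
    by (intro measurable_restrict) (auto intro: eps_rv)
  have "indep_vars (\<lambda>_. borel) (\<lambda>(n, i). eps n i) ?K"
    by (rule indep_vars_subset[OF eps_indep]) auto
  then have "distr M (PiM ?K (\<lambda>_. borel)) (\<lambda>s. \<lambda>j\<in>?K. ?e j s) = PiM ?K (\<lambda>j. distr M borel (?e j))"
    using N by (subst (asm) indep_vars_iff_distr_eq_PiM') (auto intro: eps_rv)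
  also have "\<dots> = PiM ?K (\<lambda>_. \<theta>)"
    by (intro PiM_cong refl) (auto intro: eps_law)
  finally have d: "distr M (PiM ?K (\<lambda>_. borel)) (\<lambda>s. \<lambda>j\<in>?K. ?e j s) = PiM ?K (\<lambda>_. \<theta>)" .
  have "Z N (Suc k) = (\<lambda>e. \<lambda>i\<in>{1..N}. e (Suc k, i)) \<circ> (\<lambda>s. \<lambda>j\<in>?K. ?e j s)"
    by (auto simp: Z_def restrict_def fun_eq_iff)
  then have "distr M (PiM {1..N} (\<lambda>_. borel)) (Z N (Suc k))
      = distr (PiM ?K (\<lambda>_. \<theta>)) (PiM {1..N} (\<lambda>_. borel)) (\<lambda>e. \<lambda>i\<in>{1..N}. e (Suc k, i))"
    unfolding d[symmetric] using distr_distr[OF K e] by simp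
  also have "\<dots> = distr (PiM ?K (\<lambda>_. \<theta>)) (PiM {1..N} (\<lambda>_. \<theta>)) (\<lambda>e. \<lambda>i\<in>{1..N}. e (Suc k, i))"
    by (intro distr_cong sets_PiM_cong) (auto simp: sets_theta)
  also have "\<dots> = PiM {1..N} (\<lambda>_. \<theta>)"
    by (rule distr_PiM_reindex) (auto simp: inj_on_def prob_theta)
  finally show ?thesis .
qed

abbreviation L :: "nat \<Rightarrow> nat \<Rightarrow> (nat \<Rightarrow> real^'d) measure" where
  "L N k \<equiv> distr M (E N) (Y N k)"

lemma Y_Z_measurable:
  assumes N: "1 \<le> N"
  shows "Y N k \<in> M \<rightarrow>\<^sub>M E N" "Z N (Suc k) \<in> M \<rightarrow>\<^sub>M \<Theta> N"
proof -
  show "Y N k \<in> M \<rightarrow>\<^sub>M E N" using indep_Y_Z[OF N] by (simp add: product_law_def)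
  have "sets (\<Theta> N) = sets (PiM {1..N} (\<lambda>_. borel))" by (intro sets_PiM_cong refl sets_theta)
  then show "Z N (Suc k) \<in> M \<rightarrow>\<^sub>M \<Theta> N"
    using indep_Y_Z[OF N, of k] by (simp add: product_law_def cong: measurable_cong_sets)
qed

lemma joint_law:
  assumes N: "1 \<le> N"
  shows "distr M (L N k \<Otimes>\<^sub>M \<Theta> N) (\<lambda>s. (Y N k s, Z N (Suc k) s)) = L N k \<Otimes>\<^sub>M \<Theta> N"
proof -
  have "sets (\<Theta> N) = sets (PiM {1..N} (\<lambda>_. borel))" by (intro sets_PiM_cong refl sets_theta)
  then have "sets (L N k \<Otimes>\<^sub>M \<Theta> N) = sets (E N \<Otimes>\<^sub>M PiM {1..N} (\<lambda>_. borel))"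
    by (intro sets_pair_measure_cong) auto
  then have "distr M (L N k \<Otimes>\<^sub>M \<Theta> N) (\<lambda>s. (Y N k s, Z N (Suc k) s))
     = distr M (E N \<Otimes>\<^sub>M PiM {1..N} (\<lambda>_. borel)) (\<lambda>s. (Y N k s, Z N (Suc k) s))"
    by (intro distr_cong) auto
  also have "\<dots> = L N k \<Otimes>\<^sub>M \<Theta> N"
    using indep_Y_Z[OF N, of k] law_Z[OF N, of k] by (simp add: product_law_def)
  finally show ?thesis .
qed

text \<open>The initial moment is at most \<open>V\<close>, and
  \<open>\<rho> * V + c\<^sub>0 \<le> V\<close> makes this bound invariant under a step;
  \<open>joint_law\<close> turns the expectation over \<open>M\<close> into the integral treated by
  \<open>moment_move\<close>.\<close>

lemma moment_bound:
  assumes N: "1 \<le> N" and V: "0 \<le> V" "\<rho> * V + c\<^sub>0 \<le> V"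
    and V0: "(\<integral>\<^sup>+x. ennreal (norm x powr p) \<partial>\<mu>0) \<le> ennreal V"
  shows "(\<integral>\<^sup>+x. moment N x \<partial>L N k) \<le> of_nat N * ennreal V"
proof (induction k)
  note [measurable] = Y_Z_measurable[OF N]
  have m[measurable]: "moment N \<in> borel_measurable (E N)" unfolding moment_def by measurable
  have LM: "(\<integral>\<^sup>+x. moment N x \<partial>L N k) = (\<integral>\<^sup>+s. moment N (Y N k s) \<partial>M)" for k
    by (rule nn_integral_distr) measurable
  case 0
  have X[measurable]: "X0 N i \<in> M \<rightarrow>\<^sub>M borel" if "i \<in> {1..N}" for i by (intro X0_rv N that)
  have "(\<integral>\<^sup>+s. moment N (Y N 0 s) \<partial>M) = (\<integral>\<^sup>+s. (\<Sum>i\<in>{1..N}. ennreal (norm (X0 N i s) powr p)) \<partial>M)"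
    by (intro nn_integral_cong) (auto simp: moment_def Y_def intro!: sum.cong)
  also have "\<dots> = (\<Sum>i\<in>{1..N}. \<integral>\<^sup>+s. ennreal (norm (X0 N i s) powr p) \<partial>M)"
    by (rule nn_integral_sum) measurable
  also have "\<dots> = (\<Sum>i\<in>{1..N}. \<integral>\<^sup>+x. ennreal (norm x powr p) \<partial>distr M borel (X0 N i))"
    by (intro sum.cong refl nn_integral_distr[symmetric]) measurable
  also have "\<dots> = (\<Sum>i\<in>{1..N}. \<integral>\<^sup>+x. ennreal (norm x powr p) \<partial>\<mu>0)"
    by (intro sum.cong refl arg_cong[where f="\<lambda>m. \<integral>\<^sup>+x. ennreal (norm x powr p) \<partial>m"] X0_law N)
  also have "\<dots> \<le> of_nat N * ennreal V"
    using V0 by (simp add: mult_left_mono)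
  finally show ?case unfolding LM .
next
  note [measurable] = Y_Z_measurable[OF N]
  have m[measurable]: "moment N \<in> borel_measurable (E N)" unfolding moment_def by measurable
  case (Suc k)
  have pL: "prob_space (L N k)" by (rule prob_space_distr) measurable
  have mv: "(\<lambda>w. moment N (move N (fst w) (snd w))) \<in> borel_measurable (L N k \<Otimes>\<^sub>M \<Theta> N)"
  proof -
    have "(\<lambda>w. move N (fst w) (snd w) i) \<in> L N k \<Otimes>\<^sub>M \<Theta> N \<rightarrow>\<^sub>M borel" if "i \<in> {1..N}" for i
      by (intro move_measurable[OF N that] coordinate_measurable[OF N pL _ V Suc.IH]) auto
    then show ?thesis unfolding moment_def by measurable
  qed
  have "(\<integral>\<^sup>+x. moment N x \<partial>L N (Suc k)) = (\<integral>\<^sup>+s. moment N (Y N (Suc k) s) \<partial>M)"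
    by (rule nn_integral_distr) measurable
  also have "\<dots> = (\<integral>\<^sup>+s. moment N (move N (Y N k s) (Z N (Suc k) s)) \<partial>M)"
    unfolding moment_def using Y_Suc[OF N] by (intro nn_integral_cong sum.cong) auto
  also have "\<dots> = (\<integral>\<^sup>+w. moment N (move N (fst w) (snd w)) \<partial>distr M (L N k \<Otimes>\<^sub>M \<Theta> N) (\<lambda>s. (Y N k s, Z N (Suc k) s)))"
    using mv Y_Z_measurable[OF N, of k] by (subst nn_integral_distr) (auto intro!: measurable_Pair)
  also have "\<dots> \<le> of_nat N * ennreal V"
    unfolding joint_law[OF N] by (intro moment_move[OF N pL _ V Suc.IH]) auto
  finally show ?case .
qed

lemma bad_event_prob:
  assumes N: "1 \<le> N" and V: "0 \<le> V" "\<rho> * V + c\<^sub>0 \<le> V"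
    and V0: "(\<integral>\<^sup>+x. ennreal (norm x powr p) \<partial>\<mu>0) \<le> ennreal V" and t: "0 < t" and R: "0 < R"
  shows "{x \<in> space M. bad t R h N (Y N k x) (Z N (Suc k) x)} \<in> events"
    and "prob {x \<in> space M. bad t R h N (Y N k x) (Z N (Suc k) x)}
      \<le> 8 / t * R powr (1 - p) * V
        + 2 ^ card (cells h R :: ('d \<Rightarrow> int) set) * (2 * exp (- 2 * real N * (t / (8 * R))\<^sup>2))"
proof -
  let ?P = "L N k \<Otimes>\<^sub>M \<Theta> N"
  let ?B = "{w \<in> space ?P. bad t R h N (fst w) (snd w)}"
  let ?YZ = "\<lambda>x. (Y N k x, Z N (Suc k) x)"
  have pL: "prob_space (L N k)" by (intro prob_space_distr Y_Z_measurable N)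
  have YZ: "?YZ \<in> M \<rightarrow>\<^sub>M ?P" using Y_Z_measurable[OF N, of k] by (intro measurable_Pair) auto
  have sP: "sets ?P = sets (E N \<Otimes>\<^sub>M \<Theta> N)" by (intro sets_pair_measure_cong refl) simp
  note ev = bad_events[OF N, folded sP, folded sets_eq_imp_space_eq[OF sP]]
  have "?B = {w \<in> space ?P. ennreal (t / 4) < tail R (emp N (move N (fst w) (snd w)))}
     \<union> {w \<in> space ?P. ennreal (t / 4) < tail R (Psi A \<delta> f \<theta> (emp N (fst w)))}
     \<union> (\<Union>S\<in>Pow (cells h R :: ('d \<Rightarrow> int) set). {w \<in> space ?P. t / (8 * R) \<le>
          \<bar>measure (emp N (move N (fst w) (snd w))) (\<Union>k\<in>S. cell h R k) - measure (Psi A \<delta> f \<theta> (emp N (fst w))) (\<Union>k\<in>S. cell h R k)\<bar>})"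
    by (auto simp: bad_def)
  also have "\<dots> \<in> sets ?P"
    using finite_cells by (intro sets.Un sets.finite_UN ev Union_cell_borel) auto
  finally have B: "?B \<in> sets ?P" .
  have eq: "{x \<in> space M. bad t R h N (Y N k x) (Z N (Suc k) x)} = ?YZ -` ?B \<inter> space M"
    using measurable_space[OF YZ] by auto
  show "{x \<in> space M. bad t R h N (Y N k x) (Z N (Suc k) x)} \<in> events"
    unfolding eq by (rule measurable_sets[OF YZ B])
  have "emeasure M {x \<in> space M. bad t R h N (Y N k x) (Z N (Suc k) x)} = emeasure (distr M ?P ?YZ) ?B"
    unfolding eq by (rule emeasure_distr[OF YZ B, symmetric])
  also have "\<dots> \<le> ennreal (8 / t * R powr (1 - p) * V
        + 2 ^ card (cells h R :: ('d \<Rightarrow> int) set) * (2 * exp (- 2 * real N * (t / (8 * R))\<^sup>2)))"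
    unfolding joint_law[OF N] by (rule bad_prob[OF N pL _ V moment_bound[OF N V V0] t R]) simp
  finally show "prob {x \<in> space M. bad t R h N (Y N k x) (Z N (Suc k) x)}
      \<le> 8 / t * R powr (1 - p) * V
        + 2 ^ card (cells h R :: ('d \<Rightarrow> int) set) * (2 * exp (- 2 * real N * (t / (8 * R))\<^sup>2))"
    unfolding emeasure_eq_measure using t V by (subst (asm) ennreal_le_iff) auto
qed

end

section \<open>Concentration\<close>

lemma exp_minus_le_inverse:
  fixes x y :: real
  assumes "0 < y" "y \<le> x" shows "exp (- x) \<le> 1 / y"
proof -
  have "y \<le> exp x" using exp_ge_add_one_self[of x] assms by linarith
  then show ?thesis using assms by (simp add: exp_minus divide_simps)
qed

text \<open>The inequality ln y \<le> y at y = q / a, multiplied by \<open>a\<close> and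
  exponentiated.\<close>

lemma powr_exp_minus_le:
  fixes a q :: real
  assumes "0 < a" "0 < q" shows "exp (- q) \<le> a powr a * q powr (- a)"
proof -
  have "ln (q / a) \<le> q / a" using ln_le_minus_one[of "q / a"] assms by simp
  then have "a * ln (q / a) \<le> q" using assms by (simp add: pos_le_divide_eq mult.commute)
  then have "exp (- q) \<le> exp (- a * ln (q / a))" by simp
  also have "\<dots> = (q / a) powr (- a)" using assms by (simp add: powr_def)
  also have "\<dots> = a powr a * q powr (- a)" using assms by (simp add: powr_divide powr_minus divide_simps)
  finally show ?thesis .
qed

text \<open>Here \<open>s\<close> is the threshold for \<open>j = 0\<close>, and \<open>R\<close>
  and \<open>h\<close> do not depend on \<open>j\<close>. Since \<open>2 * R / h = q / 2\<close> and
  \<open>q \<ge> 4\<close>, there are at most q^d cells. Since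
  \<open>t / (8 * R) = 2 * d * \<tau> ^ j / q\<close>, the Hoeffding exponent is at least 8 q^d
  \<tau>^(2j): of these eight shares one pays for the unions of cells, one yields the geometric
  factor, and six remain. In the tail term the geometric factor comes from
  \<open>8 / t\<close>.\<close>

lemma bad_bound_le:
  fixes q s \<tau> V p :: real and d j K :: nat
  assumes d: "1 \<le> d" and q: "4 \<le> q" and s: "0 < s" and \<tau>: "1 \<le> \<tau>" and V: "0 \<le> V" and p: "1 < p"
  defines "R \<equiv> q * s / (16 * real d)" and "h \<equiv> s / (4 * real d)" and "t \<equiv> s * \<tau> ^ j"
  assumes K: "real K \<le> (2 * R / h + 2) ^ d" and N: "N = q ^ (d + 2)"
  shows "8 / t * R powr (1 - p) * V + 2 ^ K * (2 * exp (- 2 * N * (t / (8 * R))\<^sup>2))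
    \<le> (8 * V * (16 * real d) powr (p - 1) * s powr (- p) * q powr (1 - p) + 2 * exp (- 6 * q ^ d)) * (1 / \<tau>) ^ j"
proof -
  have th: "1 \<le> \<tau> ^ j" using \<tau> by (simp add: one_le_power)
  have "R powr (1 - p) = (16 * real d) powr (p - 1) * s powr (1 - p) * q powr (1 - p)"
    using d q s unfolding R_def
    by (subst powr_divide) (auto simp: powr_mult powr_minus[of _ "p - 1", simplified] divide_simps)
  moreover have "s powr (1 - p) = s * s powr (- p)"
    using s by (simp add: powr_diff powr_minus divide_simps)
  ultimately have 1: "8 / t * R powr (1 - p) * V
      = 8 * V * (16 * real d) powr (p - 1) * s powr (- p) * q powr (1 - p) * (1 / \<tau>) ^ j"
    using s \<tau> by (simp add: t_def power_divide field_simps)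
  have q_d: "1 \<le> q ^ d" using q by (simp add: one_le_power)
  have "2 * R / h = q / 2"
    using s d by (simp add: R_def h_def field_simps)
  then have "2 * R / h + 2 \<le> q" "0 \<le> 2 * R / h + 2" using q by auto
  then have "real K \<le> q ^ d" using K power_mono[of "2 * R / h + 2" q d] by linarith
  moreover have "(2::real) ^ K \<le> exp (real K)"
    using power_mono[of 2 "exp 1 :: real" K] exp_ge_add_one_self[of 1] by (simp add: exp_of_nat_mult[of K 1, simplified])
  ultimately have K': "2 ^ K \<le> exp (q ^ d)" by (smt (verit) exp_le_cancel_iff)
  have "t / (8 * R) = 2 * real d * \<tau> ^ j / q"
    using s d q by (simp add: t_def R_def field_simps)
  then have "(t / (8 * R))\<^sup>2 = 4 * (real d)\<^sup>2 * (\<tau> ^ j)\<^sup>2 / q\<^sup>2"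
    by (simp only: power_divide power_mult_distrib) simp
  moreover have "N = q ^ d * q\<^sup>2" unfolding N by (rule power_add)
  ultimately have "2 * N * (t / (8 * R))\<^sup>2
      = 2 * (q ^ d * q\<^sup>2) * (4 * (real d)\<^sup>2 * (\<tau> ^ j)\<^sup>2 / q\<^sup>2)"
    by (simp only:)
  also have "\<dots> = 8 * (real d)\<^sup>2 * (q ^ d * (\<tau> ^ j)\<^sup>2)"
    using q by simp
  also have "\<dots> \<ge> 8 * 1 * (q ^ d * (\<tau> ^ j)\<^sup>2)"
    using d q by (intro mult_mono) (auto simp: one_le_power)
  finally have e: "8 * (q ^ d * (\<tau> ^ j)\<^sup>2) \<le> 2 * N * (t / (8 * R))\<^sup>2" by simp
  have sq: "\<tau> ^ j \<le> (\<tau> ^ j)\<^sup>2" using mult_left_mono[OF th, of "\<tau> ^ j"] th by (simp add: power2_eq_square)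
  have m: "q ^ d \<le> q ^ d * (\<tau> ^ j)\<^sup>2" "\<tau> ^ j \<le> q ^ d * (\<tau> ^ j)\<^sup>2"
    using q_d sq th mult_mono[of 1 "q ^ d" "\<tau> ^ j" "(\<tau> ^ j)\<^sup>2"] mult_left_mono[of 1 "(\<tau> ^ j)\<^sup>2" "q ^ d"] by auto
  have "2 ^ K * exp (- 2 * N * (t / (8 * R))\<^sup>2) \<le> exp (q ^ d) * exp (- 8 * (q ^ d * (\<tau> ^ j)\<^sup>2))"
    using K' e by (intro mult_mono) auto
  also have "\<dots> = exp (q ^ d - 8 * (q ^ d * (\<tau> ^ j)\<^sup>2))" by (simp flip: exp_add)
  \<comment> \<open>This amounts to 7 q^d \<le> 7 q^d \<tau>^(2j).\<close>
  also have "\<dots> \<le> exp (- 6 * q ^ d + - (q ^ d * (\<tau> ^ j)\<^sup>2))" using m by simp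
  also have "\<dots> = exp (- 6 * q ^ d) * exp (- (q ^ d * (\<tau> ^ j)\<^sup>2))" by (rule exp_add)
  also have "\<dots> \<le> exp (- 6 * q ^ d) * (1 / \<tau> ^ j)"
    using th m by (intro mult_left_mono exp_minus_le_inverse) auto
  finally have "2 ^ K * (2 * exp (- 2 * N * (t / (8 * R))\<^sup>2)) \<le> 2 * exp (- 6 * q ^ d) * (1 / \<tau>) ^ j"
    by (simp add: power_divide)
  with 1 show ?thesis by (simp only: distrib_right)
qed

section \<open>Propagation in time and the union bound\<close>

context particle_system
begin

lemma mu_nl_in_P1: "mu_nl A \<delta> f \<theta> \<mu>0 k \<in> P1"
  by (induction k) (auto intro: mu0 Psi_in_P1)

abbreviation W :: "nat \<Rightarrow> nat \<Rightarrow> 'w \<Rightarrow> real" where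
  "W N k x \<equiv> W1 (emp_particle A \<delta> f X0 eps N k x) (mu_nl A \<delta> f \<theta> \<mu>0 k)"

text \<open>\<open>Psi\<close> of the present empirical measure is the intermediate point: the
  distance to it is the fluctuation of this step, and from there on \<open>Psi\<close> contracts the
  old error.\<close>

lemma W_Suc_le:
  assumes N: "1 \<le> N" and "0 < t" "0 < R" "0 < h" "real CARD('d) * h \<le> t / 4"
    and good: "\<not> bad t R h N (Y N k x) (Z N (Suc k) x)"
  shows "W N (Suc k) x \<le> t + (\<kappa> + 2 * \<delta> * \<sigma>) * W N k x"
proof -
  let ?Y = "emp N (Y N k x)" and ?\<mu> = "mu_nl A \<delta> f \<theta> \<mu>0 k"
  have e: "emp_particle A \<delta> f X0 eps N (Suc k) x = emp N (move N (Y N k x) (Z N (Suc k) x))"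
    unfolding emp_Y[OF N, symmetric] using Y_Suc[OF N] by (intro emp_cong N) auto
  have "W N (Suc k) x \<le> W1 (emp N (move N (Y N k x) (Z N (Suc k) x))) (Psi A \<delta> f \<theta> ?Y) + W1 (Psi A \<delta> f \<theta> ?Y) (Psi A \<delta> f \<theta> ?\<mu>)"
    unfolding e mu_nl.simps by (intro W1_triangle emp_in_P1 Psi_in_P1 N mu_nl_in_P1)
  also have "\<dots> \<le> t + (\<kappa> + 2 * \<delta> * \<sigma>) * W1 ?Y ?\<mu>"
    using assms by (intro add_mono W1_step_le[where R=R and h=h] Psi_contraction emp_in_P1 mu_nl_in_P1) auto
  finally show ?thesis by (simp only: emp_Y[OF N])
qed

lemma W_measurable_0:
  assumes N: "1 \<le> N" shows "(\<lambda>x. W N 0 x) \<in> borel_measurable M"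
  unfolding emp_particle_def by (simp, intro W1_emp_measurable N mu0 X0_rv)

text \<open>The thresholds \<open>g * \<epsilon> * \<tau> ^ (n - Suc k)\<close> are such that, without bad events, the bound
  \<open>\<epsilon> * \<tau> ^ (n - k)\<close> on the distance at time \<open>k\<close> propagates to time \<open>Suc k\<close>.\<close>

lemma union_bound:
  assumes N: "1 \<le> N" and V: "0 \<le> V" "\<rho> * V + c\<^sub>0 \<le> V"
    and V0: "(\<integral>\<^sup>+x. ennreal (norm x powr p) \<partial>\<mu>0) \<le> ennreal V"
    and g: "0 < g" "g < 1" and kap: "0 < \<kappa> + 2 * \<delta> * \<sigma>" and th: "\<tau> = (1 - g) / (\<kappa> + 2 * \<delta> * \<sigma>)" "1 \<le> \<tau>"
    and eps: "0 < \<epsilon>" and R: "0 < R" and h: "0 < h" "real CARD('d) * h \<le> g * \<epsilon> / 4"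
  shows "prob {x \<in> space M. W N n x > \<epsilon>} \<le> prob {x \<in> space M. W N 0 x > g * \<tau> ^ n * \<epsilon>}
    + (\<Sum>j<n. 8 / (g * \<epsilon> * \<tau> ^ j) * R powr (1 - p) * V
        + 2 ^ card (cells h R :: ('d \<Rightarrow> int) set) * (2 * exp (- 2 * real N * (g * \<epsilon> * \<tau> ^ j / (8 * R))\<^sup>2)))"
proof (cases "{x \<in> space M. W N n x > \<epsilon>} \<in> events")
  case True
  define t where "t j = g * \<epsilon> * \<tau> ^ j" for j
  have t: "0 < t j" "real CARD('d) * h \<le> t j / 4" for j
  proof -
    show "0 < t j" using g eps th by (simp add: t_def)
    have "g * \<epsilon> * 1 \<le> t j" unfolding t_def using g eps th by (intro mult_left_mono) (auto simp: one_le_power)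
    then show "real CARD('d) * h \<le> t j / 4" using h by simp
  qed
  \<comment> \<open>Time is counted backwards: \<open>B j\<close> concerns the step that arrives at
    time \<open>n - j\<close>, so \<open>j\<close> further contractions act on its
    fluctuation.\<close>
  define B where "B j = {x \<in> space M. bad (t j) R h N (Y N (n - Suc j) x) (Z N (Suc (n - Suc j)) x)}" for j
  define I where "I = {x \<in> space M. W N 0 x > g * \<tau> ^ n * \<epsilon>}"
  have Bm: "B j \<in> events" and Bp: "prob (B j) \<le> 8 / t j * R powr (1 - p) * V
        + 2 ^ card (cells h R :: ('d \<Rightarrow> int) set) * (2 * exp (- 2 * real N * (t j / (8 * R))\<^sup>2))" for j
    unfolding B_def by (rule bad_event_prob[OF N V V0 t(1) R])+
  have Im: "I \<in> events"
    using W_measurable_0[OF N] unfolding I_def by measurable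
  have "{x \<in> space M. W N n x > \<epsilon>} \<subseteq> I \<union> (\<Union>j<n. B j)"
  proof (rule subsetI, rule ccontr)
    fix x assume x: "x \<in> {x \<in> space M. W N n x > \<epsilon>}" "x \<notin> I \<union> (\<Union>j<n. B j)"
    have "W N k x \<le> \<epsilon> * \<tau> ^ (n - k)" if "k \<le> n" for k
      using that
    proof (induction k)
      case 0
      have "W N 0 x \<le> g * \<tau> ^ n * \<epsilon>" using x by (auto simp: I_def)
      also have "\<dots> \<le> 1 * \<tau> ^ n * \<epsilon>" using g th eps by (intro mult_right_mono) auto
      finally show ?case by (simp add: mult.commute)
    next
      case (Suc k)
      define j where "j = n - Suc k"
      have j: "j < n" "n - Suc j = k" "n - k = Suc j" using Suc.prems by (auto simp: j_def)
      have "\<not> bad (t j) R h N (Y N k x) (Z N (Suc k) x)"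
        using x j by (auto simp: B_def)
      then have "W N (Suc k) x \<le> t j + (\<kappa> + 2 * \<delta> * \<sigma>) * W N k x"
        using t R h by (intro W_Suc_le[OF N, where R=R and h=h]) auto
      also have "\<dots> \<le> t j + (\<kappa> + 2 * \<delta> * \<sigma>) * (\<epsilon> * \<tau> ^ (n - k))"
        using Suc kap by (intro add_left_mono mult_left_mono) auto
      also have "\<dots> = t j + ((\<kappa> + 2 * \<delta> * \<sigma>) * \<tau>) * (\<epsilon> * \<tau> ^ j)"
        by (simp add: j)
      \<comment> \<open>The reason for the value of \<open>\<tau>\<close>: the propagated error
        takes the share \<open>1 - g\<close> of the bound and leaves \<open>g\<close> to the new
        fluctuation.\<close>
      also have "(\<kappa> + 2 * \<delta> * \<sigma>) * \<tau> = 1 - g" using kap th by simp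
      also have "t j + (1 - g) * (\<epsilon> * \<tau> ^ j) = \<epsilon> * \<tau> ^ (n - Suc k)"
        by (simp add: t_def j_def algebra_simps)
      finally show ?case .
    qed
    from this[of n] x show False by simp
  qed
  then have "prob {x \<in> space M. W N n x > \<epsilon>} \<le> prob (I \<union> (\<Union>j<n. B j))"
    using Im Bm by (intro finite_measure_mono) auto
  also have "\<dots> \<le> prob I + prob (\<Union>j<n. B j)"
    using Im Bm by (intro measure_Un_le) auto
  also have "prob (\<Union>j<n. B j) \<le> (\<Sum>j<n. prob (B j))"
    using Bm by (intro finite_measure_subadditive_finite) auto
  also have "(\<Sum>j<n. prob (B j)) \<le> (\<Sum>j<n. 8 / t j * R powr (1 - p) * V
        + 2 ^ card (cells h R :: ('d \<Rightarrow> int) set) * (2 * exp (- 2 * real N * (t j / (8 * R))\<^sup>2)))"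
    by (intro sum_mono Bp)
  finally show ?thesis by (simp add: I_def t_def)
next
  \<comment> \<open>The measure of a set outside the \<sigma>-algebra is 0 by definition, and the
    right-hand side is nonnegative.\<close>
  case False
  have "0 \<le> (\<Sum>j<n. 8 / (g * \<epsilon> * \<tau> ^ j) * R powr (1 - p) * V
        + 2 ^ card (cells h R :: ('d \<Rightarrow> int) set) * (2 * exp (- 2 * real N * (g * \<epsilon> * \<tau> ^ j / (8 * R))\<^sup>2)))"
    using g eps th V by (intro sum_nonneg add_nonneg_nonneg mult_nonneg_nonneg) auto
  with False show ?thesis by (simp add: measure_notin_sets)
qed

lemma concentration:
  fixes g \<tau> :: real
  assumes V0: "(\<integral>\<^sup>+x. ennreal (norm x powr p) \<partial>\<mu>0) < \<infinity>" and rho: "\<rho> < 1"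
    and g: "0 < g" "g < 1" and kap: "0 < \<kappa> + 2 * \<delta> * \<sigma>" and th: "\<tau> = (1 - g) / (\<kappa> + 2 * \<delta> * \<sigma>)" "1 < \<tau>"
  shows "\<exists>N0::nat. \<exists>C1::real. C1 > 0 \<and> (\<forall>\<epsilon>>0. \<forall>n N.
      real N > real N0 * (max 1 (max (ln \<epsilon>) 0)) powr ((real CARD('d) + 2) / real CARD('d)) \<longrightarrow>
      prob {x \<in> space M. W N n x > \<epsilon>} \<le> prob {x \<in> space M. W N 0 x > g * \<tau> ^ n * \<epsilon>}
        + C1 * \<epsilon> powr (- p) * real N powr (- (p - 1) / (real CARD('d) + 2)))"
proof -
  define d where "d = CARD('d)"
  have d: "1 \<le> d" by (simp add: d_def Suc_leI)
  \<comment> \<open>The second summand is the fixed point of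
    \<open>v \<mapsto> \<rho> * v + c\<^sub>0\<close>; everything above it is mapped below itself,
    so the initial moment may be added.\<close>
  define V where "V = enn2real (\<integral>\<^sup>+x. ennreal (norm x powr p) \<partial>\<mu>0) + c\<^sub>0 / (1 - \<rho>)"
  have V: "0 \<le> V" "\<rho> * V + c\<^sub>0 \<le> V"
  proof -
    have "0 \<le> c\<^sub>0 / (1 - \<rho>)" using rho_nonneg rho by simp
    then show "0 \<le> V" by (simp add: V_def)
    have "c\<^sub>0 = (1 - \<rho>) * (c\<^sub>0 / (1 - \<rho>))" using rho by simp
    also have "\<dots> \<le> (1 - \<rho>) * V" unfolding V_def using rho by (intro mult_left_mono) auto
    finally show "\<rho> * V + c\<^sub>0 \<le> V" by (simp add: algebra_simps)
  qed
  have V0': "(\<integral>\<^sup>+x. ennreal (norm x powr p) \<partial>\<mu>0) \<le> ennreal V"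
  proof -
    have "(\<integral>\<^sup>+x. ennreal (norm x powr p) \<partial>\<mu>0) = ennreal (enn2real (\<integral>\<^sup>+x. ennreal (norm x powr p) \<partial>\<mu>0))"
      using V0 by simp
    also have "\<dots> \<le> ennreal V" unfolding V_def using rho_nonneg rho by (intro ennreal_leI) simp
    finally show ?thesis .
  qed
  define G where "G = 1 / (1 - 1 / \<tau>)"
  have G: "0 < G" using th(2) by (simp add: G_def)
  \<comment> \<open>After taking the root of order \<open>d + 2\<close>, the condition on
    \<open>N\<close> reads \<open>(p + 4) * m powr (1 / d) \<le> q\<close>. The summand 4 gives
    \<open>q \<ge> 4\<close>, and \<open>p\<close> gives \<open>p * m \<le> q ^ d\<close>.\<close>
  define N0 where "N0 = nat \<lceil>(p + 4) ^ (d + 2)\<rceil>"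
  \<comment> \<open>\<open>G\<close> sums the geometric series; in the bracket stand the constants
    of the tails and of the exponential term.\<close>
  define C1 where "C1 = G * (8 * V * (16 * real d) powr (p - 1) * g powr (- p) + 2 * (p - 1) powr (p - 1))"
  have C1: "0 < C1" unfolding C1_def using G V p by (intro mult_pos_pos add_nonneg_pos) auto
  show ?thesis
  proof (intro exI[of _ N0] exI[of _ C1] conjI C1 allI impI)
    fix \<epsilon> :: real and n N :: nat
    assume eps: "0 < \<epsilon>" and N: "real N > real N0 * (max 1 (max (ln \<epsilon>) 0)) powr ((real CARD('d) + 2) / real CARD('d))"
    define m where "m = max 1 (max (ln \<epsilon>) 0)"
    have m: "1 \<le> m" "ln \<epsilon> \<le> m" by (auto simp: m_def)
    have N0: "(p + 4) ^ (d + 2) \<le> real N0" unfolding N0_def by linarith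
    have Nm: "(p + 4) ^ (d + 2) * m powr ((real d + 2) / real d) < real N"
      using N mult_right_mono[OF N0, of "m powr ((real d + 2) / real d)"] by (simp add: m_def d_def)
    have mp: "1 \<le> m powr ((real d + 2) / real d)" using m by (intro ge_one_powr_ge_zero) auto
    have Np: "0 < real N"
    proof -
      have "0 \<le> (p + 4) ^ (d + 2) * m powr ((real d + 2) / real d)" using p by auto
      then show ?thesis using Nm by linarith
    qed
    define q where "q = real N powr (1 / (real d + 2))"
    have qpos: "0 < q" using Np by (simp add: q_def)
    have qN: "real N = q ^ (d + 2)"
    proof -
      have "q ^ (d + 2) = q powr (real d + 2)"
        using powr_realpow[OF qpos, of "d + 2"] by (simp add: add.commute)
      then show ?thesis using Np by (simp add: q_def powr_powr)
    qed
    have root: "((p + 4) ^ (d + 2) * m powr ((real d + 2) / real d)) powr (1 / (real d + 2)) = (p + 4) * m powr (1 / real d)"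
    proof -
      have "((p + 4) ^ (d + 2)) powr (1 / (real d + 2)) = p + 4"
      proof -
        have "(p + 4) ^ (d + 2) = (p + 4) powr (real d + 2)"
          using powr_realpow[of "p + 4" "d + 2"] p by (simp add: add.commute)
        then show ?thesis using p by (simp only: powr_powr) simp
      qed
      moreover have "(m powr ((real d + 2) / real d)) powr (1 / (real d + 2)) = m powr (1 / real d)"
        using d by (simp add: powr_powr)
      ultimately show ?thesis using p by (simp add: powr_mult)
    qed
    have q_ge: "(p + 4) * m powr (1 / real d) \<le> q"
      unfolding root[symmetric] q_def using Nm p by (intro powr_mono2) auto
    have m1: "1 \<le> m powr (1 / real d)" using m by (intro ge_one_powr_ge_zero) auto
    have q4: "4 \<le> q"
    proof -
      have "4 * 1 \<le> (p + 4) * m powr (1 / real d)" using m1 p by (intro mult_mono) auto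
      then show ?thesis using q_ge by linarith
    qed
    have qd: "p * m \<le> q ^ d"
    proof -
      have "p * m \<le> (p + 4) ^ d * m"
        using p m d self_le_power[of "p + 4" d] by (intro mult_right_mono) auto
      also have "\<dots> = ((p + 4) * m powr (1 / real d)) ^ d"
        using m d by (simp add: power_mult_distrib powr_powr flip: powr_realpow)
      also have "\<dots> \<le> q ^ d" using q_ge p by (intro power_mono) auto
      finally show ?thesis .
    qed
    have N1: "1 \<le> N" using Np by simp
    define s where "s = g * \<epsilon>"
    have s: "0 < s" using g eps by (simp add: s_def)
    define R where "R = q * s / (16 * real d)"
    define h where "h = s / (4 * real d)"
    have R: "0 < R" and h: "0 < h" "real CARD('d) * h \<le> g * \<epsilon> / 4"
      using qpos s d by (auto simp: R_def h_def s_def d_def[symmetric])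
    define D where "D = 8 * V * (16 * real d) powr (p - 1) * s powr (- p) * q powr (1 - p) + 2 * exp (- 6 * q ^ d)"
    have D: "0 \<le> D" unfolding D_def using V by simp
    have "prob {x \<in> space M. W N n x > \<epsilon>} \<le> prob {x \<in> space M. W N 0 x > g * \<tau> ^ n * \<epsilon>}
      + (\<Sum>j<n. 8 / (g * \<epsilon> * \<tau> ^ j) * R powr (1 - p) * V
        + 2 ^ card (cells h R :: ('d \<Rightarrow> int) set) * (2 * exp (- 2 * real N * (g * \<epsilon> * \<tau> ^ j / (8 * R))\<^sup>2)))"
      by (rule union_bound[OF N1 V V0' g kap th(1) _ eps R h]) (use th in simp)
    also have "(\<Sum>j<n. 8 / (g * \<epsilon> * \<tau> ^ j) * R powr (1 - p) * V
        + 2 ^ card (cells h R :: ('d \<Rightarrow> int) set) * (2 * exp (- 2 * real N * (g * \<epsilon> * \<tau> ^ j / (8 * R))\<^sup>2)))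
      \<le> (\<Sum>j<n. D * (1 / \<tau>) ^ j)"
    proof (rule sum_mono)
      fix j
      have "real (card (cells h R :: ('d \<Rightarrow> int) set)) \<le> (2 * R / h + 2) ^ d"
        unfolding d_def using card_cells_le[of h R] h R by auto
      then show "8 / (g * \<epsilon> * \<tau> ^ j) * R powr (1 - p) * V
        + 2 ^ card (cells h R :: ('d \<Rightarrow> int) set) * (2 * exp (- 2 * real N * (g * \<epsilon> * \<tau> ^ j / (8 * R))\<^sup>2)) \<le> D * (1 / \<tau>) ^ j"
        using bad_bound_le[OF d q4 s _ V(1) p _ qN, where j=j and \<tau>=\<tau> and K="card (cells h R :: ('d \<Rightarrow> int) set)"] th(2)
        unfolding D_def R_def h_def s_def by simp
    qed
    also have "\<dots> = D * (\<Sum>j<n. (1 / \<tau>) ^ j)" by (simp add: sum_distrib_left)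
    also have "\<dots> \<le> D * G"
    proof (rule mult_left_mono[OF _ D])
      have "(\<Sum>j<n. (1 / \<tau>) ^ j) = (1 - (1 / \<tau>) ^ n) / (1 - 1 / \<tau>)"
        using th(2) by (simp add: sum_gp_strict)
      also have "\<dots> \<le> G" unfolding G_def using th(2) by (intro divide_right_mono) auto
      finally show "(\<Sum>j<n. (1 / \<tau>) ^ j) \<le> G" .
    qed
    also have "D \<le> (8 * V * (16 * real d) powr (p - 1) * g powr (- p) + 2 * (p - 1) powr (p - 1)) * (\<epsilon> powr (- p) * q powr (1 - p))"
    proof -
      \<comment> \<open>One share of the exponent becomes \<open>\<epsilon> powr (- p)\<close>, the
        use of the logarithmic condition on \<open>N\<close>; one becomes the power of
        \<open>q\<close>; the rest is at most 1.\<close>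
      have "exp (- 6 * q ^ d) = exp (- (q ^ d)) * exp (- (q ^ d)) * exp (- 4 * q ^ d)"
        by (simp flip: exp_add)
      also have "\<dots> \<le> \<epsilon> powr (- p) * ((p - 1) powr (p - 1) * q powr (- (p - 1))) * 1"
      proof (intro mult_mono)
        have "p * ln \<epsilon> \<le> q ^ d" using qd mult_left_mono[OF m(2), of p] p by linarith
        then show "exp (- (q ^ d)) \<le> \<epsilon> powr (- p)" using eps by (simp add: powr_def)
        have "q \<le> q ^ d" using q4 d by (intro self_le_power) auto
        then have "exp (- (q ^ d)) \<le> exp (- q)" by simp
        also have "\<dots> \<le> (p - 1) powr (p - 1) * q powr (- (p - 1))" using p qpos by (intro powr_exp_minus_le) auto
        finally show "exp (- (q ^ d)) \<le> (p - 1) powr (p - 1) * q powr (- (p - 1))" .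
        show "exp (- 4 * q ^ d) \<le> 1" using qpos by simp
      qed auto
      finally have "2 * exp (- 6 * q ^ d) \<le> 2 * (p - 1) powr (p - 1) * (\<epsilon> powr (- p) * q powr (1 - p))"
        by (simp add: mult_ac)
      moreover have "s powr (- p) = g powr (- p) * \<epsilon> powr (- p)"
        using g eps by (simp add: s_def powr_mult)
      ultimately show ?thesis unfolding D_def by (simp add: algebra_simps)
    qed
    also have "q powr (1 - p) = real N powr (- (p - 1) / (real CARD('d) + 2))"
      by (simp add: q_def powr_powr d_def)
    finally show "prob {x \<in> space M. W N n x > \<epsilon>} \<le> prob {x \<in> space M. W N 0 x > g * \<tau> ^ n * \<epsilon>}
        + C1 * \<epsilon> powr (- p) * real N powr (- (p - 1) / (real CARD('d) + 2))"
      using G by (simp add: C1_def mult_ac mult_right_mono)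
  qed
qed

end

section \<open>The theorem from the abstract concentration bound\<close>

theorem theorem3p7:
  fixes A :: "real^'d^'d" and \<delta> \<omega> \<alpha> \<gamma>0 :: real
    and \<theta> :: "(real^'m) measure" and \<mu>0 :: "(real^'d) measure"
    and f :: "real^'d \<Rightarrow> (real^'d) measure \<Rightarrow> real^'m \<Rightarrow> real^'d"
    and M :: "'w measure"
    and X0 :: "nat \<Rightarrow> nat \<Rightarrow> 'w \<Rightarrow> real^'d"
    and eps :: "nat \<Rightarrow> nat \<Rightarrow> 'w \<Rightarrow> real^'m"
  assumes theta: "prob_space \<theta>" "sets \<theta> = sets borel"
    and mu0: "\<mu>0 \<in> P1"
    and f_meas: "(\<lambda>(x, \<mu>, z). f x \<mu> z) \<in>
        borel \<Otimes>\<^sub>M (restrict_space (subprob_algebra borel) P1 \<Otimes>\<^sub>M borel) \<rightarrow>\<^sub>M borel"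
    and M: "prob_space M"
    and X0_rv: "\<And>N i. N \<ge> 1 \<Longrightarrow> i \<in> {1..N} \<Longrightarrow> X0 N i \<in> M \<rightarrow>\<^sub>M borel"
    and X0_law: "\<And>N i. N \<ge> 1 \<Longrightarrow> i \<in> {1..N} \<Longrightarrow> distr M borel (X0 N i) = \<mu>0"
    and X0_exch: "\<And>N p. N \<ge> 1 \<Longrightarrow> p permutes {1..N} \<Longrightarrow>
        distr M (PiM {1..N} (\<lambda>_. borel)) (\<lambda>s. \<lambda>i\<in>{1..N}. X0 N (p i) s)
      = distr M (PiM {1..N} (\<lambda>_. borel)) (\<lambda>s. \<lambda>i\<in>{1..N}. X0 N i s)"
    and eps_rv: "\<And>n i. n \<ge> 1 \<Longrightarrow> i \<ge> 1 \<Longrightarrow> eps n i \<in> M \<rightarrow>\<^sub>M borel"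
    and eps_law: "\<And>n i. n \<ge> 1 \<Longrightarrow> i \<ge> 1 \<Longrightarrow> distr M borel (eps n i) = \<theta>"
    and eps_indep: "prob_space.indep_vars M (\<lambda>_. borel) (\<lambda>(n, i). eps n i) ({1..} \<times> {1..})"
    and indep_init: "\<And>N. N \<ge> 1 \<Longrightarrow> prob_space.indep_set M
        (sets (vimage_algebra (space M) (\<lambda>s. \<lambda>i\<in>{1..N}. X0 N i s) (PiM {1..N} (\<lambda>_. borel))))
        (sets (vimage_algebra (space M) (\<lambda>s. \<lambda>(n, i)\<in>{1..} \<times> {1..}. eps n i s)
            (PiM ({1..} \<times> {1..}) (\<lambda>_. borel))))"
    and A3: "\<omega> > 0" "onorm (\<lambda>x. A *v x) \<le> exp (- \<omega>)"
    and A4: "\<alpha> > 0"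
      "(\<integral>\<^sup>+x. ennreal (norm x powr (1 + \<alpha>)) \<partial>\<mu>0) < \<infinity>"
      "(\<integral>\<^sup>+z. enn_powr (Dlip f z) (1 + \<alpha>) \<partial>\<theta>) < \<infinity>"
      "(\<integral>\<^sup>+z. ennreal (D1 f z powr (1 + \<alpha>)) \<partial>\<theta>) < \<infinity>"
    and gamma0: "0 < \<gamma>0" "\<gamma>0 < a0 \<omega> (sigma f \<theta>)"
    and delta: "0 < \<delta>"
      "0 < a_alpha \<omega> (sigma1 f \<theta> \<alpha>) \<alpha>"
      "\<delta> < a_alpha \<omega> (sigma1 f \<theta> \<alpha>) \<alpha> powr (1 / (1 + \<alpha>))"
      "\<delta> < a0 \<omega> (sigma f \<theta>) - \<gamma>0"
  shows "\<exists>N0::nat. \<exists>C1::real. C1 > 0 \<and>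
    (\<forall>\<epsilon>::real. \<epsilon> > 0 \<longrightarrow> (\<forall>n N::nat.
      real N > real N0 * (max 1 (max (ln \<epsilon>) 0)) powr ((real CARD('d) + 2) / real CARD('d)) \<longrightarrow>
      measure M {s\<in>space M. W1 (emp_particle A \<delta> f X0 eps N n s) (mu_nl A \<delta> f \<theta> \<mu>0 n) > \<epsilon>}
      \<le> measure M {s\<in>space M. W1 (emp_particle A \<delta> f X0 eps N 0 s) \<mu>0 >
              2 * sigma f \<theta> * \<gamma>0
              * ((1 - 2 * sigma f \<theta> * \<gamma>0) / (exp (- \<omega>) + 2 * \<delta> * sigma f \<theta>)) ^ n * \<epsilon>}
        + C1 * \<epsilon> powr (- (1 + \<alpha>)) * real N powr (- \<alpha> / (real CARD('d) + 2))))"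
proof -
  define p where "p = 1 + \<alpha>"
  define \<sigma> where "\<sigma> = sigma f \<theta>"
  define s1 where "s1 = sigma1 f \<theta> \<alpha>"
  define \<kappa> where "\<kappa> = exp (- \<omega>)"
  have p: "1 < p" "p - 1 = \<alpha>" using A4(1) by (auto simp: p_def)
  have \<kappa>: "0 < \<kappa>" "\<kappa> < 1" using A3(1) by (auto simp: \<kappa>_def)
  have "0 \<le> \<sigma>" "0 \<le> s1" by (auto simp: \<sigma>_def s1_def sigma_def sigma1_def)
  \<comment> \<open>Division by 0 yields 0, so \<open>\<sigma> = 0\<close> would make
    \<open>a0\<close> equal to 0, against \<open>gamma0\<close>; likewise for \<open>s1\<close> and
    \<open>a_alpha\<close>.\<close>
  moreover have "\<sigma> \<noteq> 0" using gamma0 by (auto simp: \<sigma>_def a0_def)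
  moreover have "s1 \<noteq> 0" using delta(2) by (auto simp: s1_def a_alpha_def)
  ultimately have pos: "0 < \<sigma>" "0 < s1" by auto
  have D1: "(\<integral>\<^sup>+z. enn_powr (Dlip f z) 1 \<partial>\<theta>) \<le> ennreal \<sigma>"
  proof -
    \<comment> \<open>\<open>enn2real\<close> maps \<infinity> to 0, so the positivity of
      \<open>\<sigma>\<close> already shows that the integral is finite.\<close>
    have "(\<integral>\<^sup>+z. Dlip f z \<partial>\<theta>) \<noteq> \<infinity>" using pos(1) by (auto simp: \<sigma>_def sigma_def)
    then have "(\<integral>\<^sup>+z. Dlip f z \<partial>\<theta>) = ennreal \<sigma>" by (simp add: \<sigma>_def sigma_def less_top)
    moreover have "enn_powr x 1 = x" for x by (simp add: enn_powr_def less_top)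
    ultimately show ?thesis by simp
  qed
  have Dp: "(\<integral>\<^sup>+z. enn_powr (Dlip f z) p \<partial>\<theta>) \<le> ennreal s1"
    using A4(3) by (simp add: s1_def sigma1_def p_def)
  note sec = section_measurable[OF f_meas theta(2)]
  interpret S: particle_system A \<delta> \<kappa> \<sigma> s1 p \<theta> f M X0 eps \<mu>0
  proof (intro particle_system.intro mean_field.intro particle_system_axioms.intro)
    show "norm (A *v x) \<le> \<kappa> * norm x" for x
      using onorm[OF matrix_vector_mul_bounded_linear, of A x] A3(2) mult_right_mono[OF A3(2) norm_ge_zero, of x]
      unfolding \<kappa>_def by linarith
    show "(\<integral>\<^sup>+z. ennreal (norm (f x1 \<mu>1 z - f x2 \<mu>2 z)) \<partial>\<theta>) \<le> ennreal (\<sigma> * (dist x1 x2 + W1 \<mu>1 \<mu>2))"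
      if "\<mu>1 \<in> P1" "\<mu>2 \<in> P1" for x1 x2 \<mu>1 \<mu>2
      using nn_integral_Dlip_bound[of f \<theta>, OF sec that _ D1, of x1 x2] pos W1_nonneg[of \<mu>1 \<mu>2] by simp
    show "(\<integral>\<^sup>+z. ennreal (norm (f x1 \<mu>1 z - f x2 \<mu>2 z) powr p) \<partial>\<theta>) \<le> ennreal (s1 * (dist x1 x2 + W1 \<mu>1 \<mu>2) powr p)"
      if "\<mu>1 \<in> P1" "\<mu>2 \<in> P1" for x1 x2 \<mu>1 \<mu>2
      using nn_integral_Dlip_bound[of f \<theta>, OF sec that _ Dp, of x1 x2] pos p by simp
    show "(\<integral>\<^sup>+z. ennreal (norm (f 0 (return borel 0) z) powr p) \<partial>\<theta>) < \<infinity>"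
      using A4(4) by (simp add: D1_def p_def)
  qed (use assms pos \<kappa> p in auto)
  define g where "g = 2 * \<sigma> * \<gamma>0"
  have kap: "\<kappa> + 2 * \<delta> * \<sigma> < 1 - g"
  proof -
    \<comment> \<open>Multiplied by \<open>2 * \<sigma>\<close>, the condition on
      \<open>\<delta> + \<gamma>0\<close> becomes the statement that the ratio of the theorem
      exceeds 1.\<close>
    have "(\<delta> + \<gamma>0) * (2 * \<sigma>) < a0 \<omega> \<sigma> * (2 * \<sigma>)"
      using delta(4) pos by (intro mult_strict_right_mono) (auto simp: \<sigma>_def)
    also have "a0 \<omega> \<sigma> * (2 * \<sigma>) = 1 - \<kappa>" using pos by (simp add: a0_def \<kappa>_def)
    finally show ?thesis by (simp add: g_def algebra_simps)
  qed
  have k0: "0 < \<kappa> + 2 * \<delta> * \<sigma>" using \<kappa> delta(1) pos by (simp add: add_pos_pos)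
  have g: "0 < g" "g < 1" using pos gamma0(1) kap k0 by (auto simp: g_def)
  have "S.\<rho> < 1"
  proof -
    define a where "a = a_alpha \<omega> s1 \<alpha>"
    have \<kappa>p: "\<kappa> powr p = exp (- (1 + \<alpha>) * \<omega>)"
      by (simp add: \<kappa>_def p_def exp_powr_real algebra_simps)
    \<comment> \<open>The bound on \<open>\<delta>\<close> by the root of \<open>a_alpha\<close> is
      \<open>\<rho> < 1\<close> solved for \<open>\<delta>\<close>.\<close>
    have "\<delta> powr p < (a powr (1 / p)) powr p"
      using delta p by (intro powr_less_mono2) (auto simp: a_def s1_def p_def)
    also have "\<dots> = a" using delta(2) p by (simp add: powr_powr a_def s1_def)
    finally have "2 * s1 * \<delta> powr p < 2 * s1 * a" using pos by simp
    also have "2 * s1 * a = 4 powr (- \<alpha>) - \<kappa> powr p"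
      using pos by (simp add: a_def a_alpha_def \<kappa>p)
    finally have "\<kappa> powr p + 2 * \<delta> powr p * s1 < 4 powr (- \<alpha>)" by (simp add: algebra_simps)
    then have "4 powr \<alpha> * (\<kappa> powr p + 2 * \<delta> powr p * s1) < 4 powr \<alpha> * 4 powr (- \<alpha>)" by simp
    then show ?thesis by (simp add: S.\<rho>_def p(2) flip: powr_add)
  qed
  then show ?thesis
    using S.concentration[of g "(1 - g) / (\<kappa> + 2 * \<delta> * \<sigma>)"] A4(2) g k0 kap
    by (simp add: p_def g_def \<sigma>_def \<kappa>_def less_divide_eq)
qed

end
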